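(* Let $n\ge 3$, $\rho\in\{1,-1\}$, and let $V$ be a finite-dimensional irreducible representation of the complex Lie algebra $\mathfrak{g}_{2n,\rho}(\mathbb{C}_q)$ with $\dim V\ge 2$, where $\mathbb{C}_q$ is the quantum torus with involution attached to a triple $(q,\theta_1,\theta_2)\in\mathcal{P}$. Let $\mathrm{Ann}(V)=\{x\in\mathfrak{g}_{2n,\rho}(\mathbb{C}_q) : x.V=0\}$. (1) If $q=-1$ or $(q,\theta_1,\theta_2)=(1,1,1)$, then there exists an integer $k\ge 0$ such that $$\mathfrak{g}_{2n,\rho}(\mathbb{C}_q)/\mathrm{Ann}(V)\cong \mathfrak{g}_{2mn,\theta_1\rho}(\mathbb{C})^{k},$$ where $m$ is the multiplicative order of $q$ and $\mathbb{C}$ carries the identity involution. (2) If $(q,\theta_1,\theta_2)=(1,1,-1)$ or $(1,-1,-1)$, then there exists an integer $k\ge 0$ such that $$\mathfrak{g}_{2n,\rho}(\mathbb{C}_q)/\mathrm{Ann}(V)\cong \mathfrak{sl}_{2n}(\mathbb{C})^{k}.$$ Here a power $\mathfrak{a}^k$ of a Lie algebra denotes the direct sum of $k$ copies, and isomorphisms are of Lie algebras.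
   Context: Lie algebra $\mathfrak{g}_{2n,\rho}(R)$: let $R$ be a unital associative algebra over a field $k$ of characteristic $0$ with an involution, i.e. a $k$-linear map $a\mapsto\bar a$ with $\overline{ab}=\bar b\,\bar a$ and $\bar{\bar a}=a$. For $\rho\in\{1,-1\}$, $n\ge1$, $a\in R$, let $e_{ij}(a)\in\mathfrak{gl}_{2n}(R)$ be the matrix with $a$ in position $(i,j)$ and $0$ elsewhere, and for $1\le i,j\le n$ put $f_{ij}(a)=e_{ij}(a)-e_{n+j,n+i}(\bar a)$, $g_{ij}(a)=e_{i,n+j}(a)-\rho e_{j,n+i}(\bar a)$, $h_{ij}(a)=e_{n+i,j}(a)-\rho e_{n+j,i}(\bar a)$. Then $\mathfrak{g}_{2n,\rho}(R)$ is the Lie subalgebra of $\mathfrak{gl}_{2n}(R)$ generated by all $f_{ij}(a)$ ($1\le i\ne j\le n$), $g_{ij}(a)$, $h_{ij}(a)$ ($1\le i\le j\le n$), $a\in R$. Quantum torus: for $q\in\{1,-1\}$, $\mathbb{C}_q$ is the associative $\mathbb{C}$-algebra generated by $t_1^{\pm1},t_2^{\pm1}$ with relations $t_it_i^{-1}=t_i^{-1}t_i=1$ and $t_2t_1=qt_1t_2$; $m$ is the order of $q$ ($m=1$ if $q=1$, $m=2$ if $q=-1$). It carries the $\mathbb{C}$-linear involution with $\overline{t_1}=\theta_1t_1$, $\overline{t_2}=\theta_2t_2$, where $\theta_1,\theta_2\in\{1,-1\}$. $\mathcal{P}=\{(-1,1,1),(-1,1,-1),(-1,-1,-1),(1,1,1),(1,1,-1),(1,-1,-1)\}$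 is the set of triples $(q,\theta_1,\theta_2)$ considered. *)

theory Defs
  imports
    Complex_Main
    "HOL-Library.FuncSet"
    "HOL-Library.Poly_Mapping"
    "HOL-Library.Product_Plus"
begin

section \<open>Associative algebras with involution\<close>

text \<open>The underlying additive group is that of the type; the record holds the remaining operations.\<close>

record ('k, 'r) inv_algebra =
  amult :: "'r \<Rightarrow> 'r \<Rightarrow> 'r"
  aone :: 'r
  ascale :: "'k \<Rightarrow> 'r \<Rightarrow> 'r"
  astar :: "'r \<Rightarrow> 'r"

locale inv_algebra =
  fixes R :: "('k::field_char_0, 'r::ab_group_add) inv_algebra"
  assumes scale: "vector_space (ascale R)"
    and mult_assoc: "amult R (amult R a b) c = amult R a (amult R b c)"
    and one_mult: "amult R (aone R) a = a"
    and mult_one: "amult R a (aone R) = a"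
    and mult_add_left: "amult R (a + b) c = amult R a c + amult R b c"
    and mult_add_right: "amult R a (b + c) = amult R a b + amult R a c"
    and mult_scale_left: "amult R (ascale R k a) b = ascale R k (amult R a b)"
    and mult_scale_right: "amult R a (ascale R k b) = ascale R k (amult R a b)"
    and star_add: "astar R (a + b) = astar R a + astar R b"
    and star_scale: "astar R (ascale R k a) = ascale R k (astar R a)"
    and star_mult: "astar R (amult R a b) = amult R (astar R b) (astar R a)"
    and star_star: "astar R (astar R a) = a"

definition complex_algebra :: "(complex, complex) inv_algebra" where
  "complex_algebra = \<lparr>amult = (*), aone = 1, ascale = (*), astar = (\<lambda>z. z)\<rparr>"

lemma inv_algebra_complex: "inv_algebra complex_algebra"
  by standard (auto simp: complex_algebra_def algebra_simps vector_space_def)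


section \<open>Lie algebras\<close>

record ('k, 'a) lie_algebra =
  lcarrier :: "'a set"
  lzero :: 'a
  ladd :: "'a \<Rightarrow> 'a \<Rightarrow> 'a"
  lscale :: "'k \<Rightarrow> 'a \<Rightarrow> 'a"
  lbracket :: "'a \<Rightarrow> 'a \<Rightarrow> 'a"

definition lie_subalgebra :: "'a set \<Rightarrow> ('k, 'a) lie_algebra \<Rightarrow> bool" where
  "lie_subalgebra H L \<longleftrightarrow> H \<subseteq> lcarrier L \<and> lzero L \<in> H \<and>
     (\<forall>x\<in>H. \<forall>y\<in>H. ladd L x y \<in> H) \<and> (\<forall>c. \<forall>x\<in>H. lscale L c x \<in> H) \<and>
     (\<forall>x\<in>H. \<forall>y\<in>H. lbracket L x y \<in> H)"

definition lie_generate :: "('k, 'a) lie_algebra \<Rightarrow> 'a set \<Rightarrow> ('k, 'a) lie_algebra" where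
  "lie_generate L S = L\<lparr>lcarrier := \<Inter>{H. lie_subalgebra H L \<and> S \<subseteq> H}\<rparr>"

definition lie_isomorphic :: "('k, 'a) lie_algebra \<Rightarrow> ('k, 'b) lie_algebra \<Rightarrow> bool" where
  "lie_isomorphic L M \<longleftrightarrow> (\<exists>f. bij_betw f (lcarrier L) (lcarrier M) \<and>
     (\<forall>x\<in>lcarrier L. \<forall>y\<in>lcarrier L. f (ladd L x y) = ladd M (f x) (f y)) \<and>
     (\<forall>c. \<forall>x\<in>lcarrier L. f (lscale L c x) = lscale M c (f x)) \<and>
     (\<forall>x\<in>lcarrier L. \<forall>y\<in>lcarrier L. f (lbracket L x y) = lbracket M (f x) (f y)))"

definition lie_coset :: "('k, 'a) lie_algebra \<Rightarrow> 'a set \<Rightarrow> 'a \<Rightarrow> 'a set" where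
  "lie_coset L I x = ladd L x ` I"

text \<open>The quotient by an ideal \<open>I\<close>: the unions below are over coset representatives, and
  for an ideal \<open>I\<close> each of them is a single coset.\<close>

definition lie_quotient :: "('k, 'a) lie_algebra \<Rightarrow> 'a set \<Rightarrow> ('k, 'a set) lie_algebra" where
  "lie_quotient L I =
     \<lparr>lcarrier = lie_coset L I ` lcarrier L,
      lzero = I,
      ladd = (\<lambda>A B. \<Union>a\<in>A. \<Union>b\<in>B. lie_coset L I (ladd L a b)),
      lscale = (\<lambda>c A. \<Union>a\<in>A. lie_coset L I (lscale L c a)),
      lbracket = (\<lambda>A B. \<Union>a\<in>A. \<Union>b\<in>B. lie_coset L I (lbracket L a b))\<rparr>"

definition lie_power :: "('k, 'a) lie_algebra \<Rightarrow> nat \<Rightarrow> ('k, nat \<Rightarrow> 'a) lie_algebra" where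
  "lie_power L k =
     \<lparr>lcarrier = {..<k} \<rightarrow>\<^sub>E lcarrier L,
      lzero = (\<lambda>i\<in>{..<k}. lzero L),
      ladd = (\<lambda>x y. \<lambda>i\<in>{..<k}. ladd L (x i) (y i)),
      lscale = (\<lambda>c x. \<lambda>i\<in>{..<k}. lscale L c (x i)),
      lbracket = (\<lambda>x y. \<lambda>i\<in>{..<k}. lbracket L (x i) (y i))\<rparr>"

text \<open>The representation space is the whole type \<open>'v\<close>, with scalar multiplication \<open>s\<close>.\<close>

definition lie_representation ::
  "('k::field, 'a) lie_algebra \<Rightarrow> ('k \<Rightarrow> 'v::ab_group_add \<Rightarrow> 'v) \<Rightarrow> ('a \<Rightarrow> 'v \<Rightarrow> 'v) \<Rightarrow> bool" where
  "lie_representation L s \<phi> \<longleftrightarrow> vector_space s \<and>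
     (\<forall>x\<in>lcarrier L. Vector_Spaces.linear s s (\<phi> x)) \<and>
     (\<forall>x\<in>lcarrier L. \<forall>y\<in>lcarrier L. \<forall>v. \<phi> (ladd L x y) v = \<phi> x v + \<phi> y v) \<and>
     (\<forall>c. \<forall>x\<in>lcarrier L. \<forall>v. \<phi> (lscale L c x) v = s c (\<phi> x v)) \<and>
     (\<forall>x\<in>lcarrier L. \<forall>y\<in>lcarrier L. \<forall>v.
        \<phi> (lbracket L x y) v = \<phi> x (\<phi> y v) - \<phi> y (\<phi> x v))"

definition lie_irreducible ::
  "('k::field, 'a) lie_algebra \<Rightarrow> ('k \<Rightarrow> 'v::ab_group_add \<Rightarrow> 'v) \<Rightarrow> ('a \<Rightarrow> 'v \<Rightarrow> 'v) \<Rightarrow> bool" where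
  "lie_irreducible L s \<phi> \<longleftrightarrow> lie_representation L s \<phi> \<and> (UNIV :: 'v set) \<noteq> {0} \<and>
     (\<forall>W. module.subspace s W \<and> (\<forall>x\<in>lcarrier L. \<forall>w\<in>W. \<phi> x w \<in> W) \<longrightarrow> W = {0} \<or> W = UNIV)"

definition lie_annihilator ::
  "('k, 'a) lie_algebra \<Rightarrow> ('a \<Rightarrow> 'v::ab_group_add \<Rightarrow> 'v) \<Rightarrow> 'a set" where
  "lie_annihilator L \<phi> = {x \<in> lcarrier L. \<forall>v. \<phi> x v = 0}"


section \<open>Matrix Lie algebras\<close>

text \<open>An \<open>N \<times> N\<close> matrix is a function vanishing outside the indices \<open>1, \<dots>, N\<close>.\<close>

definition mat_mult :: "('k, 'r::ab_group_add) inv_algebra \<Rightarrow> nat \<Rightarrow>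
    (nat \<Rightarrow> nat \<Rightarrow> 'r) \<Rightarrow> (nat \<Rightarrow> nat \<Rightarrow> 'r) \<Rightarrow> nat \<Rightarrow> nat \<Rightarrow> 'r" where
  "mat_mult R N A B = (\<lambda>i j. \<Sum>l = 1..N. amult R (A i l) (B l j))"

definition gl :: "nat \<Rightarrow> ('k, 'r::ab_group_add) inv_algebra \<Rightarrow> ('k, nat \<Rightarrow> nat \<Rightarrow> 'r) lie_algebra" where
  "gl N R =
     \<lparr>lcarrier = {A. \<forall>i j. i \<notin> {1..N} \<or> j \<notin> {1..N} \<longrightarrow> A i j = 0},
      lzero = (\<lambda>i j. 0),
      ladd = (\<lambda>A B i j. A i j + B i j),
      lscale = (\<lambda>c A i j. ascale R c (A i j)),
      lbracket = (\<lambda>A B i j. mat_mult R N A B i j - mat_mult R N B A i j)\<rparr>"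

definition sl :: "nat \<Rightarrow> (complex, nat \<Rightarrow> nat \<Rightarrow> complex) lie_algebra" where
  "sl N = (gl N complex_algebra)
     \<lparr>lcarrier := {A \<in> lcarrier (gl N complex_algebra). (\<Sum>i = 1..N. A i i) = 0}\<rparr>"

definition e_mat :: "nat \<Rightarrow> nat \<Rightarrow> 'r::ab_group_add \<Rightarrow> nat \<Rightarrow> nat \<Rightarrow> 'r" where
  "e_mat i j a = (\<lambda>k l. if k = i \<and> l = j then a else 0)"

definition f_mat :: "('k, 'r::ab_group_add) inv_algebra \<Rightarrow> nat \<Rightarrow>
    nat \<Rightarrow> nat \<Rightarrow> 'r \<Rightarrow> nat \<Rightarrow> nat \<Rightarrow> 'r" where
  "f_mat R n i j a = e_mat i j a - e_mat (n + j) (n + i) (astar R a)"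

definition g_mat :: "('k, 'r::ab_group_add) inv_algebra \<Rightarrow> nat \<Rightarrow> 'k \<Rightarrow>
    nat \<Rightarrow> nat \<Rightarrow> 'r \<Rightarrow> nat \<Rightarrow> nat \<Rightarrow> 'r" where
  "g_mat R n \<rho> i j a = e_mat i (n + j) a - e_mat j (n + i) (ascale R \<rho> (astar R a))"

definition h_mat :: "('k, 'r::ab_group_add) inv_algebra \<Rightarrow> nat \<Rightarrow> 'k \<Rightarrow>
    nat \<Rightarrow> nat \<Rightarrow> 'r \<Rightarrow> nat \<Rightarrow> nat \<Rightarrow> 'r" where
  "h_mat R n \<rho> i j a = e_mat (n + i) j a - e_mat (n + j) i (ascale R \<rho> (astar R a))"

text \<open>\<open>g_lie n \<rho> R\<close> is $\mathfrak{g}_{2n,\rho}(R)$: the first argument is half the matrix size.\<close>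

definition g_lie :: "nat \<Rightarrow> 'k \<Rightarrow> ('k, 'r::ab_group_add) inv_algebra \<Rightarrow>
    ('k, nat \<Rightarrow> nat \<Rightarrow> 'r) lie_algebra" where
  "g_lie n \<rho> R = lie_generate (gl (2 * n) R)
     ({f_mat R n i j a | i j a. i \<in> {1..n} \<and> j \<in> {1..n} \<and> i \<noteq> j} \<union>
      {g_mat R n \<rho> i j a | i j a. 1 \<le> i \<and> i \<le> j \<and> j \<le> n} \<union>
      {h_mat R n \<rho> i j a | i j a. 1 \<le> i \<and> i \<le> j \<and> j \<le> n})"


section \<open>The quantum torus\<close>

text \<open>\<open>Poly_Mapping.single (a, b) c\<close> stands for $c\,t_1^a t_2^b$; the product is the bilinear
  extension of $t_1^a t_2^b \cdot t_1^c t_2^d = q^{bc} t_1^{a+c} t_2^{b+d}$. That this is the algebra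
  presented by the generators $t_1^{\pm1}, t_2^{\pm1}$ and their relations is proved in
  \<open>quantum_torus_relations\<close> and \<open>quantum_torus_universal\<close> below. The involution is the
  linear extension of
  $\overline{t_1^a t_2^b} = \bar t_2^b\, \bar t_1^a = \theta_1^a \theta_2^b q^{ab} t_1^a t_2^b$; see
  \<open>quantum_torus_inv_algebra\<close>, \<open>quantum_torus_star\<close> and \<open>quantum_torus_star_unique\<close>.\<close>

type_synonym torus = "(int \<times> int) \<Rightarrow>\<^sub>0 complex"

definition torus_mult :: "complex \<Rightarrow> torus \<Rightarrow> torus \<Rightarrow> torus" where
  "torus_mult q x y = (\<Sum>a\<in>Poly_Mapping.keys x. \<Sum>b\<in>Poly_Mapping.keys y.
     Poly_Mapping.single (a + b)
       (q powi (snd a * fst b) * Poly_Mapping.lookup x a * Poly_Mapping.lookup y b))"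

definition torus_scale :: "complex \<Rightarrow> torus \<Rightarrow> torus" where
  "torus_scale c x = Poly_Mapping.map ((*) c) x"

definition torus_star :: "complex \<Rightarrow> complex \<Rightarrow> complex \<Rightarrow> torus \<Rightarrow> torus" where
  "torus_star q \<theta>1 \<theta>2 x = (\<Sum>a\<in>Poly_Mapping.keys x. Poly_Mapping.single a
     (\<theta>1 powi fst a * \<theta>2 powi snd a * q powi (fst a * snd a) * Poly_Mapping.lookup x a))"

definition quantum_torus :: "complex \<Rightarrow> complex \<Rightarrow> complex \<Rightarrow> (complex, torus) inv_algebra" where
  "quantum_torus q \<theta>1 \<theta>2 =
     \<lparr>amult = torus_mult q,
      aone = Poly_Mapping.single (0, 0) 1,
      ascale = torus_scale,
      astar = torus_star q \<theta>1 \<theta>2\<rparr>"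

definition torus_t1 :: "int \<Rightarrow> torus" where "torus_t1 k = Poly_Mapping.single (k, 0) 1"
definition torus_t2 :: "int \<Rightarrow> torus" where "torus_t2 k = Poly_Mapping.single (0, k) 1"

definition torus_params :: "(complex \<times> complex \<times> complex) set" where
  "torus_params = {(-1, 1, 1), (-1, 1, -1), (-1, -1, -1), (1, 1, 1), (1, 1, -1), (1, -1, -1)}"

definition mult_order :: "complex \<Rightarrow> nat" where
  "mult_order q = (LEAST m. 0 < m \<and> q ^ m = 1)"

lemma mult_order_1: "mult_order 1 = 1"
  unfolding mult_order_def by (rule Least_equality) auto

lemma mult_order_minus_1: "mult_order (-1) = 2"
  unfolding mult_order_def
proof (rule Least_equality)
  fix m :: nat
  assume "0 < m \<and> (-1 :: complex) ^ m = 1"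
  then show "2 \<le> m" by (cases "m = 1") auto
qed auto


subsection \<open>The presentation of the quantum torus\<close>

lemma torus_induct [case_names zero single add]:
  fixes x :: torus
  assumes "P 0" "\<And>a c. P (Poly_Mapping.single a c)" "\<And>x y. P x \<Longrightarrow> P y \<Longrightarrow> P (x + y)"
  shows "P x"
proof (induction x rule: Poly_Mapping.update_induct)
  case (update f a b)
  have "Poly_Mapping.update a b f = f + Poly_Mapping.single a b"
    using update(1)
    by (intro poly_mapping_eqI) (auto simp: lookup_update lookup_add lookup_single in_keys_iff when_def)
  then show ?case using assms(2,3) update by simp
qed (use assms in auto)

lemma torus_mult_add_left: "torus_mult q (x + y) z = torus_mult q x z + torus_mult q y z"
  unfolding torus_mult_def
  by (rule setsum_keys_plus_distrib
        [where f = "\<lambda>a c. \<Sum>b\<in>Poly_Mapping.keys z. Poly_Mapping.single (a + b)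
           (q powi (snd a * fst b) * c * Poly_Mapping.lookup z b)"])
     (auto simp: algebra_simps single_add sum.distrib)

lemma torus_mult_add_right: "torus_mult q x (y + z) = torus_mult q x y + torus_mult q x z"
  unfolding torus_mult_def sum.distrib [symmetric]
  by (intro sum.cong refl, rule setsum_keys_plus_distrib
        [where f = "\<lambda>b c. Poly_Mapping.single (a + b)
           (q powi (snd a * fst b) * Poly_Mapping.lookup x a * c)" for a])
     (auto simp: algebra_simps single_add)

lemma torus_mult_single:
  "torus_mult q (Poly_Mapping.single a c) (Poly_Mapping.single b d) =
     Poly_Mapping.single (a + b) (q powi (snd a * fst b) * c * d)"
  by (auto simp: torus_mult_def)

lemma torus_mult_0 [simp]: "torus_mult q 0 x = 0" "torus_mult q x 0 = 0"
  by (auto simp: torus_mult_def)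

lemma torus_star_add: "torus_star q \<theta>1 \<theta>2 (x + y) = torus_star q \<theta>1 \<theta>2 x + torus_star q \<theta>1 \<theta>2 y"
  unfolding torus_star_def
  by (rule setsum_keys_plus_distrib
        [where f = "\<lambda>a c. Poly_Mapping.single a
           (\<theta>1 powi fst a * \<theta>2 powi snd a * q powi (fst a * snd a) * c)"])
     (auto simp: algebra_simps single_add)

lemma torus_star_single:
  "torus_star q \<theta>1 \<theta>2 (Poly_Mapping.single a c) = Poly_Mapping.single a
     (\<theta>1 powi fst a * \<theta>2 powi snd a * q powi (fst a * snd a) * c)"
  by (auto simp: torus_star_def)

lemma torus_star_0 [simp]: "torus_star q \<theta>1 \<theta>2 0 = 0"
  by (auto simp: torus_star_def)

lemma lookup_torus_scale:
  "Poly_Mapping.lookup (torus_scale c x) a = c * Poly_Mapping.lookup x a"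
  by (simp add: torus_scale_def map.rep_eq when_def)

lemma torus_scale_add:
  "torus_scale c (x + y) = torus_scale c x + torus_scale c y"
  by (intro poly_mapping_eqI) (auto simp: lookup_torus_scale lookup_add algebra_simps)

lemma torus_scale_single:
  "torus_scale c (Poly_Mapping.single a d) = Poly_Mapping.single a (c * d)"
  by (intro poly_mapping_eqI) (auto simp: lookup_torus_scale lookup_single when_def)

lemma torus_scale_0 [simp]: "torus_scale c 0 = 0"
  by (intro poly_mapping_eqI) (auto simp: lookup_torus_scale)

lemma vector_space_torus_scale: "vector_space torus_scale"
  by standard
     (auto intro!: poly_mapping_eqI simp: lookup_torus_scale lookup_add algebra_simps)

lemma torus_mult_scale_left:
  "torus_mult q (torus_scale k x) y = torus_scale k (torus_mult q x y)"
proof (induction x rule: torus_induct)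
  case (single a c)
  show ?case
    by (induction y rule: torus_induct)
       (auto simp: torus_scale_single torus_mult_single torus_mult_add_right torus_scale_add algebra_simps)
qed (auto simp: torus_mult_add_left torus_scale_add)

lemma torus_mult_scale_right:
  "torus_mult q x (torus_scale k y) = torus_scale k (torus_mult q x y)"
proof (induction x rule: torus_induct)
  case (single a c)
  show ?case
    by (induction y rule: torus_induct)
       (auto simp: torus_scale_single torus_mult_single torus_mult_add_right torus_scale_add algebra_simps)
qed (auto simp: torus_mult_add_left torus_scale_add)

lemma torus_mult_assoc:
  assumes "q \<noteq> 0"
  shows "torus_mult q (torus_mult q x y) z = torus_mult q x (torus_mult q y z)"
proof (induction x rule: torus_induct)
  case (single a c)
  show ?case
  proof (induction y rule: torus_induct)
    case (single b d)
    show ?case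
      by (induction z rule: torus_induct)
         (auto simp: torus_mult_single torus_mult_add_right torus_mult_add_left algebra_simps
           power_int_add assms)
  qed (auto simp: torus_mult_add_left torus_mult_add_right)
qed (auto simp: torus_mult_add_left)

lemma sign_powi_square:
  assumes "\<theta> \<in> {1, -1 :: complex}"
  shows "\<theta> powi k * \<theta> powi k = 1"
proof -
  have "\<theta> powi k * \<theta> powi k = (\<theta> * \<theta>) powi k" by (simp add: power_int_mult_distrib)
  then show ?thesis using assms by auto
qed

lemma torus_star_mult:
  assumes q: "q \<in> {1, -1}" and \<theta>: "\<theta>1 \<noteq> 0" "\<theta>2 \<noteq> 0"
  shows "torus_star q \<theta>1 \<theta>2 (torus_mult q x y) =
    torus_mult q (torus_star q \<theta>1 \<theta>2 y) (torus_star q \<theta>1 \<theta>2 x)"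
proof (induction x rule: torus_induct)
  case (single a c)
  show ?case
  proof (induction y rule: torus_induct)
    case (single b d)
    have q0: "q \<noteq> 0" using q by auto
    have *: "q powi ((fst a + fst b) * (snd a + snd b)) * q powi (snd a * fst b) =
      q powi (snd b * fst a) * q powi (fst a * snd a) * q powi (fst b * snd b)"
    proof -
      have "q powi ((fst a + fst b) * (snd a + snd b)) * q powi (snd a * fst b) =
        q powi (fst a * snd a) * q powi (fst b * snd b) * q powi (snd b * fst a) *
        (q powi (snd a * fst b) * q powi (snd a * fst b))"
        by (simp add: q0 algebra_simps power_int_add)
      then show ?thesis using sign_powi_square[OF q] by simp
    qed
    have "torus_star q \<theta>1 \<theta>2
        (torus_mult q (Poly_Mapping.single a c) (Poly_Mapping.single b d)) =
      Poly_Mapping.single (a + b) (\<theta>1 powi (fst a + fst b) * \<theta>2 powi (snd a + snd b) *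
        (q powi ((fst a + fst b) * (snd a + snd b)) * q powi (snd a * fst b)) * c * d)"
      by (simp add: torus_mult_single torus_star_single mult.assoc)
    also have "\<dots> = torus_mult q (torus_star q \<theta>1 \<theta>2 (Poly_Mapping.single b d))
        (torus_star q \<theta>1 \<theta>2 (Poly_Mapping.single a c))"
      unfolding *
      by (simp add: torus_mult_single torus_star_single power_int_add \<theta> ac_simps)
    finally show ?case .
  qed (auto simp: torus_mult_add_left torus_mult_add_right torus_star_add)
qed (auto simp: torus_mult_add_left torus_mult_add_right torus_star_add)

lemma torus_star_star:
  assumes "q \<in> {1, -1}" "\<theta>1 \<in> {1, -1}" "\<theta>2 \<in> {1, -1}"
  shows "torus_star q \<theta>1 \<theta>2 (torus_star q \<theta>1 \<theta>2 x) = x"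
proof (induction x rule: torus_induct)
  case (single a c)
  have "torus_star q \<theta>1 \<theta>2 (torus_star q \<theta>1 \<theta>2 (Poly_Mapping.single a c)) =
    Poly_Mapping.single a ((\<theta>1 powi fst a * \<theta>1 powi fst a) * (\<theta>2 powi snd a * \<theta>2 powi snd a) *
      (q powi (fst a * snd a) * q powi (fst a * snd a)) * c)"
    by (simp add: torus_star_single ac_simps)
  then show ?case
    using assms by (simp only: sign_powi_square) simp
qed (auto simp: torus_star_add)

lemma torus_star_scale:
  "torus_star q \<theta>1 \<theta>2 (torus_scale k x) = torus_scale k (torus_star q \<theta>1 \<theta>2 x)"
  by (induction x rule: torus_induct)
     (auto simp: torus_scale_single torus_star_single torus_star_add torus_scale_add algebra_simps)

lemma torus_one_mult: "torus_mult q (Poly_Mapping.single (0, 0) 1) x = x"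
  by (induction x rule: torus_induct) (auto simp: torus_mult_single torus_mult_add_right plus_prod_def)

lemma torus_mult_one: "torus_mult q x (Poly_Mapping.single (0, 0) 1) = x"
  by (induction x rule: torus_induct) (auto simp: torus_mult_single torus_mult_add_left plus_prod_def)

theorem quantum_torus_inv_algebra:
  assumes "q \<in> {1, -1}" "\<theta>1 \<in> {1, -1}" "\<theta>2 \<in> {1, -1}"
  shows "inv_algebra (quantum_torus q \<theta>1 \<theta>2)"
proof -
  have "q \<noteq> 0" "\<theta>1 \<noteq> 0" "\<theta>2 \<noteq> 0" using assms by auto
  then show ?thesis
    unfolding inv_algebra_def quantum_torus_def
    using assms
    by (simp add: vector_space_torus_scale torus_mult_assoc torus_one_mult torus_mult_one
      torus_mult_add_left torus_mult_add_right torus_mult_scale_left torus_mult_scale_right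
      torus_star_add torus_star_scale torus_star_mult torus_star_star)
qed

theorem quantum_torus_star:
  "astar (quantum_torus q \<theta>1 \<theta>2) (torus_t1 1) = ascale (quantum_torus q \<theta>1 \<theta>2) \<theta>1 (torus_t1 1)"
  "astar (quantum_torus q \<theta>1 \<theta>2) (torus_t2 1) = ascale (quantum_torus q \<theta>1 \<theta>2) \<theta>2 (torus_t2 1)"
  by (simp_all add: quantum_torus_def torus_t1_def torus_t2_def torus_star_single torus_scale_single)

theorem quantum_torus_relations:
  fixes q \<theta>1 \<theta>2
  defines "R \<equiv> quantum_torus q \<theta>1 \<theta>2"
  shows "amult R (torus_t1 1) (torus_t1 (-1)) = aone R" "amult R (torus_t1 (-1)) (torus_t1 1) = aone R"
    "amult R (torus_t2 1) (torus_t2 (-1)) = aone R" "amult R (torus_t2 (-1)) (torus_t2 1) = aone R"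
    "amult R (torus_t2 1) (torus_t1 1) = ascale R q (amult R (torus_t1 1) (torus_t2 1))"
  by (simp_all add: R_def quantum_torus_def torus_t1_def torus_t2_def torus_mult_single
    torus_scale_single)

definition ipow :: "'b::monoid_mult \<Rightarrow> 'b \<Rightarrow> int \<Rightarrow> 'b" where
  "ipow u u' k = (if 0 \<le> k then u ^ nat k else u' ^ nat (- k))"

lemma ipow_simps [simp]: "ipow u u' 0 = 1" "ipow u u' 1 = u" "ipow u u' (-1) = u'"
  by (auto simp: ipow_def)

lemma ipow_step:
  assumes "u * u' = 1" "u' * u = 1"
  shows "ipow u u' (k + 1) = ipow u u' k * u" "ipow u u' (k - 1) = ipow u u' k * u'"
proof -
  have *: "ipow u u' (k + 1) = ipow u u' k * u" if "u * u' = 1" "u' * u = 1"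
    for u u' :: 'a and k :: int
  proof (cases "0 \<le> k")
    case True
    then show ?thesis by (simp add: ipow_def nat_add_distrib power_commutes)
  next
    case False
    define m where "m = nat (- k - 1)"
    have k: "k = - int m - 1" using False by (simp add: m_def)
    have "nat (- k) = Suc m" by (simp add: k)
    moreover have "u' ^ Suc m * u = u' ^ m"
      by (simp add: power_Suc2 mult.assoc that del: power_Suc)
    ultimately show ?thesis using False
      by (cases "m = 0") (auto simp: ipow_def k)
  qed
  show "ipow u u' (k + 1) = ipow u u' k * u" by (rule *[OF assms])
  have "ipow u u' k = ipow u u' (k - 1) * u" using *[OF assms, of "k - 1"] by simp
  then show "ipow u u' (k - 1) = ipow u u' k * u'" by (simp add: mult.assoc assms)
qed

lemma ipow_add:
  assumes "u * u' = 1" "u' * u = 1"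
  shows "ipow u u' (j + k) = ipow u u' j * ipow u u' k"
proof (induction k rule: int_induct[where k = 0])
  case (step1 i)
  have "ipow u u' (j + (i + 1)) = ipow u u' (j + i) * u"
    using ipow_step(1)[OF assms, of "j + i"] by (simp add: add.assoc)
  then show ?case using step1 by (simp add: ipow_step(1)[OF assms] mult.assoc)
next
  case (step2 i)
  have "ipow u u' (j + (i - 1)) = ipow u u' (j + i) * u'"
    using ipow_step(2)[OF assms, of "j + i"] by (simp add: algebra_simps)
  then show ?case using step2 by (simp add: ipow_step(2)[OF assms] mult.assoc)
qed simp

locale complex_algebra_type = vector_space s
  for s :: "complex \<Rightarrow> 'b::ring_1 \<Rightarrow> 'b" +
  assumes s_left: "s c x * y = s c (x * y)"
    and s_right: "x * s c y = s c (x * y)"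
begin

lemma q_flip:
  assumes "x * y = s r (y * x)" "r \<noteq> 0"
  shows "y * x = s (inverse r) (x * y)"
  using assms by simp

lemma q_ipow:
  assumes xy: "x * y = s r (y * x)" and r: "r \<noteq> 0" and y: "y * y' = 1" "y' * y = 1"
  shows "x * ipow y y' k = s (r powi k) (ipow y y' k * x)"
proof (induction k rule: int_induct[where k = 0])
  case (step1 i)
  have "x * ipow y y' (i + 1) = (x * ipow y y' i) * y"
    by (simp add: ipow_step[OF y] mult.assoc)
  also have "\<dots> = s (r powi i) (ipow y y' i * (x * y))"
    by (simp add: step1 s_left mult.assoc)
  also have "\<dots> = s (r powi (i + 1)) (ipow y y' (i + 1) * x)"
    by (simp add: xy s_right r power_int_add mult.assoc ipow_step[OF y])
  finally show ?case .
next
  case (step2 i)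
  have "y' * (x * y) * y' = s r (y' * (y * x) * y')" by (simp add: xy s_left s_right)
  moreover have "y' * (x * y) * y' = y' * x" by (simp add: mult.assoc y)
  moreover have "y' * (y * x) * y' = x * y'" by (simp add: mult.assoc[symmetric] y)
  ultimately have "y' * x = s r (x * y')" by simp
  from q_flip[OF this r] have xy': "x * y' = s (inverse r) (y' * x)" .
  have "x * ipow y y' (i - 1) = (x * ipow y y' i) * y'"
    by (simp add: ipow_step[OF y] mult.assoc)
  also have "\<dots> = s (r powi i) (ipow y y' i * (x * y'))"
    by (simp add: step2 s_left mult.assoc)
  also have "\<dots> = s (r powi (i - 1)) (ipow y y' (i - 1) * x)"
    by (simp add: xy' s_right r power_int_diff mult.assoc ipow_step[OF y] divide_inverse)
  finally show ?case .
qed simp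

end

text \<open>Universal property: \<open>quantum_torus\<close> maps uniquely to every complex unital associative
  algebra (multiplication of the type, scalars \<open>s\<close>) containing elements that satisfy the relations.\<close>

theorem quantum_torus_universal:
  fixes s :: "complex \<Rightarrow> 'b::ring_1 \<Rightarrow> 'b" and u1 u1' u2 u2' :: 'b and q \<theta>1 \<theta>2
  defines "R \<equiv> quantum_torus q \<theta>1 \<theta>2"
  assumes alg: "vector_space s" "\<And>c x y. s c x * y = s c (x * y)" "\<And>c x y. x * s c y = s c (x * y)"
    and q: "q \<noteq> 0"
    and u1: "u1 * u1' = 1" "u1' * u1 = 1" and u2: "u2 * u2' = 1" "u2' * u2 = 1"
    and rel: "u2 * u1 = s q (u1 * u2)"
  shows "\<exists>!\<phi>. \<phi> (aone R) = 1 \<and> (\<forall>x y. \<phi> (x + y) = \<phi> x + \<phi> y) \<and>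
    (\<forall>c x. \<phi> (ascale R c x) = s c (\<phi> x)) \<and> (\<forall>x y. \<phi> (amult R x y) = \<phi> x * \<phi> y) \<and>
    \<phi> (torus_t1 1) = u1 \<and> \<phi> (torus_t2 1) = u2"
proof -
  interpret complex_algebra_type s
    using alg by (simp add: complex_algebra_type_def complex_algebra_type_axioms_def)
  define M where "M a = ipow u1 u1' (fst a) * ipow u2 u2' (snd a)" for a :: "int \<times> int"
  define \<Phi> where "\<Phi> x = (\<Sum>a\<in>Poly_Mapping.keys x. s (Poly_Mapping.lookup x a) (M a))" for x :: torus
  have comm: "ipow u2 u2' b * ipow u1 u1' c = s (q powi (b * c)) (ipow u1 u1' c * ipow u2 u2' b)"
    for b c
  proof -
    have "u2 * ipow u1 u1' c = s (q powi c) (ipow u1 u1' c * u2)"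
      by (rule q_ipow[OF rel q u1])
    then have "ipow u1 u1' c * u2 = s (inverse (q powi c)) (u2 * ipow u1 u1' c)"
      by (rule q_flip) (use q in auto)
    then have "ipow u1 u1' c * ipow u2 u2' b =
      s (inverse (q powi c) powi b) (ipow u2 u2' b * ipow u1 u1' c)"
      by (rule q_ipow) (use q u2 in auto)
    then have "ipow u2 u2' b * ipow u1 u1' c =
      s (inverse (inverse (q powi c) powi b)) (ipow u1 u1' c * ipow u2 u2' b)"
      by (rule q_flip) (use q in auto)
    also have "inverse (inverse (q powi c) powi b) = q powi (b * c)"
      by (simp add: power_int_inverse power_int_mult[symmetric] mult.commute)
    finally show ?thesis .
  qed
  have M_mult: "M a * M b = s (q powi (snd a * fst b)) (M (a + b))" for a b
  proof -
    have "M a * M b = ipow u1 u1' (fst a) * (ipow u2 u2' (snd a) * ipow u1 u1' (fst b)) * ipow u2 u2' (snd b)"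
      by (simp add: M_def mult.assoc)
    also have "\<dots> = s (q powi (snd a * fst b)) (M (a + b))"
      by (simp add: comm s_left s_right M_def ipow_add[OF u1] ipow_add[OF u2] mult.assoc)
    finally show ?thesis .
  qed
  have \<Phi>_single: "\<Phi> (Poly_Mapping.single a c) = s c (M a)" for a c
    by (auto simp: \<Phi>_def)
  have \<Phi>_0: "\<Phi> 0 = 0" by (simp add: \<Phi>_def)
  have \<Phi>_add: "\<Phi> (x + y) = \<Phi> x + \<Phi> y" for x y
    unfolding \<Phi>_def
    by (rule setsum_keys_plus_distrib[where f = "\<lambda>a c. s c (M a)"]) (auto simp: scale_left_distrib)
  have \<Phi>_scale: "\<Phi> (ascale R c x) = s c (\<Phi> x)" for c x
    unfolding R_def quantum_torus_def
    by (induction x rule: torus_induct)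
       (auto simp: \<Phi>_0 \<Phi>_add \<Phi>_single torus_scale_single torus_scale_add scale_right_distrib)
  have \<Phi>_mult: "\<Phi> (amult R x y) = \<Phi> x * \<Phi> y" for x y
  proof -
    have "\<Phi> (torus_mult q x y) = \<Phi> x * \<Phi> y"
    proof (induction x rule: torus_induct)
      case (single a c)
      show ?case
        by (induction y rule: torus_induct)
           (auto simp: \<Phi>_0 \<Phi>_add \<Phi>_single torus_mult_single torus_mult_add_right M_mult s_left s_right
             algebra_simps)
    qed (auto simp: \<Phi>_0 \<Phi>_add torus_mult_add_left algebra_simps)
    then show ?thesis by (simp add: R_def quantum_torus_def)
  qed
  show ?thesis
  proof (rule ex1I[of _ \<Phi>])
    show "\<Phi> (aone R) = 1 \<and> (\<forall>x y. \<Phi> (x + y) = \<Phi> x + \<Phi> y) \<and>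
      (\<forall>c x. \<Phi> (ascale R c x) = s c (\<Phi> x)) \<and> (\<forall>x y. \<Phi> (amult R x y) = \<Phi> x * \<Phi> y) \<and>
      \<Phi> (torus_t1 1) = u1 \<and> \<Phi> (torus_t2 1) = u2"
      using \<Phi>_add \<Phi>_scale \<Phi>_mult
      by (simp add: \<Phi>_single R_def quantum_torus_def torus_t1_def torus_t2_def M_def)
  next
    fix \<psi>
    assume \<psi>: "\<psi> (aone R) = 1 \<and> (\<forall>x y. \<psi> (x + y) = \<psi> x + \<psi> y) \<and>
      (\<forall>c x. \<psi> (ascale R c x) = s c (\<psi> x)) \<and> (\<forall>x y. \<psi> (amult R x y) = \<psi> x * \<psi> y) \<and>
      \<psi> (torus_t1 1) = u1 \<and> \<psi> (torus_t2 1) = u2"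
    then have \<psi>_mult: "\<psi> (torus_mult q x y) = \<psi> x * \<psi> y" for x y
      by (simp add: R_def quantum_torus_def)
    have one: "\<psi> (Poly_Mapping.single (0, 0) 1) = 1"
      using \<psi> by (simp add: R_def quantum_torus_def)
    have p1: "\<psi> (torus_t1 k) = ipow u1 u1' k" for k
    proof (induction k rule: int_induct[where k = 0])
      case (step1 i)
      have "torus_t1 (i + 1) = torus_mult q (torus_t1 i) (torus_t1 1)"
        by (simp add: torus_t1_def torus_mult_single)
      then show ?case using step1 \<psi> by (simp add: \<psi>_mult ipow_step[OF u1])
    next
      case (step2 i)
      have "torus_t1 i = torus_mult q (torus_t1 (i - 1)) (torus_t1 1)"
        by (simp add: torus_t1_def torus_mult_single)
      then have "ipow u1 u1' i = \<psi> (torus_t1 (i - 1)) * u1"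
        using step2 \<psi> \<psi>_mult by metis
      then show ?case by (simp add: ipow_step[OF u1] mult.assoc u1)
    qed (simp add: torus_t1_def one)
    have p2: "\<psi> (torus_t2 k) = ipow u2 u2' k" for k
    proof (induction k rule: int_induct[where k = 0])
      case (step1 i)
      have "torus_t2 (i + 1) = torus_mult q (torus_t2 i) (torus_t2 1)"
        by (simp add: torus_t2_def torus_mult_single)
      then show ?case using step1 \<psi> by (simp add: \<psi>_mult ipow_step[OF u2])
    next
      case (step2 i)
      have "torus_t2 i = torus_mult q (torus_t2 (i - 1)) (torus_t2 1)"
        by (simp add: torus_t2_def torus_mult_single)
      then have "ipow u2 u2' i = \<psi> (torus_t2 (i - 1)) * u2"
        using step2 \<psi> \<psi>_mult by metis
      then show ?case by (simp add: ipow_step[OF u2] mult.assoc u2)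
    qed (simp add: torus_t2_def one)
    have \<psi>_single: "\<psi> (Poly_Mapping.single a c) = s c (M a)" for a c
    proof -
      have "Poly_Mapping.single a c = ascale R c (amult R (torus_t1 (fst a)) (torus_t2 (snd a)))"
        by (simp add: R_def quantum_torus_def torus_t1_def torus_t2_def torus_mult_single
          torus_scale_single)
      then show ?thesis using \<psi> by (simp add: p1 p2 M_def)
    qed
    have \<psi>0: "\<psi> 0 = 0" using \<psi>_single[of "(0, 0)" 0] by simp
    show "\<psi> = \<Phi>"
    proof
      fix x
      show "\<psi> x = \<Phi> x"
        by (induction x rule: torus_induct) (use \<psi> in \<open>auto simp: \<psi>0 \<Phi>_0 \<psi>_single \<Phi>_single \<Phi>_add\<close>)
    qed
  qed
qed

theorem quantum_torus_star_unique:
  fixes q \<theta>1 \<theta>2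
  defines "R \<equiv> quantum_torus q \<theta>1 \<theta>2"
  assumes params: "q \<in> {1, -1}" "\<theta>1 \<in> {1, -1}" "\<theta>2 \<in> {1, -1}"
    and \<sigma>: "inv_algebra (R\<lparr>astar := \<sigma>\<rparr>)"
      "\<sigma> (torus_t1 1) = ascale R \<theta>1 (torus_t1 1)" "\<sigma> (torus_t2 1) = ascale R \<theta>2 (torus_t2 1)"
  shows "\<sigma> = astar R"
proof -
  interpret A: inv_algebra R
    unfolding R_def by (rule quantum_torus_inv_algebra[OF params])
  interpret B: inv_algebra "R\<lparr>astar := \<sigma>\<rparr>" by (rule \<sigma>)
  define E where "E x \<longleftrightarrow> \<sigma> x = astar R x" for x
  have E_mult: "E (amult R x y)" if "E x" "E y" for x y
    using that B.star_mult[of x y] A.star_mult[of x y] by (simp add: E_def)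
  have E_add: "E (x + y)" if "E x" "E y" for x y
    using that B.star_add[of x y] A.star_add[of x y] by (simp add: E_def)
  have E_scale: "E (ascale R c x)" if "E x" for x c
    using that B.star_scale[of c x] A.star_scale[of c x] by (simp add: E_def)
  have one: "\<sigma> (aone R) = aone R" "astar R (aone R) = aone R"
    using B.star_mult[of "aone R" "\<sigma> (aone R)"] B.star_star[of "aone R"] B.one_mult B.mult_one
      A.star_mult[of "aone R" "astar R (aone R)"] A.star_star[of "aone R"] A.one_mult A.mult_one
    by auto
  have E_one: "E (aone R)" by (simp add: E_def one)
  have E_inv: "E y" if "E x" "amult R x y = aone R" "amult R y x = aone R" for x y
  proof -
    have "amult R (\<sigma> y) (\<sigma> x) = aone R" "amult R (astar R x) (astar R y) = aone R"
      using B.star_mult[of x y] A.star_mult[of y x] that one by auto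
    then have "\<sigma> y = amult R (\<sigma> y) (amult R (\<sigma> x) (astar R y))"
      using that(1) A.mult_one by (simp add: E_def)
    also have "\<dots> = astar R y"
      using \<open>amult R (\<sigma> y) (\<sigma> x) = aone R\<close> A.one_mult A.mult_assoc by metis
    finally show ?thesis by (simp add: E_def)
  qed
  have t: "E (torus_t1 1)" "E (torus_t2 1)"
    using \<sigma> quantum_torus_star[of q \<theta>1 \<theta>2] by (simp_all add: E_def R_def)
  have t': "E (torus_t1 (-1))" "E (torus_t2 (-1))"
    using E_inv t quantum_torus_relations[of q \<theta>1 \<theta>2, folded R_def] by blast+
  have step: "torus_t1 (j + k) = amult R (torus_t1 j) (torus_t1 k)"
    "torus_t2 (j + k) = amult R (torus_t2 j) (torus_t2 k)" for j k
    by (simp_all add: R_def quantum_torus_def torus_t1_def torus_t2_def torus_mult_single)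
  have zero: "torus_t1 0 = aone R" "torus_t2 0 = aone R"
    by (simp_all add: R_def quantum_torus_def torus_t1_def torus_t2_def)
  have p1: "E (torus_t1 k)" for k
  proof (induction k rule: int_induct[where k = 0])
    case (step2 i)
    then show ?case using step(1)[of i "-1"] E_mult t' by simp
  qed (use zero E_one step E_mult t in simp_all)
  have p2: "E (torus_t2 k)" for k
  proof (induction k rule: int_induct[where k = 0])
    case (step2 i)
    then show ?case using step(2)[of i "-1"] E_mult t' by simp
  qed (use zero E_one step E_mult t in simp_all)
  have E_single: "E (Poly_Mapping.single a c)" for a c
  proof -
    have "Poly_Mapping.single a c = ascale R c (amult R (torus_t1 (fst a)) (torus_t2 (snd a)))"
      by (simp add: R_def quantum_torus_def torus_t1_def torus_t2_def torus_mult_single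
        torus_scale_single)
    then show ?thesis using p1 p2 E_mult E_scale by simp
  qed
  have "E x" for x
    by (induction x rule: torus_induct) (use E_single[of 0 0] E_single E_add in auto)
  then show ?thesis by (auto simp: E_def)
qed

end

(* Let I be the annihilator of V and J the set of those a in the torus for which the root elements
   with entry a lie in I. Since n >= 3, J is an ideal stable under the involution, and I consists of
   the elements of the Lie algebra with all entries in J. An ideal of the Lie algebra that is
   abelian modulo I acts by commuting operators, and its brackets with everything else are nilpotent
   (Jacobson) and hence act by zero; so a central element of the torus whose square lies in J lies
   in J. As J has finite codimension, it is therefore the common kernel of finitely many
   m-dimensional irreducible representations of the torus, and evaluation at these points identifies
   the quotient with a power of the Lie algebra of the involution induced on the m x m matrices. If
   q = 1 and the involution acts nontrivially on the torus, it permutes the points without fixed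
   points, and one point from each orbit gives a copy of sl(2n). *)

theory Submission
  imports
    Defs
    "HOL-Library.Function_Algebras"
    "HOL-Computational_Algebra.Fundamental_Theorem_Algebra"
begin

section \<open>Polynomials in a linear operator\<close>

definition poly_op :: "('k::field \<Rightarrow> 'v::ab_group_add \<Rightarrow> 'v) \<Rightarrow> ('v \<Rightarrow> 'v) \<Rightarrow> 'k poly \<Rightarrow> 'v \<Rightarrow> 'v" where
  "poly_op s f P = fold_coeffs (\<lambda>a g v. s a v + g (f v)) P (\<lambda>v. 0)"

context vector_space
begin

lemma poly_op_0 [simp]: "poly_op scale f 0 v = 0"
  by (simp add: poly_op_def)

lemma poly_op_pCons [simp]: "poly_op scale f (pCons a P) v = scale a v + poly_op scale f P (f v)"
  by (cases "P = 0 \<and> a = 0") (auto simp: poly_op_def)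

lemma poly_op_1 [simp]: "poly_op scale f 1 v = v"
  by (simp add: one_pCons)

lemma poly_op_add: "poly_op scale f (P + Q) v = poly_op scale f P v + poly_op scale f Q v"
proof (induction P arbitrary: Q v)
  case (pCons a P)
  show ?case
    by (cases Q rule: pCons_cases)
      (simp add: pCons.IH scale_left_distrib add.assoc add.left_commute)
qed simp

lemma poly_op_smult: "poly_op scale f (smult c P) v = scale c (poly_op scale f P v)"
  by (induction P arbitrary: v) (simp_all add: scale_right_distrib)

lemma poly_op_sum: "poly_op scale f (sum P A) v = (\<Sum>x\<in>A. poly_op scale f (P x) v)"
  by (induction A rule: infinite_finite_induct) (auto simp: poly_op_add)

lemma poly_op_commute:
  assumes "Vector_Spaces.linear scale scale g" and "\<And>v. g (f v) = f (g v)"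
  shows "g (poly_op scale f P v) = poly_op scale f P (g v)"
proof -
  interpret g: Vector_Spaces.linear scale scale g by fact
  show ?thesis
    by (induction P arbitrary: v) (simp_all add: g.zero g.add g.scale assms(2))
qed

lemma linear_poly_op:
  assumes "Vector_Spaces.linear scale scale f"
  shows "Vector_Spaces.linear scale scale (poly_op scale f P)"
proof -
  interpret f: Vector_Spaces.linear scale scale f by fact
  have "poly_op scale f P (u + v) = poly_op scale f P u + poly_op scale f P v" for u v
    by (induction P arbitrary: u v) (simp_all add: f.add scale_right_distrib add_ac)
  moreover have "poly_op scale f P (scale c v) = scale c (poly_op scale f P v)" for c v
    by (induction P arbitrary: v) (simp_all add: f.scale scale_right_distrib mult.commute)
  ultimately show ?thesis
    by (simp add: Vector_Spaces.linear_iff vector_space_axioms)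
qed

lemma poly_op_mult:
  assumes "Vector_Spaces.linear scale scale f"
  shows "poly_op scale f (P * Q) v = poly_op scale f P (poly_op scale f Q v)"
  by (induction P arbitrary: v)
     (simp_all add: poly_op_add poly_op_smult poly_op_commute[OF assms])

end

text \<open>The multiples of \<open>X\<^sup>N\<close> make room for the induction: two solutions of different degrees for
  \<open>E\<close> combine to a nonzero solution for one more functional.\<close>

lemma ex_poly_functionals_eq_0:
  fixes l :: "'e \<Rightarrow> 'k::field poly \<Rightarrow> 'k"
  assumes "finite E"
    and add: "\<And>e P Q. l e (P + Q) = l e P + l e Q"
    and smult: "\<And>e c P. l e (smult c P) = c * l e P"
  obtains P where "P \<noteq> 0" "\<And>e. e \<in> E \<Longrightarrow> l e P = 0"
proof -
  have "\<exists>P. P \<noteq> 0 \<and> [:0, 1:] ^ N dvd P \<and> (\<forall>e\<in>E. l e P = 0)" for N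
    using \<open>finite E\<close>
  proof (induction E arbitrary: N)
    case empty
    show ?case by (rule exI[of _ "[:0, 1:] ^ N"]) simp
  next
    case (insert e E)
    obtain P where P: "P \<noteq> 0" "[:0, 1:] ^ N dvd P" "\<forall>e\<in>E. l e P = 0"
      using insert.IH by blast
    define M where "M = Suc (max N (degree P))"
    obtain Q where Q: "Q \<noteq> 0" "[:0, 1:] ^ M dvd Q" "\<forall>e\<in>E. l e Q = 0"
      using insert.IH by blast
    show ?case
    proof (cases "l e P = 0")
      case True
      then show ?thesis using P by auto
    next
      case False
      define S where "S = smult (l e Q) P + smult (- l e P) Q"
      have "degree P < degree Q"
        using dvd_imp_degree_le[OF Q(2,1)] by (simp add: M_def degree_power_eq)
      then have "coeff S (degree Q) = - l e P * lead_coeff Q"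
        by (simp add: S_def coeff_eq_0)
      then have "S \<noteq> 0" using False Q(1) by auto
      moreover have "[:0, 1:] ^ N dvd Q"
        using Q(2) by (rule power_le_dvd) (simp add: M_def)
      then have "[:0, 1:] ^ N dvd S" using P(2) by (simp add: S_def dvd_smult)
      moreover have "\<forall>e\<in>insert e E. l e S = 0"
        using P(3) Q(3) unfolding S_def add smult by auto
      ultimately show ?thesis by blast
    qed
  qed
  then show thesis using that by blast
qed

context finite_dimensional_vector_space
begin

lemma linear_eq_0_if_representation_eq_0:
  assumes "Vector_Spaces.linear scale scale f"
    and "\<And>b e. b \<in> Basis \<Longrightarrow> e \<in> Basis \<Longrightarrow> representation Basis (f b) e = 0"
  shows "f v = 0"
proof -
  interpret f: Vector_Spaces.linear scale scale f by fact
  have "f b = 0" if "b \<in> Basis" for b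
  proof -
    have "representation Basis (f b) e = 0" for e
      using assms(2)[OF that] representation_ne_zero by blast
    then show ?thesis
      using sum_nonzero_representation_eq[OF independent_Basis, of "f b"] by (simp add: span_Basis)
  qed
  then show ?thesis using f.eq_0_on_span[of Basis v] span_Basis by blast
qed

lemma ex_poly_linear_family_eq_0:
  assumes lin: "\<And>P. Vector_Spaces.linear scale scale (\<Phi> P)"
    and add: "\<And>P Q v. \<Phi> (P + Q) v = \<Phi> P v + \<Phi> Q v"
    and smult: "\<And>c P v. \<Phi> (smult c P) v = scale c (\<Phi> P v)"
  obtains P where "P \<noteq> 0" "\<And>v. \<Phi> P v = 0"
proof -
  define l where "l be P = representation Basis (\<Phi> P (fst be)) (snd be)" for be P
  have "l be (P + Q) = l be P + l be Q" for be P Q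
    by (simp add: l_def add representation_add independent_Basis span_Basis)
  moreover have "l be (smult c P) = c * l be P" for be c P
    by (simp add: l_def smult representation_scale independent_Basis span_Basis)
  ultimately obtain P where P: "P \<noteq> 0" "\<And>be. be \<in> Basis \<times> Basis \<Longrightarrow> l be P = 0"
    using ex_poly_functionals_eq_0[of "Basis \<times> Basis" l] finite_Basis by blast
  then have "\<Phi> P v = 0" for v
    by (intro linear_eq_0_if_representation_eq_0[OF lin]) (auto simp: l_def)
  with P(1) show thesis by (rule that)
qed

lemma ex_poly_op_eq_0:
  assumes "Vector_Spaces.linear scale scale f"
  obtains P where "P \<noteq> 0" "\<And>v. poly_op scale f P v = 0"
  using ex_poly_linear_family_eq_0[of "poly_op scale f"] linear_poly_op[OF assms] poly_op_add
    poly_op_smult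
  by blast

end


section \<open>Jacobson's lemma\<close>

context vector_space
begin

lemma poly_op_commutator:
  assumes x: "Vector_Spaces.linear scale scale x" and y: "Vector_Spaces.linear scale scale y"
    and comm: "\<And>v. x (y v) = y (x v) + c v" and xc: "\<And>v. x (c v) = c (x v)"
  shows "poly_op scale x P (y v) = y (poly_op scale x P v) + poly_op scale x (pderiv P) (c v)"
proof -
  interpret y: Vector_Spaces.linear scale scale y by fact
  interpret x: Vector_Spaces.linear scale scale "poly_op scale x S" for S
    by (rule linear_poly_op) (rule x)
  show ?thesis
  proof (induction P arbitrary: v)
    case (pCons a P)
    have "poly_op scale x P (x (y v)) = poly_op scale x P (y (x v)) + poly_op scale x P (c v)"
      by (simp add: comm x.add)
    then show ?case
      by (simp add: pCons.IH xc[symmetric] y.add y.scale pderiv_pCons poly_op_add add.assoc)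
  qed (simp add: y.zero)
qed

text \<open>\<open>P(x)\<close> kills $c^m y c^m$, which it moves past \<open>y\<close> at the cost of $P'(x) c^{2m+1}$.\<close>

lemma poly_op_pderiv_commutator_power:
  assumes x: "Vector_Spaces.linear scale scale x" and y: "Vector_Spaces.linear scale scale y"
    and comm: "\<And>v. x (y v) = y (x v) + c v" and xc: "\<And>v. x (c v) = c (x v)"
    and kills: "\<And>v. poly_op scale x P ((c ^^ m) v) = 0"
  shows "poly_op scale x (pderiv P) ((c ^^ (m + Suc m)) v) = 0"
proof -
  interpret x: Vector_Spaces.linear scale scale x by fact
  interpret y: Vector_Spaces.linear scale scale y by fact
  have "c v = x (y v) - y (x v)" for v using comm by simp
  then have "Vector_Spaces.linear scale scale c"
    unfolding Vector_Spaces.linear_iff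
    by (simp add: vector_space_axioms x.add y.add x.scale y.scale scale_right_diff_distrib)
  then have "poly_op scale x P (c v) = c (poly_op scale x P v)" for P v
    using poly_op_commute[of c x P v] xc by simp
  then have commute: "poly_op scale x P ((c ^^ k) v) = (c ^^ k) (poly_op scale x P v)" for P k v
    by (induction k) auto
  have "(c ^^ m) (poly_op scale x P w) = 0" for w by (metis commute kills)
  moreover have "poly_op scale x P (y ((c ^^ m) v)) = poly_op scale x (pderiv P) ((c ^^ Suc m) v)"
    by (simp add: poly_op_commutator[OF x y comm xc] kills y.zero)
  ultimately show ?thesis by (metis commute funpow_add o_apply)
qed

end

lemma commutator_nilpotent:
  fixes s :: "'k::field_char_0 \<Rightarrow> 'v::ab_group_add \<Rightarrow> 'v"
  assumes "finite_dimensional_vector_space s B"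
    and x: "Vector_Spaces.linear s s x" and y: "Vector_Spaces.linear s s y"
    and comm: "\<And>v. x (y v) = y (x v) + c v" and xc: "\<And>v. x (c v) = c (x v)"
  shows "\<exists>m. \<forall>v. (c ^^ m) v = 0"
proof -
  interpret finite_dimensional_vector_space s B by fact
  define kills where "kills P \<longleftrightarrow> P \<noteq> 0 \<and> (\<exists>m. \<forall>v. poly_op s x P ((c ^^ m) v) = 0)" for P
  obtain P0 where "P0 \<noteq> 0" "\<And>v. poly_op s x P0 v = 0"
    using ex_poly_op_eq_0[OF x] by blast
  then have "kills P0" unfolding kills_def by (metis funpow_0)
  then obtain P where P: "kills P" and minimal: "\<And>P'. kills P' \<Longrightarrow> degree P \<le> degree P'"
    using ex_has_least_nat[of kills P0 degree] by blast
  then obtain m where m: "poly_op s x P ((c ^^ m) v) = 0" for v by (auto simp: kills_def)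
  have "degree P = 0"
  proof (rule ccontr)
    assume "degree P \<noteq> 0"
    then have "pderiv P \<noteq> 0" "degree (pderiv P) < degree P"
      by (simp_all add: pderiv_eq_0_iff degree_pderiv)
    moreover from this(1) have "kills (pderiv P)"
      using poly_op_pderiv_commutator_power[OF x y comm xc m] unfolding kills_def by blast
    ultimately show False using minimal by (meson not_le)
  qed
  then obtain a where "P = [:a:]" "a \<noteq> 0"
    using P by (auto simp: kills_def elim: degree_eq_zeroE)
  then show ?thesis using m by auto
qed

lemma funpow_last_nonzero:
  fixes f :: "'a \<Rightarrow> 'a::zero"
  assumes "u \<noteq> 0" "(f ^^ m) u = 0"
  obtains l where "(f ^^ l) u \<noteq> 0" "f ((f ^^ l) u) = 0"
proof -
  define k where "k = (LEAST k. (f ^^ k) u = 0)"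
  have k: "(f ^^ k) u = 0" unfolding k_def by (rule LeastI) (rule assms(2))
  then obtain l where l: "k = Suc l" using assms(1) by (cases k) simp_all
  have "(f ^^ l) u \<noteq> 0"
    using not_less_Least[of l "\<lambda>k. (f ^^ k) u = 0"] by (simp add: l flip: k_def)
  then show thesis using that k l by simp
qed

lemma (in finite_dimensional_vector_space) commuting_nilpotents_common_kernel:
  assumes lin: "\<And>f. f \<in> S \<Longrightarrow> Vector_Spaces.linear scale scale f"
    and nilpotent: "\<And>f. f \<in> S \<Longrightarrow> \<exists>m. \<forall>v. (f ^^ m) v = 0"
    and comm: "\<And>f g v. f \<in> S \<Longrightarrow> g \<in> S \<Longrightarrow> f (g v) = g (f v)"
    and nontrivial: "(UNIV :: 'b set) \<noteq> {0}"
  shows "\<exists>v. v \<noteq> 0 \<and> (\<forall>f\<in>S. f v = 0)"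
proof -
  define invariant where
    "invariant U \<longleftrightarrow> subspace U \<and> U \<noteq> {0} \<and> (\<forall>f\<in>S. \<forall>u\<in>U. f u \<in> U)" for U
  have "invariant UNIV" using nontrivial by (simp add: invariant_def)
  then obtain U where U: "invariant U" and minimal: "\<And>U'. invariant U' \<Longrightarrow> dim U \<le> dim U'"
    using ex_has_least_nat[of invariant UNIV dim] by blast
  have "subspace U" "U \<noteq> {0}" and closed: "\<And>f u. f \<in> S \<Longrightarrow> u \<in> U \<Longrightarrow> f u \<in> U"
    using U by (auto simp: invariant_def)
  then obtain u where u: "u \<in> U" "u \<noteq> 0" using subspace_0 by blast
  have "f u = 0" if f: "f \<in> S" for f
  proof -
    interpret f: Vector_Spaces.linear scale scale f by (rule lin) (rule f)
    define K where "K = {v \<in> U. f v = 0}"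
    obtain l where l: "(f ^^ l) u \<noteq> 0" "f ((f ^^ l) u) = 0"
      using nilpotent[OF f] funpow_last_nonzero[OF u(2)] by metis
    moreover have "(f ^^ l) u \<in> U" by (induction l) (auto simp: u closed f)
    ultimately have "K \<noteq> {0}" by (auto simp: K_def)
    moreover have "subspace K"
      using \<open>subspace U\<close> by (auto simp: K_def subspace_def f.add f.scale)
    moreover have "g v \<in> K" if "g \<in> S" "v \<in> K" for g v
      using that comm[OF f that(1)] closed Vector_Spaces.linear.axioms(3)[OF lin[OF that(1)]]
      by (auto simp: K_def module_hom.zero)
    ultimately have "invariant K" by (auto simp: invariant_def)
    then have "K = U"
      using minimal subspace_dim_equal[OF \<open>subspace K\<close> \<open>subspace U\<close>] by (auto simp: K_def)
    then show ?thesis using u(1) by (auto simp: K_def)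
  qed
  with u(2) show ?thesis by blast
qed


section \<open>Lie algebras, quotients and powers\<close>

locale lie_algebra =
  fixes L :: "('k::field, 'a) lie_algebra"
  assumes closed: "lie_subalgebra (lcarrier L) L"
    and add_assoc: "x \<in> lcarrier L \<Longrightarrow> y \<in> lcarrier L \<Longrightarrow> z \<in> lcarrier L \<Longrightarrow>
      ladd L (ladd L x y) z = ladd L x (ladd L y z)"
    and add_commute: "x \<in> lcarrier L \<Longrightarrow> y \<in> lcarrier L \<Longrightarrow> ladd L x y = ladd L y x"
    and add_zero: "x \<in> lcarrier L \<Longrightarrow> ladd L x (lzero L) = x"
    and add_minus: "x \<in> lcarrier L \<Longrightarrow> ladd L x (lscale L (-1) x) = lzero L"
    and scale_add: "x \<in> lcarrier L \<Longrightarrow> y \<in> lcarrier L \<Longrightarrow>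
      lscale L c (ladd L x y) = ladd L (lscale L c x) (lscale L c y)"
    and add_scale: "x \<in> lcarrier L \<Longrightarrow> lscale L (c + d) x = ladd L (lscale L c x) (lscale L d x)"
    and scale_scale: "x \<in> lcarrier L \<Longrightarrow> lscale L c (lscale L d x) = lscale L (c * d) x"
    and scale_one: "x \<in> lcarrier L \<Longrightarrow> lscale L 1 x = x"
    and bracket_add_left: "x \<in> lcarrier L \<Longrightarrow> y \<in> lcarrier L \<Longrightarrow> z \<in> lcarrier L \<Longrightarrow>
      lbracket L (ladd L x y) z = ladd L (lbracket L x z) (lbracket L y z)"
    and bracket_add_right: "x \<in> lcarrier L \<Longrightarrow> y \<in> lcarrier L \<Longrightarrow> z \<in> lcarrier L \<Longrightarrow>
      lbracket L x (ladd L y z) = ladd L (lbracket L x y) (lbracket L x z)"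
    and bracket_scale_left: "x \<in> lcarrier L \<Longrightarrow> y \<in> lcarrier L \<Longrightarrow>
      lbracket L (lscale L c x) y = lscale L c (lbracket L x y)"
    and bracket_scale_right: "x \<in> lcarrier L \<Longrightarrow> y \<in> lcarrier L \<Longrightarrow>
      lbracket L x (lscale L c y) = lscale L c (lbracket L x y)"
    and bracket_self: "x \<in> lcarrier L \<Longrightarrow> lbracket L x x = lzero L"
    and jacobi: "x \<in> lcarrier L \<Longrightarrow> y \<in> lcarrier L \<Longrightarrow> z \<in> lcarrier L \<Longrightarrow>
      ladd L (lbracket L x (lbracket L y z))
        (ladd L (lbracket L y (lbracket L z x)) (lbracket L z (lbracket L x y))) = lzero L"
begin

lemma carrier_closed [simp]:
  "lzero L \<in> lcarrier L"
  "x \<in> lcarrier L \<Longrightarrow> y \<in> lcarrier L \<Longrightarrow> ladd L x y \<in> lcarrier L"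
  "x \<in> lcarrier L \<Longrightarrow> lscale L c x \<in> lcarrier L"
  "x \<in> lcarrier L \<Longrightarrow> y \<in> lcarrier L \<Longrightarrow> lbracket L x y \<in> lcarrier L"
  using closed by (auto simp: lie_subalgebra_def)

lemma zero_add: "x \<in> lcarrier L \<Longrightarrow> ladd L (lzero L) x = x"
  by (simp add: add_commute[of "lzero L"] add_zero)

lemma minus_add_cancel:
  assumes "x \<in> lcarrier L" "y \<in> lcarrier L"
  shows "ladd L (lscale L (-1) x) (ladd L x y) = y"
  using assms
  by (simp add: add_assoc[symmetric] add_commute[of "lscale L (-1) x"] add_minus zero_add)

lemma add_minus_cancel:
  assumes "x \<in> lcarrier L" "y \<in> lcarrier L"
  shows "ladd L x (ladd L (lscale L (-1) x) y) = y"
  using assms by (simp add: add_assoc[symmetric] add_minus zero_add)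

lemma eq_minus_if_add_eq_zero:
  assumes "x \<in> lcarrier L" "y \<in> lcarrier L" "ladd L x y = lzero L"
  shows "y = lscale L (-1) x"
  using minus_add_cancel[OF assms(1,2)] assms by (simp add: add_zero)

lemma bracket_swap:
  assumes "x \<in> lcarrier L" "y \<in> lcarrier L"
  shows "lbracket L y x = lscale L (-1) (lbracket L x y)"
proof (rule eq_minus_if_add_eq_zero)
  have "lzero L = lbracket L (ladd L x y) (ladd L x y)" using assms by (simp add: bracket_self)
  also have "\<dots> = ladd L (lbracket L x y) (lbracket L y x)"
    using assms
    by (simp add: bracket_add_left bracket_add_right bracket_self[of x] bracket_self[of y]
      zero_add add_zero add_commute[of "lbracket L y x"])
  finally show "ladd L (lbracket L x y) (lbracket L y x) = lzero L" ..
qed (use assms in auto)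

end

lemma lie_algebra_subalgebra:
  assumes "lie_algebra L" "lie_subalgebra H L"
  shows "lie_algebra (L\<lparr>lcarrier := H\<rparr>)"
proof -
  interpret lie_algebra L by fact
  have "x \<in> H \<Longrightarrow> x \<in> lcarrier L" for x using assms(2) by (auto simp: lie_subalgebra_def)
  then show ?thesis
    by unfold_locales
      (use assms(2) in \<open>auto simp: lie_subalgebra_def add_assoc add_zero add_minus scale_add
        add_scale scale_scale scale_one bracket_add_left bracket_add_right bracket_scale_left
        bracket_scale_right bracket_self jacobi intro: add_commute\<close>)
qed

lemma lie_algebra_power:
  assumes "lie_algebra M"
  shows "lie_algebra (lie_power M k)"
proof -
  interpret lie_algebra M by fact
  show ?thesis
    by unfold_locales
      (auto simp: lie_power_def lie_subalgebra_def PiE_iff restrict_def fun_eq_iff extensional_def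
        add_assoc add_zero add_minus scale_add add_scale scale_scale scale_one bracket_add_left
        bracket_add_right bracket_scale_left bracket_scale_right bracket_self jacobi
        intro: add_commute)
qed

lemma lie_generate_superset: "S \<subseteq> lcarrier (lie_generate L S)"
  by (auto simp: lie_generate_def)

lemma lie_generate_minimal:
  "lie_subalgebra H L \<Longrightarrow> S \<subseteq> H \<Longrightarrow> lcarrier (lie_generate L S) \<subseteq> H"
  by (auto simp: lie_generate_def)

lemma lie_subalgebra_generate:
  assumes "lie_algebra L" "S \<subseteq> lcarrier L"
  shows "lie_subalgebra (lcarrier (lie_generate L S)) L"
proof -
  have "lie_subalgebra (lcarrier L) L" using assms(1) by (rule lie_algebra.closed)
  then show ?thesis
    using assms(2) by (auto simp: lie_subalgebra_def lie_generate_def)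
qed

definition lie_ideal :: "'a set \<Rightarrow> ('k, 'a) lie_algebra \<Rightarrow> bool" where
  "lie_ideal I L \<longleftrightarrow> lie_subalgebra I L \<and> (\<forall>x\<in>I. \<forall>y\<in>lcarrier L. lbracket L x y \<in> I)"

lemma lie_ideal_bracket_right:
  assumes "lie_algebra L" "lie_ideal I L" "x \<in> lcarrier L" "y \<in> I"
  shows "lbracket L x y \<in> I"
proof -
  interpret lie_algebra L by fact
  have "y \<in> lcarrier L" "lbracket L y x \<in> I"
    using assms by (auto simp: lie_ideal_def lie_subalgebra_def)
  then show ?thesis
    using bracket_swap[of y x] assms by (auto simp: lie_ideal_def lie_subalgebra_def)
qed

definition lie_hom :: "('k, 'a) lie_algebra \<Rightarrow> ('k, 'b) lie_algebra \<Rightarrow> ('a \<Rightarrow> 'b) \<Rightarrow> bool" where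
  "lie_hom L M f \<longleftrightarrow> f ` lcarrier L \<subseteq> lcarrier M \<and>
     (\<forall>x\<in>lcarrier L. \<forall>y\<in>lcarrier L. f (ladd L x y) = ladd M (f x) (f y)) \<and>
     (\<forall>c. \<forall>x\<in>lcarrier L. f (lscale L c x) = lscale M c (f x)) \<and>
     (\<forall>x\<in>lcarrier L. \<forall>y\<in>lcarrier L. f (lbracket L x y) = lbracket M (f x) (f y))"

definition lie_kernel :: "('k, 'a) lie_algebra \<Rightarrow> ('k, 'b) lie_algebra \<Rightarrow> ('a \<Rightarrow> 'b) \<Rightarrow> 'a set" where
  "lie_kernel L M f = {x \<in> lcarrier L. f x = lzero M}"

lemma lie_coset_kernel:
  assumes "lie_algebra L" "lie_algebra M" and f: "lie_hom L M f" and x: "x \<in> lcarrier L"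
  shows "lie_coset L (lie_kernel L M f) x = {y \<in> lcarrier L. f y = f x}"
proof (intro set_eqI iffI)
  interpret L: lie_algebra L by fact
  interpret M: lie_algebra M by fact
  have f_in: "f y \<in> lcarrier M" if "y \<in> lcarrier L" for y using f that by (auto simp: lie_hom_def)
  fix y
  show "y \<in> {y \<in> lcarrier L. f y = f x}" if "y \<in> lie_coset L (lie_kernel L M f) x"
    using that f x f_in by (auto simp: lie_coset_def lie_kernel_def lie_hom_def M.add_zero)
  show "y \<in> lie_coset L (lie_kernel L M f) x" if "y \<in> {y \<in> lcarrier L. f y = f x}"
  proof -
    have y: "y \<in> lcarrier L" "f y = f x" using that by auto
    let ?z = "ladd L (lscale L (-1) x) y"
    have "f ?z = ladd M (lscale M (-1) (f x)) (f x)" using f x y by (simp add: lie_hom_def)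
    then have "f ?z = lzero M"
      using f_in[OF x] by (simp add: M.add_commute[of "lscale M (-1) (f x)"] M.add_minus)
    then have "?z \<in> lie_kernel L M f" using x y by (simp add: lie_kernel_def)
    moreover have "y = ladd L x ?z" using x y by (simp add: L.add_minus_cancel)
    ultimately show ?thesis unfolding lie_coset_def by blast
  qed
qed

theorem lie_quotient_kernel_isomorphic:
  assumes L: "lie_algebra L" and M: "lie_algebra M" and f: "lie_hom L M f"
    and onto: "f ` lcarrier L = lcarrier M"
  shows "lie_isomorphic (lie_quotient L (lie_kernel L M f)) M"
proof -
  interpret L: lie_algebra L by fact
  define Q where "Q = lie_quotient L (lie_kernel L M f)"
  define fibre where "fibre x = {y \<in> lcarrier L. f y = f x}" for x
  define g where "g A = f (SOME a. a \<in> A)" for A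
  have coset: "lie_coset L (lie_kernel L M f) x = fibre x" if "x \<in> lcarrier L" for x
    using lie_coset_kernel[OF L M f that] by (simp add: fibre_def)
  have g: "g (fibre x) = f x" if "x \<in> lcarrier L" for x
  proof -
    have "(SOME a. a \<in> fibre x) \<in> fibre x"
      by (rule someI[of _ x]) (use that in \<open>simp add: fibre_def\<close>)
    then show ?thesis by (simp add: g_def fibre_def)
  qed
  have carrier: "lcarrier Q = fibre ` lcarrier L"
    by (auto simp: Q_def lie_quotient_def coset)
  have ops: "ladd Q (fibre x) (fibre y) = fibre (ladd L x y)"
    "lscale Q c (fibre x) = fibre (lscale L c x)"
    "lbracket Q (fibre x) (fibre y) = fibre (lbracket L x y)"
    if "x \<in> lcarrier L" "y \<in> lcarrier L" for x y c
    using that f by (auto simp: Q_def lie_quotient_def fibre_def coset lie_hom_def)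
  have "inj_on g (fibre ` lcarrier L)"
    by (rule inj_onI) (auto simp: g, auto simp: fibre_def)
  then have "bij_betw g (lcarrier Q) (lcarrier M)"
    by (simp add: bij_betw_def carrier image_image g flip: onto)
  then show ?thesis
    using f unfolding lie_isomorphic_def Q_def[symmetric] carrier
    by (intro exI[of _ g]) (auto simp: ops g lie_hom_def)
qed

lemma lie_hom_power:
  assumes "\<And>i. i < k \<Longrightarrow> lie_hom L M (f i)"
  shows "lie_hom L (lie_power M k) (\<lambda>x. \<lambda>i\<in>{..<k}. f i x)"
  using assms by (auto simp: lie_hom_def lie_power_def image_subset_iff intro!: restrict_ext)

theorem lie_quotient_power_isomorphic:
  assumes L: "lie_algebra L" and M: "lie_algebra M" and S: "finite S"
    and hom: "\<And>p. p \<in> S \<Longrightarrow> lie_hom L M (f p)"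
    and onto: "\<And>y. (\<And>p. p \<in> S \<Longrightarrow> y p \<in> lcarrier M) \<Longrightarrow> \<exists>x\<in>lcarrier L. \<forall>p\<in>S. f p x = y p"
  shows "lie_isomorphic (lie_quotient L {x \<in> lcarrier L. \<forall>p\<in>S. f p x = lzero M})
    (lie_power M (card S))"
proof -
  define k where "k = card S"
  obtain h where "bij_betw h {..<k} S"
    using ex_bij_betw_nat_finite[OF S] by (auto simp: k_def lessThan_atLeast0)
  then have h: "inj_on h {..<k}" "S = h ` {..<k}" by (auto simp: bij_betw_def)
  define F where "F x = (\<lambda>i\<in>{..<k}. f (h i) x)" for x
  have F: "lie_hom L (lie_power M k) F"
    unfolding F_def by (rule lie_hom_power) (auto simp: h hom)
  have "lcarrier (lie_power M k) \<subseteq> F ` lcarrier L"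
  proof
    fix y assume y: "y \<in> lcarrier (lie_power M k)"
    define y' where "y' p = y (the_inv_into {..<k} h p)" for p
    have y': "y' (h i) = y i" if "i < k" for i
      using that h(1) by (simp add: y'_def the_inv_into_f_f)
    then have "y' p \<in> lcarrier M" if "p \<in> S" for p
      using y that by (auto simp: h(2) lie_power_def)
    then obtain x where x: "x \<in> lcarrier L" "\<forall>p\<in>S. f p x = y' p" using onto by blast
    have "F x = y"
      using x(2) y y' by (auto simp: F_def h(2) lie_power_def PiE_iff extensional_def fun_eq_iff)
    then show "y \<in> F ` lcarrier L" using x(1) by blast
  qed
  moreover have "F ` lcarrier L \<subseteq> lcarrier (lie_power M k)" using F by (simp add: lie_hom_def)
  ultimately have "lie_isomorphic (lie_quotient L (lie_kernel L (lie_power M k) F)) (lie_power M k)"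
    by (intro lie_quotient_kernel_isomorphic L lie_algebra_power M F) blast
  moreover have "lie_kernel L (lie_power M k) F = {x \<in> lcarrier L. \<forall>p\<in>S. f p x = lzero M}"
    by (auto simp: lie_kernel_def lie_power_def F_def h(2) restrict_def fun_eq_iff)
  ultimately show ?thesis by (simp add: k_def)
qed


section \<open>Abelian ideals in irreducible representations\<close>

lemma lie_representationD:
  assumes "lie_representation L s \<phi>"
  shows "vector_space s"
    and "x \<in> lcarrier L \<Longrightarrow> Vector_Spaces.linear s s (\<phi> x)"
    and "x \<in> lcarrier L \<Longrightarrow> y \<in> lcarrier L \<Longrightarrow> \<phi> (ladd L x y) v = \<phi> x v + \<phi> y v"
    and "x \<in> lcarrier L \<Longrightarrow> \<phi> (lscale L c x) v = s c (\<phi> x v)"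
    and "x \<in> lcarrier L \<Longrightarrow> y \<in> lcarrier L \<Longrightarrow>
      \<phi> (lbracket L x y) v = \<phi> x (\<phi> y v) - \<phi> y (\<phi> x v)"
  using assms unfolding lie_representation_def by blast+

lemma lie_representation_zero:
  assumes "lie_representation L s \<phi>" "x \<in> lcarrier L"
  shows "\<phi> x 0 = 0"
  using lie_representationD(2)[OF assms]
  by (rule module_hom.zero[OF Vector_Spaces.linear.axioms(3)])

lemma lie_ideal_annihilator:
  assumes "lie_algebra L" and rep: "lie_representation L s \<phi>"
  shows "lie_ideal (lie_annihilator L \<phi>) L"
proof -
  interpret lie_algebra L by fact
  interpret vector_space s using rep by (rule lie_representationD)
  have "\<phi> (lzero L) v = 0" for v
    using lie_representationD(3)[OF rep, of "lzero L" "lzero L" v] by (simp add: add_zero)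
  then show ?thesis
    by (auto simp: lie_ideal_def lie_subalgebra_def lie_annihilator_def lie_representationD[OF rep]
      lie_representation_zero[OF rep])
qed

lemma lie_irreducible_ideal_acts_trivially:
  assumes irr: "lie_irreducible L s \<phi>"
    and C: "C \<subseteq> lcarrier L" "\<And>x z. x \<in> C \<Longrightarrow> z \<in> lcarrier L \<Longrightarrow> lbracket L x z \<in> C"
    and v: "v \<noteq> 0" "\<And>x. x \<in> C \<Longrightarrow> \<phi> x v = 0"
    and "x \<in> C"
  shows "\<phi> x w = 0"
proof -
  have rep: "lie_representation L s \<phi>" using irr by (simp add: lie_irreducible_def)
  interpret vector_space s using rep by (rule lie_representationD)
  define W where "W = (\<Inter>x\<in>C. {w. \<phi> x w = 0})"
  have "subspace {w. \<phi> x w = 0}" if "x \<in> C" for x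
    using lie_representationD(2)[OF rep] C(1) that
    by (intro module_hom.subspace_kernel[OF Vector_Spaces.linear.axioms(3)]) blast
  then have "subspace W" unfolding W_def by (rule subspace_Int)
  moreover have "\<phi> z w \<in> W" if z: "z \<in> lcarrier L" and w: "w \<in> W" for z w
  proof -
    have "\<phi> x (\<phi> z w) = 0" if x: "x \<in> C" for x
    proof -
      have "\<phi> x w = 0" "\<phi> (lbracket L x z) w = 0" using w x C(2)[OF x z] by (auto simp: W_def)
      then show ?thesis
        using lie_representationD(5)[OF rep subsetD[OF C(1) x] z, of w]
          lie_representation_zero[OF rep z] by simp
    qed
    then show ?thesis by (simp add: W_def)
  qed
  ultimately have "W = {0} \<or> W = UNIV" using irr by (simp add: lie_irreducible_def)
  moreover have "v \<in> W" using v(2) by (simp add: W_def)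
  ultimately have "W = UNIV" using v(1) by auto
  then show ?thesis using \<open>x \<in> C\<close> by (auto simp: W_def)
qed

text \<open>By Jacobson's lemma the brackets \<open>[x, y]\<close> with \<open>x \<in> A\<close> act by commuting nilpotent
  operators.\<close>

lemma lie_irreducible_abelian_ideal:
  fixes L :: "('k::field_char_0, 'a) lie_algebra" and s :: "'k \<Rightarrow> 'v::ab_group_add \<Rightarrow> 'v"
  assumes fd: "finite_dimensional_vector_space s B" and irr: "lie_irreducible L s \<phi>"
    and A: "lie_ideal A L"
    and abelian: "\<And>x y v. x \<in> A \<Longrightarrow> y \<in> A \<Longrightarrow> \<phi> (lbracket L x y) v = 0"
    and x: "x \<in> A" and y: "y \<in> lcarrier L"
  shows "\<phi> (lbracket L x y) v = 0"
proof -
  interpret finite_dimensional_vector_space s B by fact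
  have rep: "lie_representation L s \<phi>" using irr by (simp add: lie_irreducible_def)
  note lin = lie_representationD(2)[OF rep] and bracket = lie_representationD(5)[OF rep]
  have A_carrier: "x \<in> lcarrier L" if "x \<in> A" for x
    using A that by (auto simp: lie_ideal_def lie_subalgebra_def)
  have A_bracket: "lbracket L x y \<in> A" if "x \<in> A" "y \<in> lcarrier L" for x y
    using A that by (auto simp: lie_ideal_def)
  have commute: "\<phi> x (\<phi> y v) = \<phi> y (\<phi> x v)" if "x \<in> A" "y \<in> A" for x y v
    using abelian[OF that, of v] bracket[of x y v] that A_carrier by simp
  define C where "C = {lbracket L x y | x y. x \<in> A \<and> y \<in> lcarrier L}"
  have C_A: "z \<in> A" if "z \<in> C" for z using that A_bracket by (auto simp: C_def)
  have nilpotent: "\<exists>m. \<forall>v. (f ^^ m) v = 0" if "f \<in> \<phi> ` C" for f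
  proof -
    obtain x y where f: "f = \<phi> (lbracket L x y)" and xy: "x \<in> A" "y \<in> lcarrier L"
      using \<open>f \<in> \<phi> ` C\<close> unfolding C_def by blast
    note x_in = A_carrier[OF xy(1)]
    show ?thesis
      unfolding f
    proof (rule commutator_nilpotent[OF fd lin[OF x_in] lin[OF xy(2)]])
      show "\<phi> x (\<phi> y v) = \<phi> y (\<phi> x v) + \<phi> (lbracket L x y) v" for v
        by (simp add: bracket[OF x_in xy(2)])
      show "\<phi> x (\<phi> (lbracket L x y) v) = \<phi> (lbracket L x y) (\<phi> x v)" for v
        using xy by (intro commute A_bracket)
    qed
  qed
  have "\<exists>v. v \<noteq> 0 \<and> (\<forall>f\<in>\<phi> ` C. f v = 0)"
    by (rule commuting_nilpotents_common_kernel[OF _ nilpotent])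
      (use C_A A_carrier lin commute irr in \<open>auto simp: lie_irreducible_def\<close>)
  then obtain v0 where v0: "v0 \<noteq> 0" "\<And>z. z \<in> C \<Longrightarrow> \<phi> z v0 = 0" by auto
  show ?thesis
  proof (rule lie_irreducible_ideal_acts_trivially[OF irr _ _ v0])
    show "C \<subseteq> lcarrier L" using C_A A_carrier by blast
    show "lbracket L x z \<in> C" if "x \<in> C" "z \<in> lcarrier L" for x z
      using C_A[OF that(1)] that(2) unfolding C_def by blast
    show "lbracket L x y \<in> C" using x y unfolding C_def by blast
  qed
qed


section \<open>Lagrange interpolation\<close>

definition lagrange_basis :: "'k::field set \<Rightarrow> 'k \<Rightarrow> 'k poly" where
  "lagrange_basis A a = smult (inverse (\<Prod>b\<in>A - {a}. a - b)) (\<Prod>b\<in>A - {a}. [:- b, 1:])"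

lemma poly_lagrange_basis:
  assumes "finite A" "x \<in> A"
  shows "poly (lagrange_basis A a) x = (if x = a then 1 else 0)"
  using assms by (auto simp: lagrange_basis_def poly_prod)

lemma degree_lagrange_basis:
  assumes "finite A" "a \<in> A"
  shows "degree (lagrange_basis A a) < card A"
proof -
  have "degree (\<Prod>b\<in>A - {a}. [:- b, 1:]) = card (A - {a})"
    by (subst degree_prod_eq_sum_degree) auto
  then have "degree (lagrange_basis A a) \<le> card (A - {a})"
    using degree_smult_le[of _ "\<Prod>b\<in>A - {a}. [:- b, 1:]"] by (metis lagrange_basis_def)
  also have "\<dots> < card A" using assms by (rule card_Diff1_less)
  finally show ?thesis .
qed

lemma sum_lagrange_basis:
  assumes "finite A" "A \<noteq> {}"
  shows "(\<Sum>a\<in>A. lagrange_basis A a) = 1"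
proof (rule poly_eqI_degree[of A])
  show "degree (\<Sum>a\<in>A. lagrange_basis A a) < card A"
    using assms by (intro degree_sum_less degree_lagrange_basis) (auto simp: card_gt_0_iff)
qed (use assms in \<open>auto simp: poly_sum poly_lagrange_basis card_gt_0_iff\<close>)

lemma prod_linear_factors_dvd_lagrange_basis:
  assumes "finite A" "a \<in> A"
  shows "(\<Prod>b\<in>A. [:- b, 1:]) dvd [:- a, 1:] * lagrange_basis A a"
  by (simp add: lagrange_basis_def dvd_smult prod.remove[OF assms])


section \<open>Algebras with involution\<close>

sublocale inv_algebra \<subseteq> vs: vector_space "ascale R"
  by (rule scale)

context inv_algebra
begin

abbreviation mult (infixl "\<cdot>" 70) where "a \<cdot> b \<equiv> amult R a b"
abbreviation scaled (infixr "\<odot>" 75) where "c \<odot> a \<equiv> ascale R c a"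
abbreviation star ("_\<^sup>\<dagger>" [1000] 1000) where "a\<^sup>\<dagger> \<equiv> astar R a"
abbreviation unit ("\<one>") where "\<one> \<equiv> aone R"

lemma mult_zero_left [simp]: "0 \<cdot> a = 0"
  using mult_add_left[of 0 0 a] by simp

lemma mult_zero_right [simp]: "a \<cdot> 0 = 0"
  using mult_add_right[of a 0 0] by simp

lemma mult_diff_left: "(a - b) \<cdot> c = a \<cdot> c - b \<cdot> c"
  using mult_add_left[of "a - b" b c] by simp

lemma mult_diff_right: "a \<cdot> (b - c) = a \<cdot> b - a \<cdot> c"
  using mult_add_right[of a "b - c" c] by simp

lemma mult_sum_left: "sum f A \<cdot> b = (\<Sum>x\<in>A. f x \<cdot> b)"
  by (induction A rule: infinite_finite_induct) (auto simp: mult_add_left)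

lemma mult_sum_right: "b \<cdot> sum f A = (\<Sum>x\<in>A. b \<cdot> f x)"
  by (induction A rule: infinite_finite_induct) (auto simp: mult_add_right)

lemma star_zero [simp]: "0\<^sup>\<dagger> = 0"
  using star_add[of 0 0] by simp

lemma star_diff: "(a - b)\<^sup>\<dagger> = a\<^sup>\<dagger> - b\<^sup>\<dagger>"
  using star_add[of "a - b" b] by simp

lemma star_sum: "(sum f A)\<^sup>\<dagger> = (\<Sum>x\<in>A. (f x)\<^sup>\<dagger>)"
  by (induction A rule: infinite_finite_induct) (auto simp: star_add)

lemma star_one [simp]: "\<one>\<^sup>\<dagger> = \<one>"
  using star_mult[of \<one> "\<one>\<^sup>\<dagger>"] by (simp add: star_star one_mult mult_one)

lemma central_star:
  assumes "\<And>b. z \<cdot> b = b \<cdot> z"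
  shows "z\<^sup>\<dagger> \<cdot> b = b \<cdot> z\<^sup>\<dagger>"
  using arg_cong[OF assms[of "b\<^sup>\<dagger>"], of "astar R"] by (simp add: star_mult star_star)

lemma linear_mult_left: "Vector_Spaces.linear (ascale R) (ascale R) (amult R a)"
  by (simp add: Vector_Spaces.linear_iff vs.vector_space_axioms mult_add_right mult_scale_right)

lemma linear_mult_right: "Vector_Spaces.linear (ascale R) (ascale R) (\<lambda>x. x \<cdot> a)"
  by (simp add: Vector_Spaces.linear_iff vs.vector_space_axioms mult_add_left mult_scale_left)

definition alg_eval :: "'r \<Rightarrow> 'k poly \<Rightarrow> 'r" where
  "alg_eval z P = poly_op (ascale R) (amult R z) P \<one>"

lemma poly_op_mult_left: "poly_op (ascale R) (amult R z) P x = alg_eval z P \<cdot> x"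
  using vs.poly_op_commute[OF linear_mult_right[of x], of "amult R z" P \<one>]
  by (simp add: alg_eval_def mult_assoc one_mult)

lemma alg_eval_pCons: "alg_eval z (pCons a P) = a \<odot> \<one> + z \<cdot> alg_eval z P"
  using vs.poly_op_commute[OF linear_mult_left[of z], of "amult R z" P \<one>]
  by (simp add: alg_eval_def)

lemma alg_eval_0 [simp]: "alg_eval z 0 = 0"
  and alg_eval_1 [simp]: "alg_eval z 1 = \<one>"
  and alg_eval_add: "alg_eval z (P + Q) = alg_eval z P + alg_eval z Q"
  and alg_eval_smult: "alg_eval z (smult c P) = c \<odot> alg_eval z P"
  and alg_eval_sum: "alg_eval z (sum F A) = (\<Sum>x\<in>A. alg_eval z (F x))"
  by (simp_all add: alg_eval_def vs.poly_op_add vs.poly_op_smult vs.poly_op_sum)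

lemma alg_eval_mult: "alg_eval z (P * Q) = alg_eval z P \<cdot> alg_eval z Q"
  using vs.poly_op_mult[OF linear_mult_left, of z P Q \<one>]
  by (simp add: poly_op_mult_left mult_one)

lemma alg_eval_linear_factor: "alg_eval z ([:- a, 1:] * P) = (z - a \<odot> \<one>) \<cdot> alg_eval z P"
  unfolding alg_eval_mult by (simp add: alg_eval_pCons mult_one)

lemma alg_eval_central:
  assumes "\<And>b. z \<cdot> b = b \<cdot> z"
  shows "alg_eval z P \<cdot> b = b \<cdot> alg_eval z P"
proof (induction P)
  case (pCons a P)
  have "z \<cdot> alg_eval z P \<cdot> b = b \<cdot> (z \<cdot> alg_eval z P)"
    by (metis assms mult_assoc pCons.IH)
  then show ?case
    by (simp add: alg_eval_pCons mult_add_left mult_add_right mult_scale_left mult_scale_right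
      one_mult mult_one)
qed simp

end


section \<open>Ideals\<close>

locale alg_ideal = inv_algebra R
  for R :: "('k::field_char_0, 'r::ab_group_add) inv_algebra" +
  fixes J :: "'r set"
  assumes subspace: "vs.subspace J"
    and mult_left_mem: "a \<in> J \<Longrightarrow> b \<cdot> a \<in> J"
    and mult_right_mem: "a \<in> J \<Longrightarrow> a \<cdot> b \<in> J"
begin

lemmas zero_mem = vs.subspace_0[OF subspace]
  and add_mem = vs.subspace_add[OF subspace]
  and diff_mem = vs.subspace_diff[OF subspace]
  and minus_mem = vs.subspace_neg[OF subspace]
  and scale_mem = vs.subspace_scale[OF subspace]
  and sum_mem = vs.subspace_sum[OF subspace]

lemma scale_mem_iff:
  assumes "c \<noteq> 0"
  shows "c \<odot> a \<in> J \<longleftrightarrow> a \<in> J"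
  using scale_mem[of "c \<odot> a" "inverse c"] scale_mem[of a c] assms by auto

lemma one_mem_iff: "\<one> \<in> J \<longleftrightarrow> J = UNIV"
  using mult_left_mem[of \<one>] by (auto simp: mult_one)

lemma alg_ideal_transporter:
  assumes "\<And>b. e \<cdot> b = b \<cdot> e"
  shows "alg_ideal R {x. x \<cdot> e \<in> J}"
proof (intro alg_ideal.intro alg_ideal_axioms.intro inv_algebra_axioms)
  show "vs.subspace {x. x \<cdot> e \<in> J}"
    by (auto simp: vs.subspace_def mult_add_left mult_scale_left zero_mem add_mem scale_mem)
  show "b \<cdot> x \<in> {x. x \<cdot> e \<in> J}" "x \<cdot> b \<in> {x. x \<cdot> e \<in> J}" if "x \<in> {x. x \<cdot> e \<in> J}" for x b
    using that mult_left_mem[of "x \<cdot> e" b] mult_right_mem[of "x \<cdot> e" b]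
    by (simp_all add: mult_assoc assms)
qed

text \<open>The spectral projections are the Lagrange basis polynomials in \<open>z\<close>, which modulo \<open>J\<close>
  are idempotents with sum \<open>1\<close>.\<close>

lemma central_spectral_decomposition:
  assumes z: "\<And>b. z \<cdot> b = b \<cdot> z" and A: "finite A"
    and annihilates: "alg_eval z (\<Prod>a\<in>A. [:- a, 1:]) \<in> J"
  shows "\<exists>N. (\<forall>a\<in>A. alg_ideal R (N a) \<and> J \<subseteq> N a \<and> z - a \<odot> \<one> \<in> N a) \<and> J = (\<Inter>a\<in>A. N a)"
proof -
  define e where "e a = alg_eval z (lagrange_basis A a)" for a
  define N where "N a = {x. x \<cdot> e a \<in> J}" for a
  have "alg_ideal R (N a)" for a
    unfolding N_def e_def by (rule alg_ideal_transporter) (rule alg_eval_central[OF z])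
  moreover have J_le: "J \<subseteq> N a" for a by (auto simp: N_def mult_right_mem)
  moreover have "z - a \<odot> \<one> \<in> N a" if "a \<in> A" for a
  proof -
    obtain Q where Q: "[:- a, 1:] * lagrange_basis A a = (\<Prod>b\<in>A. [:- b, 1:]) * Q"
      using prod_linear_factors_dvd_lagrange_basis[OF A \<open>a \<in> A\<close>] unfolding dvd_def by blast
    have "alg_eval z ((\<Prod>b\<in>A. [:- b, 1:]) * Q) \<in> J"
      unfolding alg_eval_mult using annihilates by (rule mult_right_mem)
    then show ?thesis
      unfolding Q[symmetric] alg_eval_linear_factor by (simp add: N_def e_def)
  qed
  moreover have "J = (\<Inter>a\<in>A. N a)"
  proof (intro equalityI INT_greatest J_le subsetI)
    fix x assume x: "x \<in> (\<Inter>a\<in>A. N a)"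
    show "x \<in> J"
    proof (cases "A = {}")
      case True
      then show ?thesis using annihilates one_mem_iff by simp
    next
      case False
      have "x = x \<cdot> (\<Sum>a\<in>A. e a)"
        using sum_lagrange_basis[OF A False]
        by (simp add: e_def alg_eval_sum[symmetric] mult_one)
      also have "\<dots> \<in> J" unfolding mult_sum_right by (rule sum_mem) (use x in \<open>auto simp: N_def\<close>)
      finally show ?thesis .
    qed
  qed
  ultimately show ?thesis by blast
qed

lemma joint_central_spectral_decomposition:
  assumes z: "\<And>b. z \<cdot> b = b \<cdot> z" "\<And>b. w \<cdot> b = b \<cdot> w" and finite: "finite A" "finite B"
    and annihilates: "alg_eval z (\<Prod>a\<in>A. [:- a, 1:]) \<in> J" "alg_eval w (\<Prod>b\<in>B. [:- b, 1:]) \<in> J"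
  shows "\<exists>N. (\<forall>a\<in>A. \<forall>b\<in>B. alg_ideal R (N a b) \<and> z - a \<odot> \<one> \<in> N a b \<and> w - b \<odot> \<one> \<in> N a b) \<and>
    J = (\<Inter>a\<in>A. \<Inter>b\<in>B. N a b)"
proof -
  obtain N where N: "\<forall>a\<in>A. alg_ideal R (N a) \<and> J \<subseteq> N a \<and> z - a \<odot> \<one> \<in> N a"
    and J_eq: "J = (\<Inter>a\<in>A. N a)"
    using central_spectral_decomposition[OF z(1) finite(1) annihilates(1)] by blast
  have "\<forall>a\<in>A. \<exists>N'. (\<forall>b\<in>B. alg_ideal R (N' b) \<and> N a \<subseteq> N' b \<and> w - b \<odot> \<one> \<in> N' b) \<and>
      N a = (\<Inter>b\<in>B. N' b)"
  proof
    fix a assume "a \<in> A"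
    then have "alg_ideal R (N a)" "alg_eval w (\<Prod>b\<in>B. [:- b, 1:]) \<in> N a"
      using annihilates(2) N by auto
    then show "\<exists>N'. (\<forall>b\<in>B. alg_ideal R (N' b) \<and> N a \<subseteq> N' b \<and> w - b \<odot> \<one> \<in> N' b) \<and>
        N a = (\<Inter>b\<in>B. N' b)"
      by (intro alg_ideal.central_spectral_decomposition[OF _ z(2) finite(2)])
  qed
  then obtain N' where N': "\<forall>a\<in>A. (\<forall>b\<in>B. alg_ideal R (N' a b) \<and> N a \<subseteq> N' a b \<and>
      w - b \<odot> \<one> \<in> N' a b) \<and> N a = (\<Inter>b\<in>B. N' a b)"
    unfolding bchoice_iff by blast
  have "J = (\<Inter>a\<in>A. \<Inter>b\<in>B. N' a b)" using J_eq N' by simp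
  moreover have "\<forall>a\<in>A. \<forall>b\<in>B. alg_ideal R (N' a b) \<and> z - a \<odot> \<one> \<in> N' a b \<and> w - b \<odot> \<one> \<in> N' a b"
    using N N' by blast
  ultimately show ?thesis by blast
qed

end

locale star_ideal = alg_ideal +
  assumes star_mem: "a \<in> J \<Longrightarrow> a\<^sup>\<dagger> \<in> J"


section \<open>Averaging over conjugations\<close>

text \<open>The average over the conjugations by the units in \<open>U\<close> plays the role of the projection of
  \<open>R\<close> to its centre along the commutators.\<close>

locale averaging_algebra = inv_algebra R
  for R :: "('k::field_char_0, 'r::ab_group_add) inv_algebra" +
  fixes U :: "('r \<times> 'r) set"
  assumes finite_units: "finite U" and units_nonempty: "U \<noteq> {}"
    and unit_inverse: "(u, v) \<in> U \<Longrightarrow> u \<cdot> v = \<one>" "(u, v) \<in> U \<Longrightarrow> v \<cdot> u = \<one>"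
    and sum_conj_commute: "(\<Sum>(u, v)\<in>U. u \<cdot> (a \<cdot> b) \<cdot> v) = (\<Sum>(u, v)\<in>U. u \<cdot> (b \<cdot> a) \<cdot> v)"
begin

definition avg :: "'r \<Rightarrow> 'r" where
  "avg a = inverse (of_nat (card U)) \<odot> (\<Sum>(u, v)\<in>U. u \<cdot> a \<cdot> v)"

lemma avg_add: "avg (a + b) = avg a + avg b"
  by (simp add: avg_def mult_add_left mult_add_right case_prod_unfold sum.distrib
    vs.scale_right_distrib)

lemma avg_scale: "avg (c \<odot> a) = c \<odot> avg a"
  by (simp add: avg_def mult_scale_left mult_scale_right case_prod_unfold
    vs.scale_sum_right[symmetric] mult.commute)

lemma linear_avg: "Vector_Spaces.linear (ascale R) (ascale R) avg"
  by (simp add: Vector_Spaces.linear_iff vs.vector_space_axioms avg_add avg_scale)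

sublocale avg: Vector_Spaces.linear "ascale R" "ascale R" avg
  by (rule linear_avg)

lemma avg_mult_commute: "avg (a \<cdot> b) = avg (b \<cdot> a)"
  by (simp add: avg_def sum_conj_commute)

lemma avg_commutator: "avg (a \<cdot> b - b \<cdot> a) = 0"
  by (simp add: avg.diff avg_mult_commute[of a b])

lemma diff_avg: "a - avg a = inverse (of_nat (card U)) \<odot> (\<Sum>(u, v)\<in>U. a - u \<cdot> a \<cdot> v)"
  using finite_units units_nonempty
  by (simp add: avg_def case_prod_unfold sum_subtractf vs.sum_constant_scale
    vs.scale_right_diff_distrib)

lemma diff_conj: "(u, v) \<in> U \<Longrightarrow> a - u \<cdot> a \<cdot> v = (a \<cdot> v) \<cdot> u - u \<cdot> (a \<cdot> v)"
  by (simp add: mult_assoc unit_inverse mult_one)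

lemma avg_avg [simp]: "avg (avg a) = avg a"
proof -
  have "avg (a - avg a) = inverse (of_nat (card U)) \<odot> (\<Sum>(u, v)\<in>U. avg (a - u \<cdot> a \<cdot> v))"
    unfolding diff_avg by (simp add: avg.scale avg.sum case_prod_unfold)
  also have "(\<Sum>(u, v)\<in>U. avg (a - u \<cdot> a \<cdot> v)) = 0"
    by (rule sum.neutral) (auto simp: diff_conj avg_commutator)
  finally show ?thesis by (simp add: avg.diff)
qed

lemma avg_star_eq_0:
  assumes "avg a = 0"
  shows "avg (a\<^sup>\<dagger>) = 0"
proof -
  have "a\<^sup>\<dagger> = (inverse (of_nat (card U)) \<odot> (\<Sum>(u, v)\<in>U. a - u \<cdot> a \<cdot> v))\<^sup>\<dagger>"
    using diff_avg[of a] assms by simp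
  then have "avg (a\<^sup>\<dagger>) =
      inverse (of_nat (card U)) \<odot> (\<Sum>(u, v)\<in>U. avg ((a - u \<cdot> a \<cdot> v)\<^sup>\<dagger>))"
    by (simp add: star_scale star_sum avg.scale avg.sum case_prod_unfold)
  also have "(\<Sum>(u, v)\<in>U. avg ((a - u \<cdot> a \<cdot> v)\<^sup>\<dagger>)) = 0"
  proof (rule sum.neutral, clarify)
    fix u v assume "(u, v) \<in> U"
    then show "avg ((a - u \<cdot> a \<cdot> v)\<^sup>\<dagger>) = 0"
      by (simp only: diff_conj star_diff[of "a \<cdot> v \<cdot> u"] star_mult avg_commutator)
  qed
  finally show ?thesis by simp
qed

end

locale averaging_ideal = averaging_algebra R U + alg_ideal R J
  for R :: "('k::field_char_0, 'r::ab_group_add) inv_algebra" and U J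
begin

lemma avg_mem: "a \<in> J \<Longrightarrow> avg a \<in> J"
  unfolding avg_def
  by (intro scale_mem sum_mem) (auto intro: mult_left_mem mult_right_mem)

lemma diff_avg_mem:
  assumes "\<And>b. b \<cdot> a - a \<cdot> b \<in> J"
  shows "a - avg a \<in> J"
  unfolding diff_avg
proof (intro scale_mem sum_mem, clarify)
  fix u v assume uv: "(u, v) \<in> U"
  then have "a - u \<cdot> a \<cdot> v = - ((u \<cdot> a - a \<cdot> u) \<cdot> v)"
    by (simp add: mult_diff_left mult_assoc unit_inverse mult_one)
  then show "a - u \<cdot> a \<cdot> v \<in> J" using assms[of u] by (simp add: minus_mem mult_right_mem)
qed

end


section \<open>Matrices over an algebra with involution\<close>

lemma sum_fun_apply: "sum f A x = (\<Sum>a\<in>A. f a x)"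
  by (induction A rule: infinite_finite_induct) auto

definition mat_trace :: "nat \<Rightarrow> (nat \<Rightarrow> nat \<Rightarrow> 'r::comm_monoid_add) \<Rightarrow> 'r" where
  "mat_trace N X = (\<Sum>i = 1..N. X i i)"

lemma e_mat_zero [simp]: "e_mat p q 0 = 0"
  and e_mat_add: "e_mat p q (a + b) = e_mat p q a + e_mat p q b"
  and e_mat_diff: "e_mat p q (a - b) = e_mat p q a - e_mat p q b"
  by (auto simp: e_mat_def fun_eq_iff)

lemma mat_trace_e_mat: "p \<in> {1..N} \<Longrightarrow> mat_trace N (e_mat p q a) = (if p = q then a else 0)"
  by (cases "p = q") (auto simp: mat_trace_def e_mat_def intro!: sum.neutral)

lemma mat_trace_diff:
  fixes X Y :: "nat \<Rightarrow> nat \<Rightarrow> 'r::ab_group_add"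
  shows "mat_trace N (X - Y) = mat_trace N X - mat_trace N Y"
  by (simp add: mat_trace_def sum_subtractf)

context inv_algebra
begin

definition mat_scale :: "'k \<Rightarrow> (nat \<Rightarrow> nat \<Rightarrow> 'r) \<Rightarrow> nat \<Rightarrow> nat \<Rightarrow> 'r" (infixr "\<odot>\<^sub>m" 75) where
  "c \<odot>\<^sub>m X = (\<lambda>i j. c \<odot> X i j)"

lemma mat_scale_apply [simp]: "(c \<odot>\<^sub>m X) i j = c \<odot> X i j"
  by (simp add: mat_scale_def)

sublocale mat: vector_space mat_scale
  by unfold_locales
    (simp_all add: fun_eq_iff vs.scale_right_distrib vs.scale_left_distrib)

lemma e_mat_scale: "e_mat p q (c \<odot> a) = c \<odot>\<^sub>m e_mat p q a"
  by (simp add: e_mat_def fun_eq_iff)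

lemma mat_mult_add_left: "mat_mult R N (X + Y) Z = mat_mult R N X Z + mat_mult R N Y Z"
  and mat_mult_add_right: "mat_mult R N X (Y + Z) = mat_mult R N X Y + mat_mult R N X Z"
  and mat_mult_diff_left: "mat_mult R N (X - Y) Z = mat_mult R N X Z - mat_mult R N Y Z"
  and mat_mult_diff_right: "mat_mult R N X (Y - Z) = mat_mult R N X Y - mat_mult R N X Z"
  and mat_mult_scale_left: "mat_mult R N (c \<odot>\<^sub>m X) Y = c \<odot>\<^sub>m mat_mult R N X Y"
  and mat_mult_scale_right: "mat_mult R N X (c \<odot>\<^sub>m Y) = c \<odot>\<^sub>m mat_mult R N X Y"
  by (simp_all add: mat_mult_def fun_eq_iff mult_add_left mult_add_right mult_diff_left
    mult_diff_right mult_scale_left mult_scale_right sum.distrib sum_subtractf vs.scale_sum_right)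

lemma mat_mult_0_left [simp]: "mat_mult R N 0 X = 0"
  and mat_mult_0_right [simp]: "mat_mult R N X 0 = 0"
  by (simp_all add: mat_mult_def fun_eq_iff)

lemma mat_mult_minus_left: "mat_mult R N (- X) Y = - mat_mult R N X Y"
  and mat_mult_minus_right: "mat_mult R N X (- Y) = - mat_mult R N X Y"
  using mat_mult_diff_left[of N 0 X Y] mat_mult_diff_right[of N X 0 Y] by simp_all

lemma mat_mult_assoc: "mat_mult R N (mat_mult R N X Y) Z = mat_mult R N X (mat_mult R N Y Z)"
proof (intro ext)
  fix i j
  have "mat_mult R N (mat_mult R N X Y) Z i j =
      (\<Sum>l = 1..N. \<Sum>k = 1..N. X i k \<cdot> (Y k l \<cdot> Z l j))"
    by (simp add: mat_mult_def mult_sum_left mult_assoc)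
  also have "\<dots> = mat_mult R N X (mat_mult R N Y Z) i j"
    by (subst sum.swap) (simp add: mat_mult_def mult_sum_right)
  finally show "mat_mult R N (mat_mult R N X Y) Z i j = mat_mult R N X (mat_mult R N Y Z) i j" .
qed

lemma e_mat_mult:
  assumes "q \<in> {1..N}"
  shows "mat_mult R N (e_mat p q a) X = (\<lambda>i j. if i = p then a \<cdot> X q j else 0)"
proof (intro ext)
  fix i j
  have "mat_mult R N (e_mat p q a) X i j =
      (\<Sum>l = 1..N. if l = q then if i = p then a \<cdot> X q j else 0 else 0)"
    unfolding mat_mult_def by (rule sum.cong) (auto simp: e_mat_def)
  then show "mat_mult R N (e_mat p q a) X i j = (if i = p then a \<cdot> X q j else 0)"
    using assms by simp
qed

lemma mult_e_mat:
  assumes "p \<in> {1..N}"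
  shows "mat_mult R N X (e_mat p q a) = (\<lambda>i j. if j = q then X i p \<cdot> a else 0)"
proof (intro ext)
  fix i j
  have "mat_mult R N X (e_mat p q a) i j =
      (\<Sum>l = 1..N. if l = p then if j = q then X i p \<cdot> a else 0 else 0)"
    unfolding mat_mult_def by (rule sum.cong) (auto simp: e_mat_def)
  then show "mat_mult R N X (e_mat p q a) i j = (if j = q then X i p \<cdot> a else 0)"
    using assms by simp
qed

lemma e_mat_mult_e_mat:
  assumes "q \<in> {1..N}"
  shows "mat_mult R N (e_mat p q a) (e_mat r s b) = (if q = r then e_mat p s (a \<cdot> b) else 0)"
  unfolding e_mat_mult[OF assms] by (auto simp: e_mat_def fun_eq_iff)

lemma gl_simps:
  "lzero (gl N R) = 0" "ladd (gl N R) X Y = X + Y" "lscale (gl N R) c X = c \<odot>\<^sub>m X"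
  "lbracket (gl N R) X Y = mat_mult R N X Y - mat_mult R N Y X"
  by (simp_all add: gl_def fun_eq_iff)

lemma mem_gl_iff: "X \<in> lcarrier (gl N R) \<longleftrightarrow> (\<forall>i j. i \<notin> {1..N} \<or> j \<notin> {1..N} \<longrightarrow> X i j = 0)"
  by (simp add: gl_def)

lemma gl_subspace: "mat.subspace (lcarrier (gl N R))"
  by (auto simp: mat.subspace_def mem_gl_iff)

lemma mat_mult_gl:
  "X \<in> lcarrier (gl N R) \<Longrightarrow> Y \<in> lcarrier (gl N R) \<Longrightarrow> mat_mult R N X Y \<in> lcarrier (gl N R)"
  by (auto simp: mem_gl_iff mat_mult_def intro!: sum.neutral)

lemma e_mat_gl: "p \<in> {1..N} \<Longrightarrow> q \<in> {1..N} \<Longrightarrow> e_mat p q a \<in> lcarrier (gl N R)"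
  by (auto simp: mem_gl_iff e_mat_def)

lemma lie_subalgebra_gl_iff:
  "lie_subalgebra H (gl N R) \<longleftrightarrow> H \<subseteq> lcarrier (gl N R) \<and> mat.subspace H \<and>
     (\<forall>X\<in>H. \<forall>Y\<in>H. mat_mult R N X Y - mat_mult R N Y X \<in> H)"
  by (auto simp: lie_subalgebra_def gl_simps mat.subspace_def)

lemma lie_algebra_gl: "lie_algebra (gl N R)"
proof
  show "lie_subalgebra (lcarrier (gl N R)) (gl N R)"
    unfolding lie_subalgebra_gl_iff
    by (auto intro: gl_subspace mat.subspace_diff[OF gl_subspace] mat_mult_gl)
qed (simp_all add: gl_simps mat_mult_add_left mat_mult_add_right mat_mult_diff_left
    mat_mult_diff_right mat_mult_scale_left mat_mult_scale_right mat_mult_assoc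
    mat.scale_right_distrib mat.scale_left_distrib mat.scale_right_diff_distrib)

lemma gl_expand:
  assumes "X \<in> lcarrier (gl N R)"
  shows "X = (\<Sum>p = 1..N. \<Sum>q = 1..N. e_mat p q (X p q))"
proof (intro ext)
  fix i j
  have "(\<Sum>p = 1..N. \<Sum>q = 1..N. e_mat p q (X p q) i j) =
      (\<Sum>p = 1..N. if p = i then (\<Sum>q = 1..N. if q = j then X i j else 0) else 0)"
    by (intro sum.cong) (auto simp: e_mat_def intro!: sum.cong)
  then show "X i j = (\<Sum>p = 1..N. \<Sum>q = 1..N. e_mat p q (X p q)) i j"
    using assms by (auto simp: sum_fun_apply mem_gl_iff)
qed

end

context averaging_algebra
begin

lemma avg_trace_mat_mult:
  "avg (mat_trace N (mat_mult R N X Y)) = avg (mat_trace N (mat_mult R N Y X))"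
proof -
  have "avg (mat_trace N (mat_mult R N X Y)) = (\<Sum>i = 1..N. \<Sum>l = 1..N. avg (X i l \<cdot> Y l i))"
    by (simp add: mat_trace_def mat_mult_def avg.sum)
  also have "\<dots> = (\<Sum>l = 1..N. \<Sum>i = 1..N. avg (Y l i \<cdot> X i l))"
    by (subst sum.swap) (simp add: avg_mult_commute)
  also have "\<dots> = avg (mat_trace N (mat_mult R N Y X))"
    by (simp add: mat_trace_def mat_mult_def avg.sum)
  finally show ?thesis .
qed

lemma lie_subalgebra_avg_trace_0:
  "lie_subalgebra {X \<in> lcarrier (gl N R). avg (mat_trace N X) = 0} (gl N R)"
proof -
  have trace: "mat_trace N (X + Y) = mat_trace N X + mat_trace N Y"
    "mat_trace N (c \<odot>\<^sub>m X) = c \<odot> mat_trace N X" for X Y c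
    by (simp_all add: mat_trace_def sum.distrib vs.scale_sum_right)
  show ?thesis
    using gl_subspace[of N] avg_trace_mat_mult mat_mult_gl mat.subspace_diff[OF gl_subspace]
    by (auto simp: lie_subalgebra_gl_iff mat.subspace_def trace mat_trace_diff avg.add avg.diff
        avg.scale)
      (auto simp: mat_trace_def)
qed

end


section \<open>Unitary Lie algebras\<close>

text \<open>\<open>adj\<close> is the adjoint with respect to the hermitian or skew-hermitian form that defines
  $\mathfrak{g}_{2n,\rho}(R)$, whose generators are of the form \<open>E - adj E\<close> for matrix units \<open>E\<close>.\<close>

locale unitary = inv_algebra R
  for R :: "('k::field_char_0, 'r::ab_group_add) inv_algebra" +
  fixes n :: nat and \<rho> :: 'k
  assumes rho: "\<rho> = 1 \<or> \<rho> = -1"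
begin

abbreviation gl_carrier ("\<g>\<l>") where "\<g>\<l> \<equiv> lcarrier (gl (2 * n) R)"
abbreviation unitary_carrier ("\<g>") where "\<g> \<equiv> lcarrier (g_lie n \<rho> R)"
abbreviation mat_prod (infixl "\<star>" 70) where "X \<star> Y \<equiv> mat_mult R (2 * n) X Y"
abbreviation tr where "tr \<equiv> mat_trace (2 * n)"

definition idx :: "nat set" where "idx = {1..2 * n}"

definition opp :: "nat \<Rightarrow> nat" where
  "opp p = (if p \<in> {1..n} then p + n else if p \<in> {n+1..2*n} then p - n else p)"

definition sign :: "nat \<Rightarrow> 'k" where
  "sign p = (if p \<le> n then 1 else \<rho>)"

definition adj :: "(nat \<Rightarrow> nat \<Rightarrow> 'r) \<Rightarrow> nat \<Rightarrow> nat \<Rightarrow> 'r" where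
  "adj X = (\<lambda>i j. (sign i * sign j) \<odot> (X (opp j) (opp i))\<^sup>\<dagger>)"

definition skew_part :: "(nat \<Rightarrow> nat \<Rightarrow> 'r) \<Rightarrow> nat \<Rightarrow> nat \<Rightarrow> 'r" where
  "skew_part X = X - adj X"

definition skew_mat :: "nat \<Rightarrow> nat \<Rightarrow> 'r \<Rightarrow> nat \<Rightarrow> nat \<Rightarrow> 'r" where
  "skew_mat p q a = skew_part (e_mat p q a)"

lemmas mem_gl_idx_iff = mem_gl_iff[of _ "2 * n", folded idx_def]
  and gl_expand_idx = gl_expand[of _ "2 * n", folded idx_def]
  and e_mat_gl_idx = e_mat_gl[of _ "2 * n", folded idx_def]
  and mat_prod_idx = mat_mult_def[of R "2 * n", folded idx_def]
  and e_mat_prod = e_mat_mult[of _ "2 * n", folded idx_def]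
  and prod_e_mat = mult_e_mat[of _ "2 * n", folded idx_def]
  and e_mat_prod_e_mat = e_mat_mult_e_mat[of _ "2 * n", folded idx_def]
  and trace_idx = mat_trace_def[of "2 * n", folded idx_def]
  and trace_e_mat = mat_trace_e_mat[of _ "2 * n", folded idx_def]

lemma finite_idx [simp]: "finite idx"
  by (simp add: idx_def)

lemma rho_square [simp]: "\<rho> * \<rho> = 1" "\<rho> * (\<rho> * c) = c"
  using rho by auto

lemma sign_square [simp]: "sign p * sign p = 1" "sign p * (sign p * c) = c"
  by (auto simp: sign_def)

lemma sign_opp: "p \<in> idx \<Longrightarrow> sign (opp p) = \<rho> * sign p"
  by (auto simp: sign_def opp_def idx_def)

lemma opp_opp [simp]: "opp (opp p) = p"
  by (auto simp: opp_def)

lemma opp_mem_idx [simp]: "opp p \<in> idx \<longleftrightarrow> p \<in> idx"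
  by (auto simp: opp_def idx_def)

lemma opp_neq: "p \<in> idx \<Longrightarrow> opp p \<noteq> p"
  by (auto simp: opp_def idx_def)

lemma opp_eq_iff: "opp p = opp q \<longleftrightarrow> p = q"
  by (metis opp_opp)

lemma opp_eq_swap: "opp p = q \<longleftrightarrow> p = opp q"
  by (metis opp_opp)

lemma bij_opp: "bij_betw opp idx idx"
  by (rule bij_betw_byWitness[where f' = opp]) (simp_all add: image_subset_iff)

lemma adj_add: "adj (X + Y) = adj X + adj Y"
  and adj_diff: "adj (X - Y) = adj X - adj Y"
  and adj_scale: "adj (c \<odot>\<^sub>m X) = c \<odot>\<^sub>m adj X"
  by (simp_all add: adj_def fun_eq_iff star_add star_diff star_scale vs.scale_right_distrib
    vs.scale_right_diff_distrib mult.commute)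

lemma adj_gl: "X \<in> \<g>\<l> \<Longrightarrow> adj X \<in> \<g>\<l>"
  unfolding mem_gl_idx_iff adj_def by (metis opp_mem_idx star_zero vs.scale_zero_right)

lemma adj_adj:
  assumes "X \<in> \<g>\<l>"
  shows "adj (adj X) = X"
proof (intro ext)
  fix i j
  show "adj (adj X) i j = X i j"
  proof (cases "i \<in> idx \<and> j \<in> idx")
    case True
    then show ?thesis
      by (simp add: adj_def star_scale star_star sign_opp mult_ac)
  next
    case False
    then show ?thesis using assms adj_gl[OF adj_gl[OF assms]] by (metis mem_gl_idx_iff)
  qed
qed

lemma adj_mult: "adj (X \<star> Y) = adj Y \<star> adj X"
proof (intro ext)
  fix i j
  have "adj (X \<star> Y) i j = (\<Sum>l\<in>idx. (sign i * sign j) \<odot> ((Y l (opp i))\<^sup>\<dagger> \<cdot> (X (opp j) l)\<^sup>\<dagger>))"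
    by (simp add: adj_def mat_prod_idx star_sum star_mult vs.scale_sum_right)
  also have "\<dots> = (\<Sum>l\<in>idx. (sign i * sign j) \<odot> ((Y (opp l) (opp i))\<^sup>\<dagger> \<cdot> (X (opp j) (opp l))\<^sup>\<dagger>))"
    by (rule sum.reindex_bij_betw[OF bij_opp, symmetric])
  also have "\<dots> = (adj Y \<star> adj X) i j"
    unfolding adj_def mat_prod_idx by (simp add: mult_scale_left mult_scale_right mult_ac)
  finally show "adj (X \<star> Y) i j = (adj Y \<star> adj X) i j" .
qed

lemma adj_e_mat:
  assumes "p \<in> idx" "q \<in> idx"
  shows "adj (e_mat p q a) = e_mat (opp q) (opp p) ((sign p * sign q) \<odot> a\<^sup>\<dagger>)"
  using assms
  by (auto simp: adj_def e_mat_def fun_eq_iff opp_eq_swap sign_opp mult_ac)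

lemma trace_adj: "tr (adj X) = (tr X)\<^sup>\<dagger>"
proof -
  have "tr (adj X) = (\<Sum>p\<in>idx. (X (opp p) (opp p))\<^sup>\<dagger>)" by (simp add: trace_idx adj_def)
  also have "\<dots> = (\<Sum>p\<in>idx. (X p p)\<^sup>\<dagger>)" by (rule sum.reindex_bij_betw[OF bij_opp])
  finally show ?thesis by (simp add: trace_idx star_sum)
qed

lemma skew_part_add: "skew_part (X + Y) = skew_part X + skew_part Y"
  and skew_part_scale: "skew_part (c \<odot>\<^sub>m X) = c \<odot>\<^sub>m skew_part X"
  by (simp_all add: skew_part_def adj_add adj_diff adj_scale mat.scale_right_diff_distrib)

lemma linear_skew_part: "Vector_Spaces.linear mat_scale mat_scale skew_part"
  by (simp add: Vector_Spaces.linear_iff mat.vector_space_axioms skew_part_add skew_part_scale)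

sublocale skew_part: Vector_Spaces.linear mat_scale mat_scale skew_part
  by (rule linear_skew_part)

lemma skew_part_gl: "X \<in> \<g>\<l> \<Longrightarrow> skew_part X \<in> \<g>\<l>"
  unfolding skew_part_def by (intro mat.subspace_diff[OF gl_subspace] adj_gl)

lemma adj_skew_part: "X \<in> \<g>\<l> \<Longrightarrow> adj (skew_part X) = - skew_part X"
  by (simp add: skew_part_def adj_diff adj_adj)

lemma skew_part_adj: "X \<in> \<g>\<l> \<Longrightarrow> skew_part (adj X) = - skew_part X"
  by (simp add: skew_part_def adj_adj)

lemma bracket_skew_part:
  assumes "X \<in> \<g>\<l>" "Y \<in> \<g>\<l>"
  shows "skew_part X \<star> skew_part Y - skew_part Y \<star> skew_part X =
    skew_part (X \<star> Y) - skew_part (Y \<star> X) - skew_part (X \<star> adj Y) + skew_part (adj Y \<star> X)"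
  using assms
  by (simp add: skew_part_def adj_mult adj_adj mat_mult_diff_left mat_mult_diff_right)

lemma skew_mat_0 [simp]: "skew_mat p q 0 = 0"
  and skew_mat_add: "skew_mat p q (a + b) = skew_mat p q a + skew_mat p q b"
  and skew_mat_diff: "skew_mat p q (a - b) = skew_mat p q a - skew_mat p q b"
  and skew_mat_scale: "skew_mat p q (c \<odot> a) = c \<odot>\<^sub>m skew_mat p q a"
  by (simp_all add: skew_mat_def e_mat_add e_mat_diff e_mat_scale skew_part.add skew_part.diff
    skew_part.scale skew_part.zero)

lemma skew_mat_sum: "skew_mat p q (sum f A) = (\<Sum>x\<in>A. skew_mat p q (f x))"
  by (induction A rule: infinite_finite_induct) (auto simp: skew_mat_add)

lemma skew_mat_eq:
  assumes "p \<in> idx" "q \<in> idx"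
  shows "skew_mat p q a = e_mat p q a - e_mat (opp q) (opp p) ((sign p * sign q) \<odot> a\<^sup>\<dagger>)"
  by (simp add: skew_mat_def skew_part_def adj_e_mat assms)

lemma skew_mat_gl: "p \<in> idx \<Longrightarrow> q \<in> idx \<Longrightarrow> skew_mat p q a \<in> \<g>\<l>"
  unfolding skew_mat_def by (intro skew_part_gl e_mat_gl_idx)

lemma skew_mat_opp:
  assumes "p \<in> idx" "q \<in> idx"
  shows "skew_mat (opp q) (opp p) (a\<^sup>\<dagger>) = - (sign p * sign q) \<odot>\<^sub>m skew_mat p q a"
proof -
  have "e_mat (opp q) (opp p) (a\<^sup>\<dagger>) = (sign p * sign q) \<odot>\<^sub>m adj (e_mat p q a)"
    unfolding adj_e_mat[OF assms] e_mat_scale by (simp add: mult_ac)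
  then show ?thesis
    using skew_part_adj[OF e_mat_gl_idx[OF assms]] by (simp add: skew_mat_def skew_part.scale)
qed

lemma trace_skew_mat:
  assumes "p \<in> idx" "q \<in> idx" "p \<noteq> q"
  shows "tr (skew_mat p q a) = 0"
  using assms
  by (simp add: skew_mat_def skew_part_def mat_trace_diff trace_adj trace_e_mat)

abbreviation bracket where "bracket X Y \<equiv> X \<star> Y - Y \<star> X"

lemma g_lie_simps:
  "lzero (g_lie n \<rho> R) = 0" "ladd (g_lie n \<rho> R) X Y = X + Y"
  "lscale (g_lie n \<rho> R) c X = c \<odot>\<^sub>m X" "lbracket (g_lie n \<rho> R) X Y = bracket X Y"
  by (simp_all add: g_lie_def lie_generate_def gl_simps)

definition transverse :: "nat \<Rightarrow> nat \<Rightarrow> bool" where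
  "transverse p q \<longleftrightarrow> p \<in> idx \<and> q \<in> idx \<and> q \<noteq> p \<and> q \<noteq> opp p"

lemma transverseD:
  assumes "transverse p q"
  shows "p \<in> idx" "q \<in> idx" "p \<noteq> q" "q \<noteq> p" "p \<noteq> opp q" "q \<noteq> opp p" "opp p \<noteq> q" "opp q \<noteq> p"
  using assms by (auto simp: transverse_def opp_eq_swap)

lemma transverse_sym: "transverse p q \<Longrightarrow> transverse q p"
  by (auto simp: transverse_def opp_eq_swap)

lemma transverse_opp [simp]:
  "transverse p (opp q) \<longleftrightarrow> transverse p q" "transverse (opp p) q \<longleftrightarrow> transverse p q"
  by (auto simp: transverse_def opp_eq_swap opp_eq_iff)

lemma bracket_skew_mat:
  assumes pq: "transverse p q" and qr: "transverse q r"
  shows "bracket (skew_mat p q a) (skew_mat q r b) =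
    skew_mat p r (a \<cdot> b) - (if r = p then skew_mat q q (b \<cdot> a) else 0)"
proof -
  note idx = transverseD(1,2)[OF pq] transverseD(2)[OF qr]
  have "e_mat p q a \<star> adj (e_mat q r b) = 0" "adj (e_mat q r b) \<star> e_mat p q a = 0"
    using transverseD[OF pq] transverseD[OF qr] idx by (simp_all add: adj_e_mat e_mat_prod_e_mat)
  then show ?thesis
    unfolding skew_mat_def bracket_skew_part[OF e_mat_gl_idx[OF idx(1,2)] e_mat_gl_idx[OF idx(2,3)]]
    using idx by (simp add: e_mat_prod_e_mat skew_part.zero)
qed

lemma bracket_skew_mat_neq:
  assumes "transverse p q" "transverse q r" "r \<noteq> p"
  shows "bracket (skew_mat p q a) (skew_mat q r b) = skew_mat p r (a \<cdot> b)"
  using assms by (simp add: bracket_skew_mat)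

lemma bracket_skew_mat_opposite:
  assumes "transverse p q"
  shows "bracket (skew_mat p q a) (skew_mat q p b) = skew_mat p p (a \<cdot> b) - skew_mat q q (b \<cdot> a)"
  using assms by (simp add: bracket_skew_mat transverse_sym)

abbreviation generators where "generators \<equiv>
  {f_mat R n i j a | i j a. i \<in> {1..n} \<and> j \<in> {1..n} \<and> i \<noteq> j} \<union>
  {g_mat R n \<rho> i j a | i j a. 1 \<le> i \<and> i \<le> j \<and> j \<le> n} \<union>
  {h_mat R n \<rho> i j a | i j a. 1 \<le> i \<and> i \<le> j \<and> j \<le> n}"

lemma f_mat_eq_skew_mat: "i \<in> {1..n} \<Longrightarrow> j \<in> {1..n} \<Longrightarrow> f_mat R n i j a = skew_mat i j a"
  and g_mat_eq_skew_mat: "i \<in> {1..n} \<Longrightarrow> j \<in> {1..n} \<Longrightarrow> g_mat R n \<rho> i j a = skew_mat i (n + j) a"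
  and h_mat_eq_skew_mat: "i \<in> {1..n} \<Longrightarrow> j \<in> {1..n} \<Longrightarrow> h_mat R n \<rho> i j a = skew_mat (n + i) j a"
  by (simp_all add: f_mat_def g_mat_def h_mat_def skew_mat_eq idx_def opp_def sign_def add.commute)

lemma generators_skew_mat:
  assumes "X \<in> generators"
  obtains p q a where "p \<in> idx" "q \<in> idx" "p \<noteq> q" "X = skew_mat p q a"
proof -
  from assms consider
    i j a where "X = f_mat R n i j a" "i \<in> {1..n}" "j \<in> {1..n}" "i \<noteq> j"
  | i j a where "X = g_mat R n \<rho> i j a" "1 \<le> i" "i \<le> j" "j \<le> n"
  | i j a where "X = h_mat R n \<rho> i j a" "1 \<le> i" "i \<le> j" "j \<le> n"
    by blast
  then show thesis
  proof cases
    case (1 i j a)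
    then show thesis by (intro that[of i j a]) (auto simp: f_mat_eq_skew_mat idx_def)
  next
    case (2 i j a)
    then show thesis by (intro that[of i "n + j" a]) (auto simp: g_mat_eq_skew_mat idx_def)
  next
    case (3 i j a)
    then show thesis by (intro that[of "n + i" j a]) (auto simp: h_mat_eq_skew_mat idx_def)
  qed
qed

lemma lie_subalgebra_unitary: "lie_subalgebra \<g> (gl (2 * n) R)"
  unfolding g_lie_def
proof (rule lie_subalgebra_generate[OF lie_algebra_gl], rule subsetI)
  fix X assume "X \<in> generators"
  then show "X \<in> \<g>\<l>" by (rule generators_skew_mat) (simp add: skew_mat_gl)
qed

lemma unitary_subset_gl: "\<g> \<subseteq> \<g>\<l>"
  and unitary_subspace: "mat.subspace \<g>"
  and bracket_mem_unitary: "X \<in> \<g> \<Longrightarrow> Y \<in> \<g> \<Longrightarrow> bracket X Y \<in> \<g>"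
  using lie_subalgebra_unitary by (auto simp: lie_subalgebra_gl_iff)

lemma lie_algebra_unitary: "lie_algebra (g_lie n \<rho> R)"
  using lie_algebra_subalgebra[OF lie_algebra_gl lie_subalgebra_unitary]
  by (simp add: g_lie_def lie_generate_def)

lemma unitary_minimal:
  assumes "lie_subalgebra H (gl (2 * n) R)"
    and "\<And>p q a. p \<in> idx \<Longrightarrow> q \<in> idx \<Longrightarrow> p \<noteq> q \<Longrightarrow> skew_mat p q a \<in> H"
  shows "\<g> \<subseteq> H"
  unfolding g_lie_def
proof (rule lie_generate_minimal[OF assms(1)], rule subsetI)
  fix X assume "X \<in> generators"
  then show "X \<in> H" by (rule generators_skew_mat) (simp add: assms(2))
qed

lemma generator_mem_unitary: "X \<in> generators \<Longrightarrow> X \<in> \<g>"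
  unfolding g_lie_def by (rule subsetD[OF lie_generate_superset])

lemma skew_mat_opp_mem_unitary:
  assumes "p \<in> idx" "q \<in> idx" "skew_mat (opp q) (opp p) (a\<^sup>\<dagger>) \<in> \<g>"
  shows "skew_mat p q a \<in> \<g>"
  using mat.subspace_scale[OF unitary_subspace assms(3), of "- (sign p * sign q)"]
  unfolding skew_mat_opp[OF assms(1,2)] by (simp add: mult_ac)

lemma skew_mat_diagonal_block_mem_unitary:
  assumes "i \<in> {1..n}" "j \<in> {1..n}" "i \<noteq> j"
  shows "skew_mat i j a \<in> \<g>"
  unfolding f_mat_eq_skew_mat[OF assms(1,2), symmetric]
  using assms by (intro generator_mem_unitary) blast

lemma skew_mat_off_diagonal_block_mem_unitary:
  assumes "i \<in> {1..n}" "j \<in> {1..n}"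
  shows "skew_mat i (n + j) a \<in> \<g>" and "skew_mat (n + i) j a \<in> \<g>"
proof -
  have ordered: "skew_mat i (n + j) a \<in> \<g>" "skew_mat (n + i) j a \<in> \<g>"
    if "1 \<le> i" "i \<le> j" "j \<le> n" for i j a
  proof -
    have "g_mat R n \<rho> i j a \<in> \<g>" "h_mat R n \<rho> i j a \<in> \<g>"
      using that by (intro generator_mem_unitary; blast)+
    then show "skew_mat i (n + j) a \<in> \<g>" "skew_mat (n + i) j a \<in> \<g>"
      using that by (simp_all add: g_mat_eq_skew_mat h_mat_eq_skew_mat)
  qed
  have "skew_mat i (n + j) a \<in> \<g> \<and> skew_mat (n + i) j a \<in> \<g>"
  proof (cases "i \<le> j")
    case True
    then show ?thesis using ordered assms by simp
  next
    case False
    then have "skew_mat j (n + i) (a\<^sup>\<dagger>) \<in> \<g>" "skew_mat (n + j) i (a\<^sup>\<dagger>) \<in> \<g>"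
      using ordered[of j i] assms by simp_all
    then show ?thesis
      using assms skew_mat_opp_mem_unitary[of i "n + j" a] skew_mat_opp_mem_unitary[of "n + i" j a]
      by (simp add: idx_def opp_def add.commute)
  qed
  then show "skew_mat i (n + j) a \<in> \<g>" "skew_mat (n + i) j a \<in> \<g>" by simp_all
qed

lemma skew_mat_mem_unitary:
  assumes "p \<in> idx" "q \<in> idx" "p \<noteq> q"
  shows "skew_mat p q a \<in> \<g>"
proof -
  consider "p \<le> n" "q \<le> n" | "p \<le> n" "n < q" | "n < p" "q \<le> n" | "n < p" "n < q" by linarith
  then show ?thesis
  proof cases
    case 1
    then show ?thesis using assms skew_mat_diagonal_block_mem_unitary by (simp add: idx_def)
  next
    case 2
    then have "p \<in> {1..n}" "q - n \<in> {1..n}" "n + (q - n) = q"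
      using assms by (auto simp: idx_def)
    then show ?thesis using skew_mat_off_diagonal_block_mem_unitary(1) by metis
  next
    case 3
    then have "p - n \<in> {1..n}" "q \<in> {1..n}" "n + (p - n) = p"
      using assms by (auto simp: idx_def)
    then show ?thesis using skew_mat_off_diagonal_block_mem_unitary(2) by metis
  next
    case 4
    then have "opp q \<in> {1..n}" "opp p \<in> {1..n}" "opp q \<noteq> opp p"
      using assms by (auto simp: idx_def opp_def)
    then have "skew_mat (opp q) (opp p) (a\<^sup>\<dagger>) \<in> \<g>" by (rule skew_mat_diagonal_block_mem_unitary)
    then show ?thesis by (rule skew_mat_opp_mem_unitary[OF assms(1,2)])
  qed
qed

lemma lie_subalgebra_skew: "lie_subalgebra {X \<in> \<g>\<l>. adj X = - X} (gl (2 * n) R)"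
proof -
  have "adj (bracket X Y) = - bracket X Y" if "adj X = - X" "adj Y = - Y" for X Y
    by (simp add: adj_diff adj_mult that mat_mult_minus_left mat_mult_minus_right)
  moreover have "mat.subspace {X. adj X = - X}"
    by (simp add: mat.subspace_def adj_add adj_scale) (simp add: adj_def fun_eq_iff)
  ultimately show ?thesis
    using mat.subspace_inter[OF gl_subspace[of "2 * n"], of "{X. adj X = - X}"]
    by (auto simp: lie_subalgebra_gl_iff Int_def
        intro: mat.subspace_diff[OF gl_subspace] mat_mult_gl)
qed

lemma adj_unitary: "X \<in> \<g> \<Longrightarrow> adj X = - X"
  using unitary_minimal[OF lie_subalgebra_skew] adj_skew_part
  by (auto simp: skew_mat_gl skew_mat_def e_mat_gl_idx skew_part_gl)

lemma skew_expand:
  assumes "X \<in> \<g>\<l>" "adj X = - X"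
  shows "2 \<odot>\<^sub>m X = (\<Sum>p\<in>idx. \<Sum>q\<in>idx. skew_mat p q (X p q))"
proof -
  have "2 \<odot>\<^sub>m X = skew_part X"
    using mat.scale_left_distrib[of 1 1 X] assms(2) by (simp add: skew_part_def)
  also have "\<dots> = skew_part (\<Sum>p\<in>idx. \<Sum>q\<in>idx. e_mat p q (X p q))"
    using gl_expand_idx[OF assms(1)] by simp
  finally show ?thesis by (simp add: skew_mat_def skew_part.sum)
qed

end


section \<open>Ideals of unitary Lie algebras\<close>

locale averaging_unitary = averaging_algebra R U + unitary R n \<rho>
  for R :: "('k::field_char_0, 'r::ab_group_add) inv_algebra" and U n \<rho> +
  assumes three_le: "3 \<le> n"
begin

lemma avg_trace_unitary:
  assumes "X \<in> \<g>"
  shows "avg (tr X) = 0"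
proof -
  have "\<g> \<subseteq> {X \<in> \<g>\<l>. avg (tr X) = 0}"
    by (rule unitary_minimal[OF lie_subalgebra_avg_trace_0])
      (simp add: skew_mat_gl trace_skew_mat avg.zero)
  with assms show ?thesis by blast
qed

lemma ex_transverse:
  assumes "p \<in> idx" "q \<in> idx"
  obtains r where "transverse p r" "transverse q r"
proof -
  have "card {p, opp p, q, opp q} \<le> 4"
    using card_length[of "[p, opp p, q, opp q]"] by simp
  also have "4 < card idx" using three_le by (simp add: idx_def)
  finally obtain r where "r \<in> idx" "r \<notin> {p, opp p, q, opp q}"
    by (meson card_mono finite.emptyI finite.insertI not_le subsetI)
  then show thesis using assms that[of r] by (simp add: transverse_def)
qed

lemma transverse_1_2: "transverse 1 2"
  using three_le by (simp add: transverse_def idx_def opp_def)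

end

locale unitary_ideal = averaging_unitary R U n \<rho>
  for R :: "('k::field_char_0, 'r::ab_group_add) inv_algebra" and U n \<rho> +
  fixes I :: "(nat \<Rightarrow> nat \<Rightarrow> 'r) set"
  assumes lie_ideal: "lie_ideal I (g_lie n \<rho> R)"
begin

lemma ideal_subset: "I \<subseteq> \<g>"
  and ideal_subspace: "mat.subspace I"
  and bracket_mem: "X \<in> I \<Longrightarrow> Y \<in> \<g> \<Longrightarrow> bracket X Y \<in> I"
  using lie_ideal by (auto simp: lie_ideal_def lie_subalgebra_def g_lie_simps mat.subspace_def)

lemma bracket_mem_right: "X \<in> \<g> \<Longrightarrow> Y \<in> I \<Longrightarrow> bracket X Y \<in> I"
  using lie_ideal_bracket_right[OF lie_algebra_unitary lie_ideal] by (simp add: g_lie_simps)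

lemmas ideal_zero = mat.subspace_0[OF ideal_subspace]
  and ideal_add = mat.subspace_add[OF ideal_subspace]
  and ideal_scale = mat.subspace_scale[OF ideal_subspace]
  and ideal_sum = mat.subspace_sum[OF ideal_subspace]

lemma skew_mat_opp_mem_iff:
  assumes "p \<in> idx" "q \<in> idx"
  shows "skew_mat (opp q) (opp p) (a\<^sup>\<dagger>) \<in> I \<longleftrightarrow> skew_mat p q a \<in> I"
proof -
  have "c \<odot>\<^sub>m X \<in> I \<longleftrightarrow> X \<in> I" if "c * c = 1" for c X
    using ideal_scale[of X c] ideal_scale[of "c \<odot>\<^sub>m X" c] that by auto
  then show ?thesis
    unfolding skew_mat_opp[OF assms] by (simp add: mult_ac del: mat.scale_minus_left)
qed

lemma skew_mat_row_mem:
  assumes pq: "transverse p q" and pr: "transverse p r" and mem: "skew_mat p q a \<in> I"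
  shows "skew_mat p r (a \<cdot> b) \<in> I"
proof -
  have adjacent_mem: "skew_mat p r (a \<cdot> b) \<in> I"
    if "transverse p q" "transverse q r" "r \<noteq> p" "skew_mat p q a \<in> I" for q r a b
    using bracket_mem[OF that(4) skew_mat_mem_unitary[of q r b]] transverseD[OF that(2)]
      bracket_skew_mat_neq[OF that(1-3)] by simp
  have "r \<noteq> p" using pr by (rule transverseD)
  obtain s where s: "transverse p s" "transverse q s"
    using ex_transverse transverseD(1,2)[OF pq] by metis
  show ?thesis
  proof (cases "transverse q r")
    case True
    then show ?thesis using adjacent_mem pq \<open>r \<noteq> p\<close> mem by blast
  next
    case False
    then have "r = q \<or> r = opp q" using pq pr by (auto simp: transverse_def)
    then have "transverse s r" using s(2) transverse_sym by auto
    moreover have "skew_mat p s (a \<cdot> b) \<in> I" using adjacent_mem pq s mem transverseD(4) by blast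
    ultimately have "skew_mat p r (a \<cdot> b \<cdot> \<one>) \<in> I" using adjacent_mem s(1) \<open>r \<noteq> p\<close> by blast
    then show ?thesis by (simp add: mult_one)
  qed
qed

lemma skew_mat_col_mem:
  assumes pq: "transverse p q" and rq: "transverse r q" and mem: "skew_mat p q a \<in> I"
  shows "skew_mat r q (b \<cdot> a) \<in> I"
proof -
  note idx = transverseD(1,2)[OF pq] transverseD(1)[OF rq]
  have "skew_mat (opp q) (opp p) (a\<^sup>\<dagger>) \<in> I" using mem idx by (simp add: skew_mat_opp_mem_iff)
  then have "skew_mat (opp q) (opp r) (a\<^sup>\<dagger> \<cdot> b\<^sup>\<dagger>) \<in> I"
    by (rule skew_mat_row_mem[rotated 2]) (simp_all add: pq rq transverse_sym)
  then show ?thesis using idx by (simp add: star_mult[symmetric] skew_mat_opp_mem_iff)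
qed

definition root_ideal :: "'r set" where
  "root_ideal = {a. skew_mat 1 2 a \<in> I}"

lemma skew_mat_mem_move:
  assumes "transverse p q" "transverse p' q'" "skew_mat p q a \<in> I"
  shows "skew_mat p' q' a \<in> I"
proof -
  obtain s where s: "transverse p s" "transverse p' s"
    using ex_transverse transverseD(1) assms(1,2) by metis
  have "skew_mat p s a \<in> I"
    using skew_mat_row_mem[OF assms(1) s(1) assms(3), of \<one>] by (simp add: mult_one)
  then have "skew_mat p' s a \<in> I"
    using skew_mat_col_mem[OF s(1,2), of a \<one>] by (simp add: one_mult)
  then show ?thesis using skew_mat_row_mem[OF s(2) assms(2), of a \<one>] by (simp add: mult_one)
qed

lemma skew_mat_mem_iff: "transverse p q \<Longrightarrow> skew_mat p q a \<in> I \<longleftrightarrow> a \<in> root_ideal"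
  unfolding root_ideal_def using skew_mat_mem_move transverse_1_2 by blast

sublocale star_ideal R root_ideal
proof
  show "vs.subspace root_ideal"
    by (simp add: vs.subspace_def root_ideal_def skew_mat_add skew_mat_scale ideal_zero ideal_add
      ideal_scale)
  fix a b assume a: "a \<in> root_ideal"
  then show "a \<cdot> b \<in> root_ideal" "b \<cdot> a \<in> root_ideal"
    using skew_mat_row_mem skew_mat_col_mem transverse_1_2 by (auto simp: root_ideal_def)
  have "skew_mat (opp 2) (opp 1) (a\<^sup>\<dagger>) \<in> I"
    using a transverseD(1,2)[OF transverse_1_2] by (simp add: root_ideal_def skew_mat_opp_mem_iff)
  then show "a\<^sup>\<dagger> \<in> root_ideal" using skew_mat_mem_iff transverse_1_2 transverse_sym by simp
qed

sublocale averaging_ideal R U root_ideal ..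

lemma off_diagonal_mem:
  assumes "p \<in> idx" "q \<in> idx" "p \<noteq> q" "a \<in> root_ideal"
  shows "skew_mat p q a \<in> I"
proof (cases "transverse p q")
  case True
  then show ?thesis using assms by (simp add: skew_mat_mem_iff)
next
  case False
  then have q: "q = opp p" using assms by (auto simp: transverse_def)
  obtain s where s: "transverse p s" using ex_transverse assms(1) by metis
  then have "transverse s q" by (simp add: q transverse_sym)
  moreover have "bracket (skew_mat p s a) (skew_mat s q \<one>) \<in> I"
    using s assms(4) transverseD[OF \<open>transverse s q\<close>]
    by (intro bracket_mem skew_mat_mem_unitary) (simp_all add: skew_mat_mem_iff)
  ultimately show ?thesis using s assms(3) by (simp add: bracket_skew_mat_neq mult_one)
qed

lemma diagonal_diff_mem:
  assumes "p \<in> idx" "q \<in> idx" "a \<in> root_ideal"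
  shows "skew_mat p p a - skew_mat q q a \<in> I"
proof -
  have transverse_diff: "skew_mat p p a - skew_mat q q a \<in> I" if "transverse p q" for p q
  proof -
    have "bracket (skew_mat p q a) (skew_mat q p \<one>) \<in> I"
      using that assms(3) transverseD[OF that]
      by (intro bracket_mem skew_mat_mem_unitary) (simp_all add: skew_mat_mem_iff)
    then show ?thesis using that by (simp add: bracket_skew_mat_opposite one_mult mult_one)
  qed
  obtain s where "transverse p s" "transverse s q"
    using ex_transverse[OF assms(1,2)] transverse_sym by metis
  from ideal_add[OF this[THEN transverse_diff]] show ?thesis by simp
qed

lemma diagonal_commutator_mem:
  assumes "a \<in> root_ideal"
  shows "skew_mat 1 1 (a \<cdot> b - b \<cdot> a) \<in> I"
proof -
  note idx = transverseD[OF transverse_1_2]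
  have "bracket (skew_mat 1 2 a) (skew_mat 2 1 b) \<in> I"
    using assms idx transverse_1_2
    by (intro bracket_mem skew_mat_mem_unitary) (simp_all add: skew_mat_mem_iff)
  then have "skew_mat 1 1 (a \<cdot> b) - skew_mat 2 2 (b \<cdot> a) \<in> I"
    by (simp only: bracket_skew_mat_opposite[OF transverse_1_2])
  moreover have "skew_mat 2 2 (b \<cdot> a) - skew_mat 1 1 (b \<cdot> a) \<in> I"
    using assms idx mult_left_mem by (intro diagonal_diff_mem)
  ultimately show ?thesis using ideal_add by (fastforce simp: skew_mat_diff)
qed

lemma diagonal_avg_0_mem:
  assumes "a \<in> root_ideal" "avg a = 0"
  shows "skew_mat 1 1 a \<in> I"
proof -
  have "skew_mat 1 1 a =
      inverse (of_nat (card U)) \<odot>\<^sub>m (\<Sum>(u, v)\<in>U. skew_mat 1 1 (a - u \<cdot> a \<cdot> v))"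
    using diff_avg[of a] assms(2)
    by (simp add: skew_mat_scale[symmetric] skew_mat_sum[symmetric] case_prod_unfold)
  also have "\<dots> \<in> I"
    using diagonal_commutator_mem[OF mult_right_mem[OF assms(1)]]
    by (intro ideal_scale ideal_sum) (auto simp: diff_conj)
  finally show ?thesis .
qed

theorem mem_ideal_if_entries_mem:
  assumes X: "X \<in> \<g>\<l>" "adj X = - X" "avg (tr X) = 0" and entries: "\<And>i j. X i j \<in> root_ideal"
  shows "X \<in> I"
proof -
  have "(\<Sum>p\<in>idx. skew_mat p p (X p p)) =
      (\<Sum>p\<in>idx. skew_mat p p (X p p) - skew_mat 1 1 (X p p)) + skew_mat 1 1 (tr X)"
    by (simp add: trace_idx skew_mat_sum sum_subtractf)
  also have "\<dots> \<in> I"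
  proof (rule ideal_add)
    show "(\<Sum>p\<in>idx. skew_mat p p (X p p) - skew_mat 1 1 (X p p)) \<in> I"
      using transverseD(1)[OF transverse_1_2] by (intro ideal_sum diagonal_diff_mem entries)
    have "tr X \<in> root_ideal" unfolding trace_idx by (intro sum_mem entries)
    then show "skew_mat 1 1 (tr X) \<in> I" using X(3) by (rule diagonal_avg_0_mem)
  qed
  finally have diagonal: "(\<Sum>p\<in>idx. skew_mat p p (X p p)) \<in> I" .
  have "(\<Sum>p\<in>idx. \<Sum>q\<in>idx - {p}. skew_mat p q (X p q)) \<in> I"
    by (intro ideal_sum off_diagonal_mem entries) auto
  then have "(\<Sum>p\<in>idx. skew_mat p p (X p p) + (\<Sum>q\<in>idx - {p}. skew_mat p q (X p q))) \<in> I"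
    unfolding sum.distrib using diagonal by (intro ideal_add)
  also have "(\<Sum>p\<in>idx. skew_mat p p (X p p) + (\<Sum>q\<in>idx - {p}. skew_mat p q (X p q))) =
      2 \<odot>\<^sub>m X"
    unfolding skew_expand[OF X(1,2)] by (intro sum.cong refl sum.remove[symmetric]) auto
  finally have "(1 / 2) \<odot>\<^sub>m (2 \<odot>\<^sub>m X) \<in> I" by (rule ideal_scale)
  then show ?thesis by simp
qed

end

context averaging_unitary
begin

theorem mem_unitary_iff: "X \<in> \<g> \<longleftrightarrow> X \<in> \<g>\<l> \<and> adj X = - X \<and> avg (tr X) = 0"
proof -
  have "lie_subalgebra \<g> (g_lie n \<rho> R)"
    using lie_algebra_unitary by (rule lie_algebra.closed)
  then interpret unitary_ideal R U n \<rho> \<g>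
    by unfold_locales (auto simp: lie_ideal_def lie_subalgebra_def)
  have "root_ideal = UNIV"
    using skew_mat_mem_unitary transverseD[OF transverse_1_2] by (auto simp: root_ideal_def)
  then show ?thesis
    using mem_ideal_if_entries_mem unitary_subset_gl adj_unitary avg_trace_unitary by blast
qed

lemma skew_part_mem_unitary:
  assumes "X \<in> \<g>\<l>" "avg (tr X) = 0"
  shows "skew_part X \<in> \<g>"
  using assms
  by (simp add: mem_unitary_iff skew_part_gl adj_skew_part)
    (simp add: skew_part_def mat_trace_diff trace_adj avg.diff avg_star_eq_0)

lemma toral_mem_unitary: "p \<in> idx \<Longrightarrow> skew_mat p p \<one> \<in> \<g>"
  by (simp add: mem_unitary_iff skew_mat_gl)
    (simp add: skew_mat_def skew_part_def adj_adj adj_diff e_mat_gl_idx mat_trace_diff trace_adj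
      trace_e_mat avg.zero)

end

context unitary
begin

definition weight :: "nat \<Rightarrow> nat \<Rightarrow> nat \<Rightarrow> 'k" where
  "weight p i j = (of_bool (i = p) - of_bool (i = opp p)) - (of_bool (j = p) - of_bool (j = opp p))"

lemma bracket_toral:
  assumes "p \<in> idx"
  shows "bracket (skew_mat p p \<one>) X = (\<lambda>i j. weight p i j \<odot> X i j)"
proof -
  have toral: "skew_mat p p \<one> = e_mat p p \<one> - e_mat (opp p) (opp p) \<one>"
    using assms by (simp add: skew_mat_eq)
  have neq: "opp p \<noteq> p" using assms by (rule opp_neq)
  have scale_2: "2 \<odot> x = x + x" for x using vs.scale_left_distrib[of 1 1 x] by simp
  show ?thesis
  proof (intro ext)
    fix i j
    show "bracket (skew_mat p p \<one>) X i j = weight p i j \<odot> X i j"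
      unfolding toral weight_def using assms neq
      by (cases "i = p"; cases "i = opp p"; cases "j = p"; cases "j = opp p")
        (simp_all add: mat_mult_diff_left mat_mult_diff_right e_mat_prod prod_e_mat one_mult
          mult_one scale_2)
  qed
qed

lemma weight_eq_1_iff:
  "p \<in> idx \<Longrightarrow> weight p i j = 1 \<longleftrightarrow>
    i = p \<and> j \<noteq> p \<and> j \<noteq> opp p \<or> j = opp p \<and> i \<noteq> p \<and> i \<noteq> opp p"
  and weight_eq_minus_1_iff:
  "p \<in> idx \<Longrightarrow> weight p i j = -1 \<longleftrightarrow>
    j = p \<and> i \<noteq> p \<and> i \<noteq> opp p \<or> i = opp p \<and> j \<noteq> p \<and> j \<noteq> opp p"
  and weight_eq_2_iff: "p \<in> idx \<Longrightarrow> weight p i j = 2 \<longleftrightarrow> i = p \<and> j = opp p"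
  using opp_neq[of p]
  by (cases "i = p"; cases "i = opp p"; cases "j = p"; cases "j = opp p"; simp add: weight_def)+

lemma weight_transverse:
  assumes "transverse p q"
  shows "weight p i j = 1 \<and> weight q i j = -1 \<longleftrightarrow> i = p \<and> j = q \<or> i = opp q \<and> j = opp p"
  using transverseD[OF assms] by (auto simp: weight_eq_1_iff weight_eq_minus_1_iff opp_eq_iff)

lemma weight_range: "weight p i j \<in> {-2, -1, 0, 1, 2}"
  by (auto simp: weight_def of_bool_def)

end

context unitary_ideal
begin

lemma weight_poly_mem:
  assumes "p \<in> idx" "X \<in> I"
  shows "(\<lambda>i j. poly P (weight p i j) \<odot> X i j) \<in> I"
proof (induction P)
  case 0
  show ?case using ideal_zero by (simp add: zero_fun_def)
next
  case (pCons c P)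
  have "(\<lambda>i j. poly (pCons c P) (weight p i j) \<odot> X i j) =
      c \<odot>\<^sub>m X + bracket (skew_mat p p \<one>) (\<lambda>i j. poly P (weight p i j) \<odot> X i j)"
    unfolding bracket_toral[OF assms(1)] by (simp add: fun_eq_iff vs.scale_left_distrib)
  also have "\<dots> \<in> I"
    using assms pCons by (intro ideal_add ideal_scale bracket_mem_right toral_mem_unitary)
  finally show ?case .
qed

lemma weight_component_mem:
  assumes "p \<in> idx" "X \<in> I"
  shows "(\<lambda>i j. if weight p i j = w then X i j else 0) \<in> I"
proof (cases "w \<in> {-2, -1, 0, 1, 2}")
  case True
  have "poly (lagrange_basis {-2, -1, 0, 1, 2} w) (weight p i j) = of_bool (weight p i j = w)"
    for i j
    using weight_range by (subst poly_lagrange_basis) auto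
  then show ?thesis
    using weight_poly_mem[OF assms, of "lagrange_basis {-2, -1, 0, 1, 2} w"]
    by (simp add: of_bool_def if_distrib[of "\<lambda>c. c \<odot> _"] cong: if_cong)
next
  case False
  then have "weight p i j \<noteq> w" for i j using weight_range by metis
  then show ?thesis using ideal_zero by (simp add: zero_fun_def)
qed

lemma transverse_entry_mem:
  assumes X: "X \<in> I" and pq: "transverse p q"
  shows "X p q \<in> root_ideal"
proof -
  note idx = transverseD(1,2)[OF pq]
  have "(\<lambda>i j. if weight p i j = 1 then if weight q i j = -1 then X i j else 0 else 0) \<in> I"
    using weight_component_mem[OF idx(1) weight_component_mem[OF idx(2) X]] .
  also have "(\<lambda>i j. if weight p i j = 1 then if weight q i j = -1 then X i j else 0 else 0) =
      skew_mat p q (X p q)"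
  proof (intro ext)
    fix i j
    have "adj X (opp q) (opp p) = - X (opp q) (opp p)"
      using X ideal_subset adj_unitary by fastforce
    then have "X (opp q) (opp p) = - (sign p * sign q) \<odot> (X p q)\<^sup>\<dagger>"
      using idx by (simp add: adj_def sign_opp mult_ac eq_neg_iff_add_eq_0 add.commute)
    then show "(if weight p i j = 1 then if weight q i j = -1 then X i j else 0 else 0) =
        skew_mat p q (X p q) i j"
      using weight_transverse[OF pq, of i j] transverseD[OF pq]
      by (auto simp: skew_mat_eq e_mat_def)
  qed
  finally show ?thesis using skew_mat_mem_iff[OF pq] by simp
qed

lemma opposite_entry_mem:
  assumes X: "X \<in> I" and p: "p \<in> idx"
  shows "X p (opp p) \<in> root_ideal"
proof -
  define Y where "Y = (\<lambda>i j. if weight p i j = 2 then X i j else 0)"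
  have Y: "Y \<in> I" unfolding Y_def by (rule weight_component_mem[OF p X])
  have Y_eq: "Y = e_mat p (opp p) (X p (opp p))"
    by (simp add: Y_def e_mat_def weight_eq_2_iff[OF p] fun_eq_iff)
  obtain q where q: "transverse q p" using ex_transverse p transverse_sym by metis
  note transverse = transverseD[OF q]
  have "bracket (skew_mat q p \<one>) Y \<in> I"
    using Y transverse by (intro bracket_mem_right skew_mat_mem_unitary)
  then have "bracket (skew_mat q p \<one>) Y q (opp p) \<in> root_ideal"
    by (rule transverse_entry_mem) (simp add: q)
  also have "bracket (skew_mat q p \<one>) Y q (opp p) = X p (opp p)"
    using transverse opp_neq[OF p]
    by (simp add: Y_eq skew_mat_eq mat_mult_diff_left mat_mult_diff_right e_mat_prod_e_mat
      opp_eq_iff one_mult) (simp add: e_mat_def)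
  finally show ?thesis .
qed

lemma diagonal_intertwine_mem:
  assumes X: "X \<in> I" and pq: "transverse p q"
  shows "a \<cdot> X q q - X p p \<cdot> a \<in> root_ideal"
proof -
  note transverse = transverseD[OF pq]
  have "bracket (skew_mat p q a) X \<in> I"
    using transverse X by (intro bracket_mem_right skew_mat_mem_unitary)
  then have "bracket (skew_mat p q a) X p q \<in> root_ideal" by (rule transverse_entry_mem[OF _ pq])
  also have "bracket (skew_mat p q a) X p q = a \<cdot> X q q - X p p \<cdot> a"
    using transverse
    by (simp add: skew_mat_eq mat_mult_diff_left mat_mult_diff_right e_mat_prod prod_e_mat)
  finally show ?thesis .
qed

lemma diagonal_entries_diff_mem:
  assumes X: "X \<in> I" and "p \<in> idx" "q \<in> idx"
  shows "X q q - X p p \<in> root_ideal"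
proof -
  have transverse_diff: "X q q - X p p \<in> root_ideal" if "transverse p q" for p q
    using diagonal_intertwine_mem[OF X that, of \<one>] by (simp add: one_mult mult_one)
  obtain s where "transverse p s" "transverse s q"
    using ex_transverse assms(2,3) transverse_sym by metis
  from add_mem[OF this[THEN transverse_diff]] show ?thesis by simp
qed

lemma diagonal_entry_mem:
  assumes X: "X \<in> I" and p: "p \<in> idx"
  shows "X p p \<in> root_ideal"
proof -
  define x where "x = X p p"
  have "b \<cdot> x - x \<cdot> b \<in> root_ideal" for b
  proof -
    obtain q where q: "transverse p q" using ex_transverse p by metis
    then have "b \<cdot> (X q q - x) \<in> root_ideal"
      unfolding x_def using X p transverseD(2) by (intro mult_left_mem diagonal_entries_diff_mem)
    with diagonal_intertwine_mem[OF X q, of b]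
    have "(b \<cdot> X q q - x \<cdot> b) - b \<cdot> (X q q - x) \<in> root_ideal"
      unfolding x_def by (rule diff_mem)
    then show ?thesis by (simp add: mult_diff_right)
  qed
  then have x: "x - avg x \<in> root_ideal" by (rule diff_avg_mem)
  have "avg (tr X) = 0" using X ideal_subset avg_trace_unitary by blast
  then have "of_nat (card idx) \<odot> avg x = - avg (\<Sum>q\<in>idx. X q q - x)"
    by (simp add: trace_idx sum_subtractf vs.sum_constant_scale avg.diff avg.scale)
  also have "\<dots> \<in> root_ideal"
    unfolding x_def by (intro minus_mem avg_mem sum_mem diagonal_entries_diff_mem X p)
  finally have "avg x \<in> root_ideal" using p by (subst (asm) scale_mem_iff) auto
  from add_mem[OF x this] show ?thesis by (simp add: x_def)
qed

theorem mem_ideal_iff: "X \<in> I \<longleftrightarrow> X \<in> \<g> \<and> (\<forall>i j. X i j \<in> root_ideal)"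
proof (intro iffI conjI allI)
  assume X: "X \<in> I"
  then show X_unitary: "X \<in> \<g>" using ideal_subset by blast
  fix i j
  consider "transverse i j" | "i \<in> idx" "j = i" | "i \<in> idx" "j = opp i" | "i \<notin> idx \<or> j \<notin> idx"
    by (auto simp: transverse_def)
  then show "X i j \<in> root_ideal"
  proof cases
    case 4
    then have "X i j = 0" using X_unitary unitary_subset_gl mem_gl_idx_iff by blast
    then show ?thesis by (simp add: zero_mem)
  qed (use X transverse_entry_mem opposite_entry_mem diagonal_entry_mem in auto)
next
  assume "X \<in> \<g> \<and> (\<forall>i j. X i j \<in> root_ideal)"
  then show "X \<in> I" using mem_ideal_if_entries_mem[of X] mem_unitary_iff[of X] by simp
qed

end

section \<open>The root ideal of an irreducible representation\<close>

context unitary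
begin

lemma lie_ideal_entries:
  assumes "alg_ideal R N"
  shows "lie_ideal {X \<in> \<g>. \<forall>i j. X i j \<in> N} (g_lie n \<rho> R)"
proof -
  interpret N: alg_ideal R N by fact
  have "bracket X Y i j \<in> N" if "\<forall>i j. X i j \<in> N" for X Y i j
    using that
    by (auto simp: mat_prod_idx intro!: N.diff_mem N.sum_mem
        intro: N.mult_left_mem N.mult_right_mem)
  moreover have "mat.subspace {X. \<forall>i j. X i j \<in> N}"
    by (simp add: mat.subspace_def N.zero_mem N.add_mem N.scale_mem)
  then have "mat.subspace (\<g> \<inter> {X. \<forall>i j. X i j \<in> N})"
    using unitary_subspace by (rule mat.subspace_inter[rotated])
  ultimately show ?thesis
    using bracket_mem_unitary
    by (auto simp: lie_ideal_def lie_subalgebra_def g_lie_simps mat.subspace_def)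
qed

end

locale unitary_rep = averaging_unitary R U n \<rho>
  for R :: "('k::field_char_0, 'r::ab_group_add) inv_algebra" and U n \<rho> +
  fixes s :: "'k \<Rightarrow> 'v::ab_group_add \<Rightarrow> 'v" and B :: "'v set"
    and \<phi> :: "(nat \<Rightarrow> nat \<Rightarrow> 'r) \<Rightarrow> 'v \<Rightarrow> 'v"
  assumes finite_dim: "finite_dimensional_vector_space s B"
    and irreducible: "lie_irreducible (g_lie n \<rho> R) s \<phi>"
begin

lemma representation: "lie_representation (g_lie n \<rho> R) s \<phi>"
  using irreducible by (simp add: lie_irreducible_def)

sublocale unitary_ideal R U n \<rho> "lie_annihilator (g_lie n \<rho> R) \<phi>"
  by unfold_locales (rule lie_ideal_annihilator[OF lie_algebra_unitary representation])

text \<open>The matrices with entries in \<open>N\<close> form an ideal that is abelian modulo the annihilator.\<close>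

lemma root_ideal_semiprime:
  assumes "star_ideal R N" and square: "\<And>a b. a \<in> N \<Longrightarrow> b \<in> N \<Longrightarrow> a \<cdot> b \<in> root_ideal"
  shows "N \<subseteq> root_ideal"
proof
  fix a assume a: "a \<in> N"
  interpret N: star_ideal R N by fact
  define A where "A = {X \<in> \<g>. \<forall>i j. X i j \<in> N}"
  have A: "lie_ideal A (g_lie n \<rho> R)"
    unfolding A_def by (rule lie_ideal_entries) (rule N.alg_ideal_axioms)
  have "\<phi> (lbracket (g_lie n \<rho> R) X Y) v = 0" if "X \<in> A" "Y \<in> A" for X Y v
  proof -
    have "bracket X Y i j \<in> root_ideal" for i j
      using that square by (auto simp: A_def mat_prod_idx intro!: diff_mem sum_mem)
    then have "bracket X Y \<in> lie_annihilator (g_lie n \<rho> R) \<phi>"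
      using that bracket_mem_unitary by (simp add: A_def mem_ideal_iff)
    then show ?thesis by (simp add: lie_annihilator_def g_lie_simps)
  qed
  then have bracket_kills: "bracket X Y \<in> lie_annihilator (g_lie n \<rho> R) \<phi>"
    if "X \<in> A" "Y \<in> \<g>" for X Y
    using lie_irreducible_abelian_ideal[OF finite_dim irreducible A _ that] that
      bracket_mem_unitary[of X Y]
    by (simp add: lie_annihilator_def g_lie_simps A_def)
  obtain r where r: "transverse 1 r" "transverse r 2"
    using ex_transverse transverseD(1,2)[OF transverse_1_2] transverse_sym by metis
  note transverse = transverseD[OF r(1)] transverseD[OF r(2)]
  have "skew_mat 1 r a i j \<in> N" for i j
    using transverse(1,2) a
    by (simp add: skew_mat_eq e_mat_def N.zero_mem N.minus_mem N.diff_mem N.scale_mem N.star_mem)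
  then have "skew_mat 1 r a \<in> A" using transverse by (simp add: A_def skew_mat_mem_unitary)
  then have "bracket (skew_mat 1 r a) (skew_mat r 2 \<one>) \<in> lie_annihilator (g_lie n \<rho> R) \<phi>"
    using transverse by (intro bracket_kills skew_mat_mem_unitary)
  then show "a \<in> root_ideal"
    using bracket_skew_mat_neq[OF r] by (simp add: root_ideal_def mult_one)
qed

lemma star_ideal_annihilator_of:
  assumes "star_ideal R K"
  shows "star_ideal R {x. \<forall>y\<in>K. x \<cdot> y \<in> root_ideal \<and> y \<cdot> x \<in> root_ideal}" (is "star_ideal R ?N")
proof -
  interpret K: star_ideal R K by fact
  show ?thesis
  proof
    show "vs.subspace ?N"
      by (simp add: vs.subspace_def mult_add_left mult_add_right mult_scale_left mult_scale_right
        zero_mem add_mem scale_mem)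
    fix x b assume x: "x \<in> ?N"
    show "b \<cdot> x \<in> ?N" "x \<cdot> b \<in> ?N"
      using x mult_left_mem mult_right_mem K.mult_left_mem K.mult_right_mem
      by (auto simp: mult_assoc)
        (simp_all add: mult_assoc[symmetric] mult_right_mem K.mult_right_mem)
    show "x\<^sup>\<dagger> \<in> ?N"
      using x K.star_mem star_mem by (auto simp: star_mult[symmetric]) (metis star_mult star_star)+
  qed
qed

text \<open>\<open>w\<close> lies in the ideal \<open>K\<close> of those elements that \<open>w\<close> and its adjoint multiply into the
  root ideal, and in the annihilator \<open>N\<close> of \<open>K\<close>.\<close>

lemma central_mem_if_norm_mem:
  assumes w: "\<And>b. w \<cdot> b = b \<cdot> w" and square: "w \<cdot> w \<in> root_ideal" and norm: "w \<cdot> w\<^sup>\<dagger> \<in> root_ideal"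
  shows "w \<in> root_ideal"
proof -
  note w' = central_star[OF w]
  define K where "K = {x. w \<cdot> x \<in> root_ideal \<and> w\<^sup>\<dagger> \<cdot> x \<in> root_ideal}"
  define N where "N = {x. \<forall>y\<in>K. x \<cdot> y \<in> root_ideal \<and> y \<cdot> x \<in> root_ideal}"
  interpret K: star_ideal R K
  proof
    show "vs.subspace K"
      by (simp add: K_def vs.subspace_def mult_add_right mult_scale_right zero_mem add_mem
        scale_mem)
    fix x b assume x: "x \<in> K"
    have "w \<cdot> (b \<cdot> x) = b \<cdot> (w \<cdot> x)" "w\<^sup>\<dagger> \<cdot> (b \<cdot> x) = b \<cdot> (w\<^sup>\<dagger> \<cdot> x)" by (metis w w' mult_assoc)+
    then show "b \<cdot> x \<in> K" "x \<cdot> b \<in> K"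
      using x
      by (simp_all add: K_def mult_left_mem) (simp_all add: mult_assoc[symmetric] mult_right_mem)
    show "x\<^sup>\<dagger> \<in> K"
      using x star_mem[of "w \<cdot> x"] star_mem[of "w\<^sup>\<dagger> \<cdot> x"]
      by (simp add: K_def star_mult star_star w w')
  qed
  interpret N: star_ideal R N
    unfolding N_def by (rule star_ideal_annihilator_of) (rule K.star_ideal_axioms)
  have "star_ideal R (K \<inter> N)"
    by unfold_locales
      (auto intro: vs.subspace_inter K.subspace N.subspace K.mult_left_mem N.mult_left_mem
        K.mult_right_mem N.mult_right_mem K.star_mem N.star_mem)
  then have "K \<inter> N \<subseteq> root_ideal" by (rule root_ideal_semiprime) (auto simp: N_def)
  moreover have "w \<in> K" using square norm by (simp add: K_def w')
  moreover have "w \<in> N" unfolding N_def K_def by (simp add: w[symmetric])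
  ultimately show ?thesis by blast
qed

lemma central_mem_if_square_mem:
  assumes z: "\<And>b. z \<cdot> b = b \<cdot> z" and square: "z \<cdot> z \<in> root_ideal"
  shows "z \<in> root_ideal"
proof (rule central_mem_if_norm_mem[OF z square], rule central_mem_if_norm_mem)
  show "z \<cdot> z\<^sup>\<dagger> \<cdot> b = b \<cdot> (z \<cdot> z\<^sup>\<dagger>)" for b by (metis z central_star mult_assoc)
  have "z \<cdot> z\<^sup>\<dagger> \<cdot> (z \<cdot> z\<^sup>\<dagger>) = z \<cdot> z \<cdot> (z\<^sup>\<dagger> \<cdot> z\<^sup>\<dagger>)" by (metis z mult_assoc)
  then show "z \<cdot> z\<^sup>\<dagger> \<cdot> (z \<cdot> z\<^sup>\<dagger>) \<in> root_ideal" using square mult_right_mem by simp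
  then show "z \<cdot> z\<^sup>\<dagger> \<cdot> (z \<cdot> z\<^sup>\<dagger>)\<^sup>\<dagger> \<in> root_ideal" by (simp add: star_mult star_star)
qed

lemma ex_alg_eval_mem_root_ideal:
  obtains P where "P \<noteq> 0" "alg_eval z P \<in> root_ideal"
proof -
  interpret V: finite_dimensional_vector_space s B by (rule finite_dim)
  note mem = skew_mat_mem_unitary[OF transverseD(1,2,3)[OF transverse_1_2]]
  note rep = lie_representationD[OF representation, unfolded g_lie_simps]
  obtain P where P: "P \<noteq> 0" "\<And>v. \<phi> (skew_mat 1 2 (alg_eval z P)) v = 0"
  proof (rule V.ex_poly_linear_family_eq_0[of "\<lambda>P. \<phi> (skew_mat 1 2 (alg_eval z P))"])
    show "Vector_Spaces.linear s s (\<phi> (skew_mat 1 2 (alg_eval z P)))" for P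
      by (rule rep(2)) (rule mem)
    show "\<phi> (skew_mat 1 2 (alg_eval z (P + Q))) v =
        \<phi> (skew_mat 1 2 (alg_eval z P)) v + \<phi> (skew_mat 1 2 (alg_eval z Q)) v" for P Q v
      unfolding alg_eval_add skew_mat_add by (rule rep(3)) (rule mem)+
    show "\<phi> (skew_mat 1 2 (alg_eval z (smult c P))) v = s c (\<phi> (skew_mat 1 2 (alg_eval z P)) v)"
      for c P v
      unfolding alg_eval_smult skew_mat_scale by (rule rep(4)) (rule mem)
  qed blast
  then have "skew_mat 1 2 (alg_eval z P) \<in> lie_annihilator (g_lie n \<rho> R) \<phi>"
    using mem unfolding lie_annihilator_def by blast
  with P(1) show thesis using that unfolding root_ideal_def by blast
qed

end

context alg_ideal
begin

lemma minimal_poly_factor_not_mem: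
  assumes "P \<noteq> 0" and minimal: "\<And>P'. P' \<noteq> 0 \<Longrightarrow> alg_eval z P' \<in> J \<Longrightarrow> degree P \<le> degree P'"
    and P: "P = [:- a, 1:] * T"
  shows "alg_eval z T \<notin> J"
proof
  assume "alg_eval z T \<in> J"
  moreover have "T \<noteq> 0" using P \<open>P \<noteq> 0\<close> by auto
  ultimately have "degree P \<le> degree T" by (intro minimal)
  moreover have "degree P = Suc (degree T)"
    unfolding P using \<open>T \<noteq> 0\<close> by (subst degree_mult_eq) auto
  ultimately show False by simp
qed

lemma minimal_poly_rsquarefree:
  assumes semiprime: "\<And>w. (\<And>b. w \<cdot> b = b \<cdot> w) \<Longrightarrow> w \<cdot> w \<in> J \<Longrightarrow> w \<in> J"
    and z: "\<And>b. z \<cdot> b = b \<cdot> z"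
    and P: "P \<noteq> 0" "alg_eval z P \<in> J"
    and minimal: "\<And>P'. P' \<noteq> 0 \<Longrightarrow> alg_eval z P' \<in> J \<Longrightarrow> degree P \<le> degree P'"
  shows "rsquarefree P"
proof -
  have "order a P = 0 \<or> order a P = 1" for a
  proof (rule ccontr)
    assume "\<not> (order a P = 0 \<or> order a P = 1)"
    then have "[:- a, 1:] ^ 2 dvd P" using \<open>P \<noteq> 0\<close> by (subst order_divides) auto
    then obtain T where T: "P = [:- a, 1:] * ([:- a, 1:] * T)"
      by (metis dvdE mult.assoc power2_eq_square)
    let ?W = "[:- a, 1:] * T"
    have "?W * ?W = P * T" unfolding T by (simp only: mult_ac)
    then have "alg_eval z ?W \<cdot> alg_eval z ?W = alg_eval z P \<cdot> alg_eval z T"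
      by (simp only: alg_eval_mult[symmetric])
    then have "alg_eval z ?W \<cdot> alg_eval z ?W \<in> J" using P(2) by (simp only: mult_right_mem)
    then have "alg_eval z ?W \<in> J" by (rule semiprime[OF alg_eval_central[OF z]])
    then show False using minimal_poly_factor_not_mem[OF P(1) minimal T] by contradiction
  qed
  then show ?thesis using \<open>P \<noteq> 0\<close> by (simp add: rsquarefree_def)
qed

end

text \<open>The roots of the minimal polynomial of \<open>z\<close> modulo \<open>J\<close> are simple by semiprimeness and
  nonzero because \<open>z\<close> is invertible.\<close>

lemma central_unit_spectrum:
  fixes R :: "(complex, 'r::ab_group_add) inv_algebra"
  assumes "alg_ideal R J"
    and semiprime: "\<And>w. (\<And>b. amult R w b = amult R b w) \<Longrightarrow> amult R w w \<in> J \<Longrightarrow> w \<in> J"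
    and P0: "P0 \<noteq> 0" "inv_algebra.alg_eval R z P0 \<in> J"
    and z: "\<And>b. amult R z b = amult R b z" and z': "amult R z' z = aone R"
  obtains A where "finite A" "0 \<notin> A" "inv_algebra.alg_eval R z (\<Prod>a\<in>A. [:- a, 1:]) \<in> J"
proof -
  interpret alg_ideal R J by fact
  obtain P where P: "P \<noteq> 0" "alg_eval z P \<in> J"
    and minimal: "\<And>P'. P' \<noteq> 0 \<Longrightarrow> alg_eval z P' \<in> J \<Longrightarrow> degree P \<le> degree P'"
    using ex_has_least_nat[of "\<lambda>P. P \<noteq> 0 \<and> alg_eval z P \<in> J" P0 degree] P0 by blast
  have "rsquarefree P" using semiprime z P minimal by (rule minimal_poly_rsquarefree)
  then have "smult (lead_coeff P) (\<Prod>a | poly P a = 0. [:- a, 1:]) = P"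
    by (rule complex_poly_decompose_rsquarefree)
  then have "lead_coeff P \<odot> alg_eval z (\<Prod>a | poly P a = 0. [:- a, 1:]) \<in> J"
    using P(2) by (simp add: alg_eval_smult[symmetric])
  then have "alg_eval z (\<Prod>a | poly P a = 0. [:- a, 1:]) \<in> J"
    using \<open>P \<noteq> 0\<close> by (simp add: scale_mem_iff)
  moreover have "poly P 0 \<noteq> 0"
  proof
    assume "poly P 0 = 0"
    then obtain T where T: "P = [:- 0, 1:] * T" by (auto simp: poly_eq_0_iff_dvd)
    have "z' \<cdot> (z \<cdot> alg_eval z T) \<in> J"
      using mult_left_mem[OF P(2)] by (simp add: T alg_eval_pCons)
    then show False
      using minimal_poly_factor_not_mem[OF P(1) minimal T]
      by (simp add: mult_assoc[symmetric] z' one_mult)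
  qed
  ultimately show thesis using that poly_roots_finite[OF \<open>P \<noteq> 0\<close>] by simp
qed


section \<open>Matrix representations of algebras\<close>

locale matrix_rep = inv_algebra R
  for R :: "(complex, 'r::ab_group_add) inv_algebra" +
  fixes m :: nat and \<epsilon> :: "nat \<Rightarrow> nat \<Rightarrow> 'r \<Rightarrow> complex"
  assumes rep_add: "\<epsilon> u v (x + y) = \<epsilon> u v x + \<epsilon> u v y"
    and rep_scale: "\<epsilon> u v (c \<odot> x) = c * \<epsilon> u v x"
    and rep_mult: "\<epsilon> u v (x \<cdot> y) = (\<Sum>w<m. \<epsilon> u w x * \<epsilon> w v y)"
    and rep_one: "u < m \<Longrightarrow> v < m \<Longrightarrow> \<epsilon> u v \<one> = of_bool (u = v)"
begin

lemma rep_zero [simp]: "\<epsilon> u v 0 = 0"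
  using rep_add[of u v 0 0] by simp

lemma rep_diff: "\<epsilon> u v (x - y) = \<epsilon> u v x - \<epsilon> u v y"
  using rep_add[of u v "x - y" y] by simp

lemma rep_minus: "\<epsilon> u v (- x) = - \<epsilon> u v x"
  using rep_diff[of u v 0 x] by simp

lemma rep_sum: "\<epsilon> u v (sum f A) = (\<Sum>x\<in>A. \<epsilon> u v (f x))"
  by (induction A rule: infinite_finite_induct) (auto simp: rep_add)

lemma rep_scalar_mult:
  assumes "\<And>u v. u < m \<Longrightarrow> v < m \<Longrightarrow> \<epsilon> u v z = c * of_bool (u = v)" and "u < m"
  shows "\<epsilon> u v (z \<cdot> x) = c * \<epsilon> u v x"
proof -
  have "\<epsilon> u v (z \<cdot> x) = (\<Sum>w<m. if w = u then c * \<epsilon> u v x else 0)"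
    unfolding rep_mult by (rule sum.cong) (auto simp: assms)
  then show ?thesis using assms(2) by simp
qed

lemma rep_alg_eval_scalar:
  assumes z: "\<And>u v. u < m \<Longrightarrow> v < m \<Longrightarrow> \<epsilon> u v z = c * of_bool (u = v)" and "u < m" "v < m"
  shows "\<epsilon> u v (alg_eval z P) = poly P c * of_bool (u = v)"
  using assms(2,3)
  by (induction P)
    (simp_all add: alg_eval_pCons rep_add rep_scale rep_one rep_scalar_mult[OF z] distrib_right
      mult.assoc)

lemma kernel_alg_ideal: "alg_ideal R {x. \<forall>u<m. \<forall>v<m. \<epsilon> u v x = 0}"
  by unfold_locales (auto simp: vs.subspace_def rep_add rep_scale rep_mult intro!: sum.neutral)

lemma kernel_proper:
  assumes "0 < m"
  shows "{x. \<forall>u<m. \<forall>v<m. \<epsilon> u v x = 0} \<noteq> UNIV"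
proof -
  have "\<one> \<notin> {x. \<forall>u<m. \<forall>v<m. \<epsilon> u v x = 0}"
    using rep_one[of 0 0] assms by (auto intro!: exI[of _ 0])
  then show ?thesis by blast
qed

end

lemma (in alg_ideal) int_power_congruence:
  fixes g :: "int \<Rightarrow> 'r"
  assumes "c \<noteq> 0" and g: "g 0 = \<one>" "\<And>k. g (k + 1) = g k \<cdot> g 1" and "g 1 - c \<odot> \<one> \<in> J"
  shows "g k - c powi k \<odot> \<one> \<in> J"
proof (induction k rule: int_induct[where k = 0])
  case base
  show ?case by (simp add: g zero_mem)
next
  case (step1 k)
  have "g (k + 1) - c powi (k + 1) \<odot> \<one> = g k \<cdot> (g 1 - c \<odot> \<one>) + c \<odot> (g k - c powi k \<odot> \<one>)"
    using \<open>c \<noteq> 0\<close>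
    by (simp add: g(2) mult_diff_right mult_scale_right mult_one vs.scale_right_diff_distrib
      power_int_add mult.commute)
  also have "\<dots> \<in> J" by (rule add_mem[OF mult_left_mem[OF assms(4)] scale_mem[OF step1(2)]])
  finally show ?case .
next
  case (step2 k)
  have "c \<odot> (g (k - 1) - c powi (k - 1) \<odot> \<one>) =
      (g k - c powi k \<odot> \<one>) - g (k - 1) \<cdot> (g 1 - c \<odot> \<one>)"
    using \<open>c \<noteq> 0\<close> g(2)[of "k - 1"]
    by (simp add: mult_diff_right mult_scale_right mult_one vs.scale_right_diff_distrib
      power_int_diff)
  also have "\<dots> \<in> J" by (rule diff_mem[OF step2(2) mult_left_mem[OF assms(4)]])
  finally show ?case using \<open>c \<noteq> 0\<close> by (simp add: scale_mem_iff)
qed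


section \<open>The quantum torus at a sign\<close>

lemma single_sum: "Poly_Mapping.single k (sum f A) = (\<Sum>x\<in>A. Poly_Mapping.single k (f x))"
  by (induction A rule: infinite_finite_induct) (auto simp: single_add)

definition torus_functional :: "(int \<times> int \<Rightarrow> complex) \<Rightarrow> torus \<Rightarrow> complex" where
  "torus_functional f x = (\<Sum>k\<in>Poly_Mapping.keys x. Poly_Mapping.lookup x k * f k)"

lemma torus_functional_single [simp]: "torus_functional f (Poly_Mapping.single k c) = c * f k"
  by (simp add: torus_functional_def)

lemma torus_functional_zero [simp]: "torus_functional f 0 = 0"
  by (simp add: torus_functional_def)

lemma torus_functional_add:
  "torus_functional f (x + y) = torus_functional f x + torus_functional f y"
  unfolding torus_functional_def
  by (rule setsum_keys_plus_distrib[where f = "\<lambda>k c. c * f k"]) (auto simp: algebra_simps)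

lemma torus_functional_scale: "torus_functional f (torus_scale c x) = c * torus_functional f x"
  by (induction x rule: torus_induct)
    (auto simp: torus_scale_single torus_scale_add torus_functional_add algebra_simps)

locale torus =
  fixes q \<theta>1 \<theta>2 :: complex
  assumes signs: "q \<in> {1, -1}" "\<theta>1 \<in> {1, -1}" "\<theta>2 \<in> {1, -1}"
begin

abbreviation T where "T \<equiv> quantum_torus q \<theta>1 \<theta>2"
definition m :: nat where "m = mult_order q"

lemma q_cases: "q = 1 \<and> m = 1 \<or> q = -1 \<and> m = 2"
  using signs by (auto simp: m_def mult_order_1 mult_order_minus_1)

lemma q_nonzero [simp]: "q \<noteq> 0" and m_pos [simp]: "0 < m" "m \<noteq> 0"
  using q_cases by auto

lemma q_power_int_square [simp]: "q powi a * q powi a = 1"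
  using signs(1) by (rule sign_powi_square)

lemma q_power_int_minus [simp]: "q powi - a = q powi a"
  using q_power_int_square[of a] by (metis inverse_unique power_int_minus)

lemma q_power_int_diff: "q powi (a - b) = q powi a * q powi b"
  using power_int_add[of q a "- b"] by simp

lemma q_power_int_cong:
  assumes "int m dvd a - b"
  shows "q powi a = q powi b"
  using q_cases assms by (auto simp: power_int_minus_left)

lemma q_power_int_eq_1: "int m dvd a \<Longrightarrow> q powi a = 1"
  using q_power_int_cong[of a 0] by simp

lemma q_power_int_mult_cong: "int m dvd a - b \<Longrightarrow> q powi (a * k) = q powi (b * k)"
  by (rule q_power_int_cong) (simp flip: left_diff_distrib)

lemma sum_q_power_int: "(\<Sum>k<m. q powi (int k * a)) = of_nat m * of_bool (int m dvd a)"
  using q_cases by (auto simp: power_int_minus_left numeral_2_eq_2)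

lemma dvd_diff_less_iff: "u < m \<Longrightarrow> v < m \<Longrightarrow> int m dvd int u - int v \<longleftrightarrow> u = v"
  by (metis mod_eq_dvd_iff mod_less of_nat_eq_iff of_nat_mod)

lemma sum_residue:
  "(\<Sum>u<m. of_bool (int m dvd a - int u) * f u) = (f (nat (a mod int m)) :: complex)"
proof -
  have less: "nat (a mod int m) < m" by (simp add: nat_less_iff)
  have "int m dvd a - int u \<longleftrightarrow> u = nat (a mod int m)" if "u < m" for u
    using that by (auto simp: mod_eq_dvd_iff[symmetric])
  then have "(\<Sum>u<m. of_bool (int m dvd a - int u) * f u) =
      (\<Sum>u<m. if u = nat (a mod int m) then f u else 0)"
    by (intro sum.cong) auto
  then show ?thesis using less by simp
qed

lemma T_simps:
  "amult T = torus_mult q" "ascale T = torus_scale" "aone T = Poly_Mapping.single (0, 0) 1"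
  "astar T = torus_star q \<theta>1 \<theta>2"
  by (simp_all add: quantum_torus_def)

end

sublocale torus \<subseteq> inv_algebra "quantum_torus q \<theta>1 \<theta>2"
  using signs by (rule quantum_torus_inv_algebra)

context torus
begin

notation mult (infixl "\<cdot>" 70) and scaled (infixr "\<odot>" 75)
  and star ("_\<^sup>\<dagger>" [1000] 1000) and unit ("\<one>")

definition conjugators :: "(torus \<times> torus) set" where
  "conjugators = (\<lambda>(i, j). (Poly_Mapping.single (int i, int j) 1,
     Poly_Mapping.single (- int i, - int j) (q powi (int i * int j)))) ` ({..<m} \<times> {..<m})"

lemma inj_conjugators:
  "inj_on (\<lambda>(i, j). (Poly_Mapping.single (int i, int j) (1::complex),
     Poly_Mapping.single (- int i, - int j) (q powi (int i * int j)))) ({..<m} \<times> {..<m})"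
  by (rule inj_onI) (auto dest: arg_cong[where f = Poly_Mapping.keys] split: if_splits)

lemma card_conjugators: "card conjugators = m * m"
  unfolding conjugators_def card_image[OF inj_conjugators] by simp

lemma sum_conjugators:
  "(\<Sum>(u, v)\<in>conjugators. f u v) = (\<Sum>i<m. \<Sum>j<m. f (Poly_Mapping.single (int i, int j) 1)
     (Poly_Mapping.single (- int i, - int j) (q powi (int i * int j))))"
  unfolding conjugators_def sum.reindex[OF inj_conjugators]
  by (simp add: case_prod_unfold sum.cartesian_product)

lemma conj_single:
  "Poly_Mapping.single (i, j) 1 \<cdot> Poly_Mapping.single (x, y) c \<cdot>
     Poly_Mapping.single (- i, - j) (q powi (i * j)) =
   Poly_Mapping.single (x, y) (q powi (j * x) * q powi (i * y) * c)"
proof -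
  have combine: "q powi a * (q powi b * 1 * c) * q powi d = q powi (a + b + d) * c" for a b d
    by (simp add: power_int_add)
  have exponent: "(j + y) * - i + j * x + i * j = j * x - i * y" by (simp add: algebra_simps)
  show ?thesis
    unfolding T_simps torus_mult_single add_Pair fst_conv snd_conv combine exponent q_power_int_diff
    by simp
qed

lemma sum_conj_single:
  "(\<Sum>(u, v)\<in>conjugators. u \<cdot> Poly_Mapping.single (x, y) c \<cdot> v) =
     Poly_Mapping.single (x, y) (of_nat (m * m) * of_bool (int m dvd x \<and> int m dvd y) * c)"
proof -
  have "(\<Sum>(u, v)\<in>conjugators. u \<cdot> Poly_Mapping.single (x, y) c \<cdot> v) =
      Poly_Mapping.single (x, y) (\<Sum>i<m. \<Sum>j<m. q powi (int j * x) * q powi (int i * y) * c)"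
    by (simp add: sum_conjugators conj_single single_sum)
  also have "(\<Sum>i<m. \<Sum>j<m. q powi (int j * x) * q powi (int i * y) * c) =
      (\<Sum>j<m. q powi (int j * x)) * (\<Sum>i<m. q powi (int i * y)) * c"
    by (simp add: sum_product sum_distrib_left sum_distrib_right mult.assoc)
  finally show ?thesis unfolding sum_q_power_int by (simp add: of_bool_conj)
qed

lemma sum_conj_mult_commute:
  "(\<Sum>(u, v)\<in>conjugators. u \<cdot> (a \<cdot> b) \<cdot> v) = (\<Sum>(u, v)\<in>conjugators. u \<cdot> (b \<cdot> a) \<cdot> v)"
proof (induction a rule: torus_induct)
  case (single k c)
  show ?case
  proof (induction b rule: torus_induct)
    case (single l d)
    obtain x y x' y' where kl: "k = (x, y)" "l = (x', y')" by (cases k, cases l)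
    have "q powi (y * x') = q powi (y' * x)" if dvd: "int m dvd x + x'" "int m dvd y + y'"
    proof (rule q_power_int_cong)
      have "y * x' - y' * x = y * (x + x') - x * (y + y')" by (simp add: algebra_simps)
      then show "int m dvd y * x' - y' * x" using dvd by simp
    qed
    then show ?case
      by (auto simp: kl T_simps(1) torus_mult_single sum_conj_single[unfolded T_simps(1)]
        add.commute mult_ac of_bool_def)
  qed (simp_all add: mult_add_left mult_add_right case_prod_unfold sum.distrib)
qed (simp_all add: mult_add_left mult_add_right case_prod_unfold sum.distrib)

end

sublocale torus \<subseteq> averaging_algebra "quantum_torus q \<theta>1 \<theta>2" conjugators
proof
  show "finite conjugators" "conjugators \<noteq> {}"
    by (auto simp: conjugators_def lessThan_empty_iff)
  show "u \<cdot> v = \<one>" "v \<cdot> u = \<one>" if "(u, v) \<in> conjugators" for u v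
    using that
    by (auto simp: conjugators_def T_simps torus_mult_single zero_prod_def mult.commute)
qed (rule sum_conj_mult_commute)

context torus
begin

lemma avg_single:
  "avg (Poly_Mapping.single (x, y) c) =
     Poly_Mapping.single (x, y) (of_bool (int m dvd x \<and> int m dvd y) * c)"
  unfolding avg_def sum_conj_single
  by (simp add: card_conjugators T_simps torus_scale_single field_simps)

definition z1 :: torus where "z1 = Poly_Mapping.single (int m, 0) 1"
definition z2 :: torus where "z2 = Poly_Mapping.single (0, int m) 1"

lemma z1_central: "z1 \<cdot> x = x \<cdot> z1"
  and z2_central: "z2 \<cdot> x = x \<cdot> z2"
  unfolding T_simps z1_def z2_def
  by (induction x rule: torus_induct; force simp: torus_mult_add_left torus_mult_add_right
      torus_mult_single add.commute q_power_int_eq_1)+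

lemma z1_inverse: "Poly_Mapping.single (- int m, 0) 1 \<cdot> z1 = \<one>"
  and z2_inverse: "Poly_Mapping.single (0, - int m) 1 \<cdot> z2 = \<one>"
  by (simp_all add: T_simps z1_def z2_def torus_mult_single)

lemma sum_avg_conjugators: "x = (\<Sum>(u, v)\<in>conjugators. avg (x \<cdot> v) \<cdot> u)"
proof (induction x rule: torus_induct)
  case (single k c)
  obtain a b where k: "k = (a, b)" by (cases k)
  have "avg (Poly_Mapping.single k c \<cdot> Poly_Mapping.single (- i, - j) (q powi (i * j))) \<cdot>
      Poly_Mapping.single (i, j) 1 =
      Poly_Mapping.single k (of_bool (int m dvd b - j) * (of_bool (int m dvd a - i) * c))" for i j
  proof -
    have "q powi ((b - j) * i) * (q powi (b * i) * c * q powi (i * j)) =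
        (q powi (b * i) * q powi (b * i)) * (q powi (i * j) * q powi (i * j)) * c"
      by (simp add: left_diff_distrib right_diff_distrib q_power_int_diff mult_ac)
    also have "\<dots> = c" by (simp only: q_power_int_square) simp
    finally have "Poly_Mapping.single (a, b)
        (q powi ((b - j) * i) * (q powi (b * i) * c * q powi (i * j))) =
        Poly_Mapping.single (a, b) c"
      by (rule arg_cong)
    then show ?thesis
      by (simp add: k T_simps(1) torus_mult_single avg_single of_bool_conj)
  qed
  then have "(\<Sum>(u, v)\<in>conjugators. avg (Poly_Mapping.single k c \<cdot> v) \<cdot> u) =
      (\<Sum>i<m. \<Sum>j<m. Poly_Mapping.single k
        (of_bool (int m dvd b - int j) * (of_bool (int m dvd a - int i) * c)))"
    by (simp add: sum_conjugators)
  also have "\<dots> = Poly_Mapping.single k c"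
    by (simp add: single_sum[symmetric] sum_residue)
  finally show ?case ..
qed (simp_all add: mult_add_left avg_add case_prod_unfold sum.distrib avg.zero)

text \<open>\<open>ev p\<close> is the representation on $\mathbb{C}^m$ in which $t_1$ acts by
  $\alpha\,\mathrm{diag}(1, q, \dots, q^{m-1})$ and $t_2$ by $\beta$ times the cyclic shift, where
  \<open>p = (\<alpha>, \<beta>)\<close>; \<open>central_char p\<close> is its central character, extended by zero.\<close>

definition ev :: "complex \<times> complex \<Rightarrow> nat \<Rightarrow> nat \<Rightarrow> torus \<Rightarrow> complex" where
  "ev p u v = torus_functional (\<lambda>(x, y). fst p powi x * snd p powi y * q powi (int u * x) *
     of_bool (int m dvd int u + y - int v))"

definition central_char :: "complex \<times> complex \<Rightarrow> torus \<Rightarrow> complex" where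
  "central_char p = torus_functional (\<lambda>(x, y). fst p powi x * snd p powi y *
     of_bool (int m dvd x \<and> int m dvd y))"

definition torus_points :: "(complex \<times> complex) set" where
  "torus_points = {p. fst p \<noteq> 0 \<and> snd p \<noteq> 0}"

lemma ev_add: "ev p u v (x + y) = ev p u v x + ev p u v y"
  and ev_scale: "ev p u v (torus_scale c x) = c * ev p u v x"
  and ev_zero [simp]: "ev p u v 0 = 0"
  by (simp_all add: ev_def torus_functional_add torus_functional_scale)

lemma ev_single: "ev p u v (Poly_Mapping.single (x, y) c) =
    c * (fst p powi x * snd p powi y * q powi (int u * x) * of_bool (int m dvd int u + y - int v))"
  by (simp add: ev_def)

lemma ev_mult:
  assumes p: "p \<in> torus_points"
  shows "ev p u v (torus_mult q x y) = (\<Sum>w<m. ev p u w x * ev p w v y)"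
proof (induction x rule: torus_induct)
  case (single k c)
  show ?case
  proof (induction y rule: torus_induct)
    case (single l d)
    obtain x y x' y' where kl: "k = (x, y)" "l = (x', y')" by (cases k, cases l)
    define w where "w = nat ((int u + y) mod int m)"
    have w: "int m dvd int u + y - int w" by (simp add: w_def)
    have "int m dvd int u + y + y' - int v \<longleftrightarrow> int m dvd int w + y' - int v"
    proof -
      have "int u + y + y' - int v = (int u + y - int w) + (int w + y' - int v)" by simp
      then show ?thesis using dvd_add_right_iff[OF w] by (simp only:)
    qed
    moreover have "q powi (int w * x') = q powi (int u * x') * q powi (y * x')"
      using q_power_int_mult_cong[OF w, of x'] by (simp add: distrib_right power_int_add)
    moreover have
      "(\<Sum>w<m. ev p u w (Poly_Mapping.single k c) * ev p w v (Poly_Mapping.single l d)) =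
       (\<Sum>w<m. of_bool (int m dvd int u + y - int w) *
         (c * (fst p powi x * snd p powi y * q powi (int u * x)) *
          ev p w v (Poly_Mapping.single l d)))"
      by (simp add: kl(1) ev_single mult_ac)
    ultimately show ?case
      using p unfolding sum_residue w_def[symmetric]
      by (simp add: kl ev_single torus_mult_single torus_points_def power_int_add distrib_left
          add.assoc add_diff_eq)
  qed (simp_all add: ev_add torus_mult_add_right distrib_left sum.distrib)
qed (simp_all add: ev_add torus_mult_add_left distrib_right sum.distrib)

lemma matrix_rep_ev: "p \<in> torus_points \<Longrightarrow> matrix_rep T m (ev p)"
  by unfold_locales
    (simp_all add: T_simps ev_add ev_scale ev_mult ev_single dvd_diff_less_iff)

lemma ev_z1: "p \<in> torus_points \<Longrightarrow> u < m \<Longrightarrow> v < m \<Longrightarrow> ev p u v z1 = fst p ^ m * of_bool (u = v)"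
  and ev_z2: "p \<in> torus_points \<Longrightarrow> u < m \<Longrightarrow> v < m \<Longrightarrow> ev p u v z2 = snd p ^ m * of_bool (u = v)"
proof -
  have "int m dvd int u + int m - int v \<longleftrightarrow> int m dvd int u - int v"
    using dvd_add_right_iff[of "int m" "int m" "int u - int v"] by (simp add: algebra_simps)
  then show "ev p u v z1 = fst p ^ m * of_bool (u = v)" "ev p u v z2 = snd p ^ m * of_bool (u = v)"
    if "u < m" "v < m"
    using that by (simp_all add: z1_def z2_def ev_single dvd_diff_less_iff q_power_int_eq_1)
qed

lemma ev_avg: "ev p u v (avg x) = of_bool (int m dvd int u - int v) * (\<Sum>w<m. ev p w w x) / of_nat m"
proof (induction x rule: torus_induct)
  case (single k c)
  obtain x y where k: "k = (x, y)" by (cases k)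
  have "(\<Sum>w<m. ev p w w (Poly_Mapping.single k c)) =
      (\<Sum>w<m. q powi (int w * x)) * (c * (fst p powi x * snd p powi y * of_bool (int m dvd y)))"
    by (simp add: k ev_single sum_distrib_left sum_distrib_right mult_ac)
  moreover have "int m dvd int u + y - int v \<longleftrightarrow> int m dvd int u - int v" if "int m dvd y"
    using dvd_add_right_iff[OF that, of "int u - int v"] by (simp add: algebra_simps)
  ultimately show ?case
    unfolding sum_q_power_int
    by (auto simp: k avg_single ev_single of_bool_def q_power_int_eq_1)
qed (simp_all add: ev_add avg_add avg.zero sum.distrib distrib_left add_divide_distrib)

lemma monomial_diff_central_char_mem:
  assumes "alg_ideal T N" and p: "p \<in> torus_points"
    and z: "z1 - fst p ^ m \<odot> \<one> \<in> N" "z2 - snd p ^ m \<odot> \<one> \<in> N"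
  shows "Poly_Mapping.single (int m * i, int m * j) 1 -
    (fst p powi (int m * i) * snd p powi (int m * j)) \<odot> \<one> \<in> N"
proof -
  interpret N: alg_ideal T N by fact
  let ?a = "(fst p ^ m) powi i" and ?b = "(snd p ^ m) powi j"
  let ?s = "Poly_Mapping.single (int m * i, 0) 1" and ?t = "Poly_Mapping.single (0, int m * j) 1"
  have mem: "?s - ?a \<odot> \<one> \<in> N" "?t - ?b \<odot> \<one> \<in> N"
    by (rule N.int_power_congruence;
      use p z in \<open>simp add: T_simps torus_mult_single distrib_left torus_points_def z1_def z2_def\<close>)+
  have "Poly_Mapping.single (int m * i, int m * j) 1 -
      (fst p powi (int m * i) * snd p powi (int m * j)) \<odot> \<one> = ?s \<cdot> ?t - (?a * ?b) \<odot> \<one>"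
    by (simp add: T_simps torus_mult_single power_int_mult)
  also have "\<dots> = ?s \<cdot> (?t - ?b \<odot> \<one>) + ?b \<odot> (?s - ?a \<odot> \<one>)"
    by (simp add: mult_diff_right mult_scale_right mult_one vs.scale_right_diff_distrib
      mult.commute)
  also have "\<dots> \<in> N" using mem by (intro N.scale_mem N.add_mem N.mult_left_mem)
  finally show ?thesis .
qed

text \<open>The average of \<open>x\<close> is central, so that modulo an ideal containing \<open>z1 - \<alpha>\<^sup>m\<close> and
  \<open>z2 - \<beta>\<^sup>m\<close> it is a scalar, given by the central character.\<close>

lemma avg_diff_central_char_mem:
  assumes "alg_ideal T N" and "p \<in> torus_points"
    and "z1 - fst p ^ m \<odot> \<one> \<in> N" "z2 - snd p ^ m \<odot> \<one> \<in> N"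
  shows "avg x - central_char p x \<odot> \<one> \<in> N"
proof -
  interpret N: alg_ideal T N by fact
  show ?thesis
  proof (induction x rule: torus_induct)
    case (single k c)
    obtain x y where k: "k = (x, y)" by (cases k)
    show ?case
    proof (cases "int m dvd x \<and> int m dvd y")
      case True
      then obtain i j where ij: "x = int m * i" "y = int m * j" by (elim conjE dvdE)
      have "avg (Poly_Mapping.single k c) - central_char p (Poly_Mapping.single k c) \<odot> \<one> =
          c \<odot> (Poly_Mapping.single (int m * i, int m * j) 1 -
            (fst p powi (int m * i) * snd p powi (int m * j)) \<odot> \<one>)"
        by (simp add: k ij avg_single central_char_def T_simps torus_scale_single
          vs.scale_right_diff_distrib[unfolded T_simps])
      also have "\<dots> \<in> N" by (intro N.scale_mem monomial_diff_central_char_mem[OF assms])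
      finally show ?thesis .
    next
      case False
      then show ?thesis by (auto simp: k avg_single central_char_def N.zero_mem)
    qed
  next
    case (add x y)
    then show ?case using N.add_mem[OF add]
      by (simp add: avg_add central_char_def torus_functional_add vs.scale_left_distrib
        algebra_simps)
  qed (simp add: central_char_def avg.zero N.zero_mem)
qed

lemma mem_iff_central_char_eq_0:
  assumes N: "alg_ideal T N" "N \<noteq> UNIV" and p: "p \<in> torus_points"
    and z: "z1 - fst p ^ m \<odot> \<one> \<in> N" "z2 - snd p ^ m \<odot> \<one> \<in> N"
  shows "x \<in> N \<longleftrightarrow> (\<forall>y. central_char p (x \<cdot> y) = 0)"
proof -
  interpret N: averaging_ideal T conjugators N
    using N(1) averaging_algebra_axioms by (intro averaging_ideal.intro)
  note congruent = avg_diff_central_char_mem[OF N(1) p z]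
  have avg_mem_iff: "avg x \<in> N \<longleftrightarrow> central_char p x = 0" for x
  proof -
    have "avg x \<in> N \<longleftrightarrow> central_char p x \<odot> \<one> \<in> N"
      using N.add_mem[OF congruent[of x], of "central_char p x \<odot> \<one>"]
        N.diff_mem[OF _ congruent[of x], of "avg x"]
      by auto
    also have "\<dots> \<longleftrightarrow> central_char p x = 0"
      using N.scale_mem_iff[of "central_char p x" \<one>] N.one_mem_iff N(2) N.zero_mem by auto
    finally show ?thesis .
  qed
  show ?thesis
  proof
    show "\<forall>y. central_char p (x \<cdot> y) = 0" if "x \<in> N"
      using that by (simp add: N.avg_mem N.mult_right_mem flip: avg_mem_iff)
    assume "\<forall>y. central_char p (x \<cdot> y) = 0"
    then have "(\<Sum>(u, v)\<in>conjugators. avg (x \<cdot> v) \<cdot> u) \<in> N"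
      by (intro N.sum_mem) (auto simp: avg_mem_iff intro: N.mult_right_mem)
    then show "x \<in> N" using sum_avg_conjugators[of x] by simp
  qed
qed

lemma proper_ideal_eq_ev_kernel:
  assumes N: "alg_ideal T N" "N \<noteq> UNIV" and p: "p \<in> torus_points"
    and z: "z1 - fst p ^ m \<odot> \<one> \<in> N" "z2 - snd p ^ m \<odot> \<one> \<in> N"
  shows "N = {x. \<forall>u<m. \<forall>v<m. ev p u v x = 0}"
proof -
  interpret ev: matrix_rep T m "ev p" using p by (rule matrix_rep_ev)
  let ?K = "{x. \<forall>u<m. \<forall>v<m. ev p u v x = 0}"
  have "z1 - fst p ^ m \<odot> \<one> \<in> ?K" "z2 - snd p ^ m \<odot> \<one> \<in> ?K"
    using p by (simp_all add: ev.rep_diff ev.rep_scale ev.rep_one ev_z1 ev_z2)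
  note K = mem_iff_central_char_eq_0[OF ev.kernel_alg_ideal ev.kernel_proper[OF m_pos(1)] p this]
  show ?thesis
    by (intro set_eqI) (simp only: mem_iff_central_char_eq_0[OF N p z] K)
qed

lemma ex_root: "\<exists>b :: complex. b ^ m = a"
  using q_cases power2_csqrt[of a] by (auto intro: exI[of _ "csqrt a"])

theorem alg_ideal_eq_ev_kernel:
  assumes J: "alg_ideal T J"
    and A1: "finite A1" "0 \<notin> A1" "alg_eval z1 (\<Prod>a\<in>A1. [:- a, 1:]) \<in> J"
    and A2: "finite A2" "0 \<notin> A2" "alg_eval z2 (\<Prod>a\<in>A2. [:- a, 1:]) \<in> J"
  obtains S where "finite S" "S \<subseteq> torus_points" "inj_on (\<lambda>p. (fst p ^ m, snd p ^ m)) S"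
    "\<And>x. x \<in> J \<longleftrightarrow> (\<forall>p\<in>S. \<forall>u<m. \<forall>v<m. ev p u v x = 0)"
proof -
  obtain N where N: "\<forall>a\<in>A1. \<forall>b\<in>A2.
      alg_ideal T (N a b) \<and> z1 - a \<odot> \<one> \<in> N a b \<and> z2 - b \<odot> \<one> \<in> N a b"
    and J_eq: "J = (\<Inter>a\<in>A1. \<Inter>b\<in>A2. N a b)"
    using alg_ideal.joint_central_spectral_decomposition[OF J z1_central z2_central A1(1) A2(1)
        A1(3) A2(3)] by (elim exE conjE)
  obtain root where root: "root a ^ m = a" for a :: complex using ex_root by metis
  define point where "point = (\<lambda>(a, b). (root a, root b))"
  define D where "D = {(a, b). a \<in> A1 \<and> b \<in> A2 \<and> N a b \<noteq> UNIV}"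
  have "root a \<noteq> 0" if "a \<noteq> 0" for a using that root[of a] by auto
  then have "root a \<noteq> 0" if "a \<in> A1 \<union> A2" for a using that A1(2) A2(2) by (metis Un_iff)
  then have point: "point d \<in> torus_points" if "d \<in> D" for d
    using that by (auto simp: D_def point_def torus_points_def)
  have kernel: "N a b = {x. \<forall>u<m. \<forall>v<m. ev (point (a, b)) u v x = 0}" if "(a, b) \<in> D" for a b
    using that N point[OF that]
    by (intro proper_ideal_eq_ev_kernel) (auto simp: D_def point_def root)
  show thesis
  proof (rule that[of "point ` D"])
    have "D \<subseteq> A1 \<times> A2" by (auto simp: D_def)
    then have "finite D" using A1(1) A2(1) by (auto intro: finite_subset)
    then show "finite (point ` D)" by (rule finite_imageI)
    show "point ` D \<subseteq> torus_points" using point by blast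
    show "inj_on (\<lambda>p. (fst p ^ m, snd p ^ m)) (point ` D)"
      by (auto simp: inj_on_def point_def root)
    fix x
    have "x \<in> J \<longleftrightarrow> (\<forall>(a, b)\<in>D. x \<in> N a b)" unfolding J_eq D_def by blast
    then show "x \<in> J \<longleftrightarrow> (\<forall>p\<in>point ` D. \<forall>u<m. \<forall>v<m. ev p u v x = 0)"
      using kernel by auto
  qed
qed

lemma ev_surj:
  assumes p: "p \<in> torus_points"
  obtains x where "\<And>u v. u < m \<Longrightarrow> v < m \<Longrightarrow> ev p u v x = M u v"
proof -
  interpret ev: matrix_rep T m "ev p" using p by (rule matrix_rep_ev)
  define mat_unit where "mat_unit u v = (\<Sum>k<m. Poly_Mapping.single (int k, int v - int u)
    (q powi (int u * int k) * fst p powi - int k * snd p powi (int u - int v) / of_nat m))" for u v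
  have mat_unit: "ev p w x (mat_unit u v) = of_bool (w = u \<and> x = v)"
    if "u < m" "v < m" "w < m" "x < m" for u v w x
  proof -
    have "ev p w x (mat_unit u v) = (\<Sum>k<m. q powi (int k * (int w - int u))) *
        of_bool (int m dvd int w + (int v - int u) - int x) / of_nat m"
      unfolding mat_unit_def ev.rep_sum ev_single sum_distrib_right sum_divide_distrib
      using p
      by (intro sum.cong) (auto simp: torus_points_def power_int_minus power_int_diff
          right_diff_distrib q_power_int_diff mult_ac)
    then show ?thesis
      using that unfolding sum_q_power_int by (auto simp: dvd_diff_less_iff)
  qed
  define x where "x = (\<Sum>u<m. \<Sum>v<m. M u v \<odot> mat_unit u v)"
  have "ev p w z x = M w z" if "w < m" "z < m" for w z
  proof -
    have "ev p w z x = (\<Sum>u<m. \<Sum>v<m. if v = z then if u = w then M w z else 0 else 0)"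
      unfolding x_def ev.rep_sum ev.rep_scale using that by (intro sum.cong) (auto simp: mat_unit)
    then show ?thesis using that by simp
  qed
  then show thesis by (rule that)
qed

lemma ev_interpolation:
  assumes S: "finite S" "S \<subseteq> torus_points" "inj_on (\<lambda>p. (fst p ^ m, snd p ^ m)) S"
  obtains x where "\<And>p u v. p \<in> S \<Longrightarrow> u < m \<Longrightarrow> v < m \<Longrightarrow> ev p u v x = M p u v"
proof -
  define e where "e p = alg_eval z1 (lagrange_basis ((\<lambda>p. fst p ^ m) ` S) (fst p ^ m)) \<cdot>
    alg_eval z2 (lagrange_basis ((\<lambda>p. snd p ^ m) ` S) (snd p ^ m))" for p
  have "\<exists>x. \<forall>u<m. \<forall>v<m. ev p u v x = M p u v" if "p \<in> S" for p
    using ev_surj[of p "M p"] that S(2) by (metis subsetD)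
  then obtain x where x: "\<And>p u v. p \<in> S \<Longrightarrow> u < m \<Longrightarrow> v < m \<Longrightarrow> ev p u v (x p) = M p u v" by metis
  have idempotent: "ev p u v (e p' \<cdot> y) = of_bool (p = p') * ev p u v y"
    if p: "p \<in> S" "p' \<in> S" and uv: "u < m" "v < m" for p p' u v y
  proof -
    have "p \<in> torus_points" using p S(2) by blast
    then interpret ev: matrix_rep T m "ev p" by (rule matrix_rep_ev)
    have basis: "poly (lagrange_basis ((\<lambda>p. fst p ^ m) ` S) (fst p' ^ m)) (fst p ^ m) =
        of_bool (fst p ^ m = fst p' ^ m)"
      "poly (lagrange_basis ((\<lambda>p. snd p ^ m) ` S) (snd p' ^ m)) (snd p ^ m) =
        of_bool (snd p ^ m = snd p' ^ m)"
      using S(1) p(1) by (auto simp: poly_lagrange_basis)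
    have "fst p ^ m = fst p' ^ m \<and> snd p ^ m = snd p' ^ m \<longleftrightarrow> p = p'"
      using inj_onD[OF S(3) _ p] by auto
    moreover have "ev p u v (e p') =
        of_bool (fst p ^ m = fst p' ^ m \<and> snd p ^ m = snd p' ^ m) * of_bool (u = v)"
      if "u < m" "v < m" for u v
      unfolding e_def using that \<open>p \<in> torus_points\<close>
      by (simp add: ev.rep_scalar_mult[OF ev.rep_alg_eval_scalar[OF ev_z1]] basis of_bool_conj
          ev.rep_alg_eval_scalar[OF ev_z2])
    ultimately show ?thesis using uv by (simp add: ev.rep_scalar_mult)
  qed
  have "ev p u v (\<Sum>p'\<in>S. e p' \<cdot> x p') = M p u v" if p: "p \<in> S" and uv: "u < m" "v < m" for p u v
  proof -
    interpret ev: matrix_rep T m "ev p" using p S(2) by (intro matrix_rep_ev) blast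
    have "ev p u v (\<Sum>p'\<in>S. e p' \<cdot> x p') = (\<Sum>p'\<in>S. if p' = p then M p u v else 0)"
      unfolding ev.rep_sum using p uv by (intro sum.cong) (auto simp: idempotent x)
    then show ?thesis using S(1) p by simp
  qed
  then show thesis by (rule that)
qed

end


section \<open>Block maps\<close>

lemma complex_algebra_simps:
  "amult complex_algebra = (*)" "ascale complex_algebra = (*)" "astar complex_algebra = (\<lambda>z. z)"
  "aone complex_algebra = 1"
  by (simp_all add: complex_algebra_def)

lemmas gl_complex_simps = inv_algebra.gl_simps[OF inv_algebra_complex]

text \<open>\<open>block_map\<close> replaces every entry of an \<open>n \<times> n\<close> matrix by its image under a representation on
  \<open>m \<times> m\<close> matrices; the rows of the result are labelled through \<open>\<pi>\<close> and rescaled by the signs \<open>\<chi>\<close>.\<close>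

definition block_map :: "nat \<Rightarrow> (nat \<Rightarrow> nat \<times> nat) \<Rightarrow> (nat \<Rightarrow> complex) \<Rightarrow>
    (nat \<Rightarrow> nat \<Rightarrow> 'r \<Rightarrow> complex) \<Rightarrow> (nat \<Rightarrow> nat \<Rightarrow> 'r) \<Rightarrow> nat \<Rightarrow> nat \<Rightarrow> complex" where
  "block_map N \<pi> \<chi> \<epsilon> X = (\<lambda>a b. if a \<in> {1..N} \<and> b \<in> {1..N}
     then \<chi> a * \<chi> b * \<epsilon> (snd (\<pi> a)) (snd (\<pi> b)) (X (fst (\<pi> a)) (fst (\<pi> b))) else 0)"

lemma block_map_gl: "block_map N \<pi> \<chi> \<epsilon> X \<in> lcarrier (gl N complex_algebra)"
  by (auto simp: block_map_def gl_def)

locale block_rep = matrix_rep R m \<epsilon>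
  for R :: "(complex, 'r::ab_group_add) inv_algebra" and m \<epsilon> +
  fixes n N :: nat and \<pi> :: "nat \<Rightarrow> nat \<times> nat" and \<chi> :: "nat \<Rightarrow> complex"
  assumes bij_blocks: "bij_betw \<pi> {1..N} ({1..n} \<times> {..<m})"
    and sign_square: "\<chi> a * \<chi> a = 1"
begin

abbreviation block where "block \<equiv> block_map N \<pi> \<chi> \<epsilon>"

lemma block_add: "block (X + Y) = block X + block Y"
  and block_diff: "block (X - Y) = block X - block Y"
  and block_minus: "block (- X) = - block X"
  and block_scale: "block (c \<odot>\<^sub>m X) = (\<lambda>a b. c * block X a b)"
  by (auto simp: block_map_def fun_eq_iff rep_add rep_diff rep_minus rep_scale
    algebra_simps)

lemma sum_blocks: "(\<Sum>a = 1..N. f (\<pi> a)) = (\<Sum>i = 1..n. \<Sum>u<m. f (i, u))"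
  unfolding sum.reindex_bij_betw[OF bij_blocks] by (simp add: sum.cartesian_product)

lemma block_mult: "block (mat_mult R n X Y) = mat_mult complex_algebra N (block X) (block Y)"
proof (intro ext)
  fix a b
  show "block (mat_mult R n X Y) a b = mat_mult complex_algebra N (block X) (block Y) a b"
  proof (cases "a \<in> {1..N} \<and> b \<in> {1..N}")
    case True
    let ?l = "\<lambda>c. \<epsilon> (snd (\<pi> a)) (snd c) (X (fst (\<pi> a)) (fst c))"
    let ?r = "\<lambda>c. \<epsilon> (snd c) (snd (\<pi> b)) (Y (fst c) (fst (\<pi> b)))"
    have "mat_mult complex_algebra N (block X) (block Y) a b =
        (\<Sum>c = 1..N. (\<chi> c * \<chi> c) * (\<chi> a * \<chi> b * (?l (\<pi> c) * ?r (\<pi> c))))"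
      unfolding mat_mult_def complex_algebra_simps block_map_def
      using True by (intro sum.cong) (auto simp: mult_ac)
    also have "\<dots> = (\<Sum>i = 1..n. \<Sum>u<m. \<chi> a * \<chi> b * (?l (i, u) * ?r (i, u)))"
      unfolding sign_square mult_1 by (rule sum_blocks)
    also have "\<dots> = block (mat_mult R n X Y) a b"
      using True by (simp add: block_map_def mat_mult_def rep_sum rep_mult sum_distrib_left)
    finally show ?thesis ..
  next
    case False
    then show ?thesis
      by (auto simp: block_map_def mat_mult_def complex_algebra_simps)
  qed
qed

lemma lie_hom_block: "lie_hom (gl n R) (gl N complex_algebra) block"
  unfolding lie_hom_def gl_simps gl_complex_simps
  by (simp add: image_subset_iff block_map_gl block_add block_diff block_mult block_scale
    inv_algebra.mat_scale_def[OF inv_algebra_complex] complex_algebra_simps)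

lemma trace_block: "mat_trace N (block X) = (\<Sum>u<m. \<epsilon> u u (mat_trace n X))"
proof -
  have "mat_trace N (block X) = (\<Sum>a = 1..N. \<epsilon> (snd (\<pi> a)) (snd (\<pi> a)) (X (fst (\<pi> a)) (fst (\<pi> a))))"
    by (simp add: mat_trace_def block_map_def sign_square)
  also have "\<dots> = (\<Sum>i = 1..n. \<Sum>u<m. \<epsilon> u u (X i i))" by (subst sum_blocks) simp
  also have "\<dots> = (\<Sum>u<m. \<epsilon> u u (mat_trace n X))"
    by (subst sum.swap) (simp add: mat_trace_def rep_sum)
  finally show ?thesis .
qed

lemma block_eq_0_iff:
  assumes "X \<in> lcarrier (gl n R)"
  shows "block X = 0 \<longleftrightarrow> (\<forall>i j. \<forall>u<m. \<forall>v<m. \<epsilon> u v (X i j) = 0)"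
proof (intro iffI allI impI)
  fix i j u v assume zero: "block X = 0" and uv: "u < m" "v < m"
  show "\<epsilon> u v (X i j) = 0"
  proof (cases "i \<in> {1..n} \<and> j \<in> {1..n}")
    case True
    then have "(i, u) \<in> \<pi> ` {1..N}" "(j, v) \<in> \<pi> ` {1..N}"
      using True uv unfolding bij_betw_imp_surj_on[OF bij_blocks] by simp_all
    then obtain a b where ab: "a \<in> {1..N}" "\<pi> a = (i, u)" "b \<in> {1..N}" "\<pi> b = (j, v)" by auto
    then have "\<chi> a * \<chi> b * \<epsilon> u v (X i j) = 0"
      using fun_cong[OF fun_cong[OF zero], of a b] by (simp add: block_map_def)
    then show ?thesis using sign_square[of a] sign_square[of b] by auto
  next
    case False
    then show ?thesis using assms by (auto simp: mem_gl_iff)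
  qed
next
  assume "\<forall>i j. \<forall>u<m. \<forall>v<m. \<epsilon> u v (X i j) = 0"
  moreover have "snd (\<pi> a) < m" if "a \<in> {1..N}" for a
    using bij_betwE[OF bij_blocks] that by (metis SigmaE lessThan_iff snd_conv)
  ultimately show "block X = 0" by (auto simp: block_map_def fun_eq_iff)
qed

end

context torus
begin

lemma block_interpolation:
  assumes S: "finite S" "S \<subseteq> torus_points" "inj_on (\<lambda>p. (fst p ^ m, snd p ^ m)) S"
    and blocks: "bij_betw \<pi> {1..N} ({1..n} \<times> {..<m})" "\<And>a. \<chi> a * \<chi> a = 1"
    and Y: "\<And>p. p \<in> S \<Longrightarrow> Y p \<in> lcarrier (gl N complex_algebra)"
  shows "\<exists>X\<in>lcarrier (gl n T). \<forall>p\<in>S. block_map N \<pi> \<chi> (ev p) X = Y p"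
proof -
  define row where "row = the_inv_into {1..N} \<pi>"
  have row: "row (\<pi> a) = a" if "a \<in> {1..N}" for a
    unfolding row_def using bij_betw_imp_inj_on[OF blocks(1)] that by (rule the_inv_into_f_f)
  have range: "fst (\<pi> a) \<in> {1..n}" "snd (\<pi> a) < m" if "a \<in> {1..N}" for a
    using bij_betwE[OF blocks(1)] that by (auto simp: mem_Times_iff)
  define M where "M i j p u v = \<chi> (row (i, u)) * \<chi> (row (j, v)) * Y p (row (i, u)) (row (j, v))"
    for i j p u v
  have "\<exists>x. \<forall>p\<in>S. \<forall>u<m. \<forall>v<m. ev p u v x = M i j p u v" for i j
    by (rule ev_interpolation[OF S, of "M i j"]) blast
  then obtain x where x: "\<And>i j p u v. p \<in> S \<Longrightarrow> u < m \<Longrightarrow> v < m \<Longrightarrow> ev p u v (x i j) = M i j p u v"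
    by metis
  define X where "X = (\<lambda>i j. if i \<in> {1..n} \<and> j \<in> {1..n} then x i j else 0)"
  show ?thesis
  proof (intro bexI ballI ext)
    show "X \<in> lcarrier (gl n T)" by (simp add: X_def mem_gl_iff)
    fix p a b assume p: "p \<in> S"
    have "\<chi> a * \<chi> b * (\<chi> a * \<chi> b * y) = (\<chi> a * \<chi> a) * (\<chi> b * \<chi> b) * y" for y by (simp only: mult_ac)
    then have "\<chi> a * \<chi> b * (\<chi> a * \<chi> b * y) = y" for y by (simp add: blocks(2))
    then show "block_map N \<pi> \<chi> (ev p) X a b = Y p a b"
      using Y[OF p] range by (auto simp: block_map_def X_def x[OF p] M_def row gl_def)
  qed
qed

text \<open>The average of the trace of an interpolating matrix is evaluated to zero everywhere, so it may
  be subtracted from a diagonal entry.\<close>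

lemma block_interpolation_traceless:
  assumes S: "finite S" "S \<subseteq> torus_points" "inj_on (\<lambda>p. (fst p ^ m, snd p ^ m)) S"
    and blocks: "bij_betw \<pi> {1..N} ({1..n} \<times> {..<m})" "\<And>a. \<chi> a * \<chi> a = 1" and "0 < n"
    and Y: "\<And>p. p \<in> S \<Longrightarrow> Y p \<in> lcarrier (gl N complex_algebra)" "\<And>p. p \<in> S \<Longrightarrow> mat_trace N (Y p) = 0"
  obtains X where "X \<in> lcarrier (gl n T)" "avg (mat_trace n X) = 0"
    "\<And>p. p \<in> S \<Longrightarrow> block_map N \<pi> \<chi> (ev p) X = Y p"
proof -
  have "\<exists>Z\<in>lcarrier (gl n T). \<forall>p\<in>S. block_map N \<pi> \<chi> (ev p) Z = Y p"
    using S blocks Y(1) by (rule block_interpolation)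
  then obtain Z where "Z \<in> lcarrier (gl n T)" and Z: "\<forall>p\<in>S. block_map N \<pi> \<chi> (ev p) Z = Y p" ..
  have rep: "block_rep T m (ev p) n N \<pi> \<chi>" if "p \<in> S" for p
    using that S(2) blocks by (intro block_rep.intro block_rep_axioms.intro matrix_rep_ev) auto
  have one: "1 \<in> {1..n}" using \<open>0 < n\<close> by simp
  define c where "c = avg (mat_trace n Z)"
  show thesis
  proof (rule that[of "Z - e_mat 1 1 c"])
    show "Z - e_mat 1 1 c \<in> lcarrier (gl n T)"
      using \<open>Z \<in> lcarrier (gl n T)\<close> e_mat_gl[OF one one] by (rule mat.subspace_diff[OF gl_subspace])
    show "avg (mat_trace n (Z - e_mat 1 1 c)) = 0"
      unfolding mat_trace_diff mat_trace_e_mat[OF one] by (simp add: avg.diff c_def)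
    fix p assume p: "p \<in> S"
    interpret block_rep T m "ev p" n N \<pi> \<chi> using p by (rule rep)
    have "ev p u v c = 0" for u v
      using trace_block[of Z] Z p Y(2)[OF p] by (simp add: c_def ev_avg)
    then have "block (e_mat 1 1 c) = 0"
      unfolding block_eq_0_iff[OF e_mat_gl[OF one one]] by (simp add: e_mat_def)
    then show "block (Z - e_mat 1 1 c) = Y p" using Z p by (simp add: block_diff)
  qed
qed

end

lemma involution_transversal:
  assumes "finite S" and involution: "\<And>p. \<sigma> (\<sigma> p) = p" and fixed_point_free: "\<And>p. p \<in> S \<Longrightarrow> \<sigma> p \<noteq> p"
  obtains S' where "S' \<subseteq> S" "S' \<inter> \<sigma> ` S' = {}" "S \<subseteq> S' \<union> \<sigma> ` S'"
proof -
  have "\<exists>S'\<subseteq>S. S' \<inter> \<sigma> ` S' = {} \<and> S \<subseteq> S' \<union> \<sigma> ` S'"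
    using assms(1) fixed_point_free
  proof (induction S rule: finite_induct)
    case (insert p S)
    then obtain S' where S': "S' \<subseteq> S" "S' \<inter> \<sigma> ` S' = {}" "S \<subseteq> S' \<union> \<sigma> ` S'" by auto
    show ?case
    proof (cases "p \<in> \<sigma> ` S'")
      case True
      then show ?thesis using S' by (intro exI[of _ S']) auto
    next
      case False
      moreover have "\<sigma> p \<notin> S'" using False involution by (metis imageI)
      moreover have "\<sigma> p \<noteq> p" using insert.prems by simp
      ultimately show ?thesis using S' by (intro exI[of _ "insert p S'"]) auto
    qed
  qed simp
  then show thesis using that by blast
qed

lemma lie_hom_restrict:
  assumes "lie_hom L M f" "H \<subseteq> lcarrier L" "f ` H \<subseteq> K"
  shows "lie_hom (L\<lparr>lcarrier := H\<rparr>) (M\<lparr>lcarrier := K\<rparr>) f"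
proof -
  have "x \<in> lcarrier L" if "x \<in> H" for x using assms(2) that by blast
  then show ?thesis using assms(1,3) by (simp add: lie_hom_def)
qed

lemma complex_averaging_algebra: "averaging_algebra complex_algebra {(1, 1)}"
  by (intro averaging_algebra.intro averaging_algebra_axioms.intro inv_algebra_complex)
    (auto simp: complex_algebra_simps)

lemma lie_subalgebra_sl: "lie_subalgebra (lcarrier (sl N)) (gl N complex_algebra)"
proof -
  interpret averaging_algebra complex_algebra "{(1, 1)}" by (rule complex_averaging_algebra)
  have "avg a = a" for a by (simp add: avg_def complex_algebra_simps)
  then show ?thesis using lie_subalgebra_avg_trace_0[of N] by (simp add: sl_def mat_trace_def)
qed

locale torus_rep = torus q \<theta>1 \<theta>2 +
    unitary_rep "quantum_torus q \<theta>1 \<theta>2" "torus.conjugators q" n \<rho> s B \<phi>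
  for q \<theta>1 \<theta>2 :: complex and n \<rho> and s :: "complex \<Rightarrow> 'v::ab_group_add \<Rightarrow> 'v" and B \<phi>
begin

notation unitary_carrier ("\<g>") and gl_carrier ("\<g>\<l>")

lemma root_ideal_eq_ev_kernel:
  "\<exists>S. finite S \<and> S \<subseteq> torus_points \<and> inj_on (\<lambda>p. (fst p ^ m, snd p ^ m)) S \<and>
    (\<forall>x. x \<in> root_ideal \<longleftrightarrow> (\<forall>p\<in>S. \<forall>u<m. \<forall>v<m. ev p u v x = 0))"
proof -
  have spectrum: "\<exists>A. finite A \<and> 0 \<notin> A \<and> alg_eval z (\<Prod>a\<in>A. [:- a, 1:]) \<in> root_ideal"
    if central: "\<And>b. z \<cdot> b = b \<cdot> z" and inverse: "z' \<cdot> z = \<one>" for z z'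
  proof -
    obtain P where P: "P \<noteq> 0" "alg_eval z P \<in> root_ideal" by (rule ex_alg_eval_mem_root_ideal)
    obtain A where "finite A" "0 \<notin> A" "alg_eval z (\<Prod>a\<in>A. [:- a, 1:]) \<in> root_ideal"
      by (rule central_unit_spectrum[OF alg_ideal_axioms central_mem_if_square_mem P central
          inverse])
    then show ?thesis by blast
  qed
  obtain A1 where A1: "finite A1" "0 \<notin> A1" "alg_eval z1 (\<Prod>a\<in>A1. [:- a, 1:]) \<in> root_ideal"
    using spectrum[OF z1_central z1_inverse] by (elim exE conjE)
  obtain A2 where A2: "finite A2" "0 \<notin> A2" "alg_eval z2 (\<Prod>a\<in>A2. [:- a, 1:]) \<in> root_ideal"
    using spectrum[OF z2_central z2_inverse] by (elim exE conjE)
  show ?thesis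
    by (rule alg_ideal_eq_ev_kernel[OF alg_ideal_axioms A1 A2]) blast
qed

lemma trace_block_unitary:
  assumes "block_rep T m (ev p) (2 * n) N \<pi> \<chi>" "X \<in> \<g>"
  shows "mat_trace N (block_map N \<pi> \<chi> (ev p) X) = 0"
proof -
  have "avg (tr X) = 0" using assms(2) by (rule avg_trace_unitary)
  then have "(\<Sum>w<m. ev p w w (tr X)) = 0" using ev_avg[of p 0 0 "tr X"] by simp
  then show ?thesis unfolding block_rep.trace_block[OF assms(1)] .
qed

lemma annihilator_quotient_isomorphic:
  assumes S: "finite S" "S \<subseteq> torus_points"
    and blocks: "\<And>p. p \<in> S \<Longrightarrow> block_rep T m (ev p) (2 * n) N \<pi> \<chi>"
    and K: "lie_subalgebra K (gl N complex_algebra)"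
    and into: "\<And>p X. p \<in> S \<Longrightarrow> X \<in> \<g> \<Longrightarrow> block_map N \<pi> \<chi> (ev p) X \<in> K"
    and onto: "\<And>Y. (\<And>p. p \<in> S \<Longrightarrow> Y p \<in> K) \<Longrightarrow> \<exists>X\<in>\<g>. \<forall>p\<in>S. block_map N \<pi> \<chi> (ev p) X = Y p"
    and kernel: "\<And>X. X \<in> \<g> \<Longrightarrow> (\<forall>i j. X i j \<in> root_ideal) \<longleftrightarrow>
      (\<forall>p\<in>S. block_map N \<pi> \<chi> (ev p) X = 0)"
  shows "lie_isomorphic (lie_quotient (g_lie n \<rho> T) (lie_annihilator (g_lie n \<rho> T) \<phi>))
    (lie_power ((gl N complex_algebra)\<lparr>lcarrier := K\<rparr>) (card S))"
proof -
  let ?K = "(gl N complex_algebra)\<lparr>lcarrier := K\<rparr>"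
  have "lie_isomorphic
      (lie_quotient (g_lie n \<rho> T) {X \<in> \<g>. \<forall>p\<in>S. block_map N \<pi> \<chi> (ev p) X = lzero ?K})
      (lie_power ?K (card S))"
  proof (rule lie_quotient_power_isomorphic[OF lie_algebra_unitary _ S(1)])
    show "lie_algebra ?K"
      by (rule lie_algebra_subalgebra[OF inv_algebra.lie_algebra_gl[OF inv_algebra_complex] K])
    fix p assume p: "p \<in> S"
    have "lie_hom (gl (2 * n) T) (gl N complex_algebra) (block_map N \<pi> \<chi> (ev p))"
      by (rule block_rep.lie_hom_block[OF blocks[OF p]])
    then have "lie_hom ((gl (2 * n) T)\<lparr>lcarrier := \<g>\<rparr>) ?K (block_map N \<pi> \<chi> (ev p))"
      using unitary_subset_gl by (rule lie_hom_restrict) (use into[OF p] in blast)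
    then show "lie_hom (g_lie n \<rho> T) ?K (block_map N \<pi> \<chi> (ev p))"
      by (simp add: g_lie_def lie_generate_def)
  qed (simp add: onto)
  also have "{X \<in> \<g>. \<forall>p\<in>S. block_map N \<pi> \<chi> (ev p) X = lzero ?K} = lie_annihilator (g_lie n \<rho> T) \<phi>"
    by (simp add: set_eq_iff mem_ideal_iff kernel gl_complex_simps cong: conj_cong)
  finally show ?thesis .
qed

lemma entries_mem_root_ideal_iff:
  assumes "S \<subseteq> torus_points"
    and kernel: "\<forall>x. x \<in> root_ideal \<longleftrightarrow> (\<forall>p\<in>S. \<forall>u<m. \<forall>v<m. ev p u v x = 0)"
    and blocks: "\<And>p. p \<in> torus_points \<Longrightarrow> block_rep T m (ev p) (2 * n) N \<pi> \<chi>"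
    and "X \<in> \<g>"
  shows "(\<forall>i j. X i j \<in> root_ideal) \<longleftrightarrow> (\<forall>p\<in>S. block_map N \<pi> \<chi> (ev p) X = 0)"
proof -
  have "block_map N \<pi> \<chi> (ev p) X = 0 \<longleftrightarrow> (\<forall>i j. \<forall>u<m. \<forall>v<m. ev p u v (X i j) = 0)" if "p \<in> S" for p
    using assms(1,4) that unitary_subset_gl by (intro block_rep.block_eq_0_iff[OF blocks]) auto
  then show ?thesis using kernel by auto
qed

end


section \<open>Commutative tori with a nontrivial involution\<close>

context torus_rep
begin

definition dual_point :: "complex \<times> complex \<Rightarrow> complex \<times> complex" where
  "dual_point p = (\<theta>1 * fst p, \<theta>2 * snd p)"

lemma dual_point_dual_point [simp]: "dual_point (dual_point p) = p"
  using signs by (auto simp: dual_point_def prod_eq_iff)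

lemma dual_point_torus_points: "p \<in> torus_points \<Longrightarrow> dual_point p \<in> torus_points"
  using signs by (auto simp: dual_point_def torus_points_def)

lemma ev_star_commutative:
  assumes "q = 1"
  shows "ev p u v (x\<^sup>\<dagger>) = ev (dual_point p) u v x"
proof (induction x rule: torus_induct)
  case (single k c)
  obtain a b where "k = (a, b)" by (cases k)
  then show ?case
    by (simp add: T_simps torus_star_single ev_single dual_point_def power_int_mult_distrib)
      (simp add: assms)
qed (simp_all add: star_add ev_add)

lemma sl_block_rep:
  assumes "q = 1" "p \<in> torus_points"
  shows "block_rep T m (ev p) (2 * n) (2 * n) (\<lambda>a. (a, 0)) (\<lambda>a. 1)"
proof -
  have "m = 1" using assms(1) q_cases by auto
  then have "bij_betw (\<lambda>a. (a, 0)) {1..2 * n} ({1..2 * n} \<times> {..<m})"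
    by (intro bij_betw_byWitness[where f' = fst]) auto
  then show ?thesis
    using matrix_rep_ev[OF assms(2)] by (simp add: block_rep_def block_rep_axioms_def)
qed

abbreviation sl_block where "sl_block p \<equiv> block_map (2 * n) (\<lambda>a. (a, 0)) (\<lambda>a. 1) (ev p)"

lemma sl_block_adj_eq_0_iff:
  assumes "q = 1" "p \<in> torus_points" "X \<in> \<g>\<l>"
  shows "sl_block p (adj X) = 0 \<longleftrightarrow> sl_block (dual_point p) X = 0"
proof -
  interpret p: matrix_rep T m "ev p" using assms(2) by (rule matrix_rep_ev)
  have "ev p u v (adj X i j) = 0 \<longleftrightarrow> ev (dual_point p) u v (X (opp j) (opp i)) = 0" for u v i j
    using rho by (auto simp: adj_def p.rep_scale ev_star_commutative[OF assms(1)] sign_def)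
  then have "sl_block p (adj X) = 0 \<longleftrightarrow>
      (\<forall>i j. \<forall>u<m. \<forall>v<m. ev (dual_point p) u v (X (opp j) (opp i)) = 0)"
    unfolding block_rep.block_eq_0_iff[OF sl_block_rep[OF assms(1,2)] adj_gl[OF assms(3)]] by simp
  also have "\<dots> \<longleftrightarrow> (\<forall>i j. \<forall>u<m. \<forall>v<m. ev (dual_point p) u v (X i j) = 0)"
    by (metis opp_opp)
  finally show ?thesis
    using block_rep.block_eq_0_iff[OF sl_block_rep[OF assms(1) dual_point_torus_points]] assms
    by simp
qed

lemma sl_block_mem_sl:
  assumes "q = 1" "p \<in> torus_points" "X \<in> \<g>"
  shows "sl_block p X \<in> lcarrier (sl (2 * n))"
  using trace_block_unitary[OF sl_block_rep[OF assms(1,2)] assms(3)]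
    block_map_gl[of "2 * n" "\<lambda>a. (a, 0)" "\<lambda>a. 1" "ev p" X]
  by (simp add: sl_def mat_trace_def)

text \<open>Interpolating \<open>0\<close> at the dual points makes the adjoint vanish on \<open>S\<close>, so that taking the skew
  part does not change the values on \<open>S\<close>.\<close>

lemma sl_block_interpolation:
  assumes q: "q = 1" and S: "finite S" "S \<subseteq> torus_points" and disjoint: "S \<inter> dual_point ` S = {}"
    and Y: "\<And>p. p \<in> S \<Longrightarrow> Y p \<in> lcarrier (sl (2 * n))"
  shows "\<exists>X\<in>\<g>. \<forall>p\<in>S. sl_block p X = Y p"
proof -
  have m: "m = 1" using q_cases q by auto
  let ?S = "S \<union> dual_point ` S"
  define Y' where "Y' p = (if p \<in> S then Y p else 0)" for p
  obtain Z where Z: "Z \<in> \<g>\<l>" "avg (tr Z) = 0" "\<And>p. p \<in> ?S \<Longrightarrow> sl_block p Z = Y' p"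
  proof (rule block_interpolation_traceless[where S = ?S and Y = Y' and \<chi> = "\<lambda>a. 1"])
    show "finite ?S" "?S \<subseteq> torus_points" using S dual_point_torus_points by auto
    show "inj_on (\<lambda>p. (fst p ^ m, snd p ^ m)) ?S" by (simp add: m inj_on_def)
    show "bij_betw (\<lambda>a. (a, 0)) {1..2 * n} ({1..2 * n} \<times> {..<m})"
      by (rule bij_betw_byWitness[where f' = fst]) (auto simp: m)
    show "Y' p \<in> lcarrier (gl (2 * n) complex_algebra)" "mat_trace (2 * n) (Y' p) = 0" for p
      using Y by (auto simp: Y'_def sl_def mat_trace_def gl_def)
  qed (use three_le in simp_all)
  show ?thesis
  proof (intro bexI ballI)
    show "skew_part Z \<in> \<g>" using Z(1,2) by (rule skew_part_mem_unitary)
    fix p assume p: "p \<in> S"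
    then have p_point: "p \<in> torus_points" using S(2) by blast
    have "dual_point p \<notin> S" using p disjoint by blast
    then have "sl_block p (adj Z) = 0"
      using Z(3)[of "dual_point p"] p by (simp add: Y'_def sl_block_adj_eq_0_iff[OF q p_point Z(1)])
    then show "sl_block p (skew_part Z) = Y p"
      using Z(3)[of p] p
      by (simp add: Y'_def skew_part_def block_rep.block_diff[OF sl_block_rep[OF q p_point]])
  qed
qed

lemma sl_block_dual_point_eq_0_iff:
  assumes "q = 1" "p \<in> torus_points" "X \<in> \<g>"
  shows "sl_block (dual_point p) X = 0 \<longleftrightarrow> sl_block p X = 0"
proof -
  have "X \<in> \<g>\<l>" using assms(3) unitary_subset_gl by blast
  then have "sl_block (dual_point p) X = 0 \<longleftrightarrow> sl_block p (adj X) = 0"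
    using assms(1,2) by (intro sl_block_adj_eq_0_iff[symmetric])
  then show ?thesis
    by (simp add: adj_unitary[OF assms(3)] block_rep.block_minus[OF sl_block_rep[OF assms(1,2)]])
qed

theorem quotient_isomorphic_sl_power:
  assumes q: "q = 1" and \<theta>2: "\<theta>2 = -1"
  shows "\<exists>k. lie_isomorphic (lie_quotient (g_lie n \<rho> T) (lie_annihilator (g_lie n \<rho> T) \<phi>))
    (lie_power (sl (2 * n)) k)"
proof -
  obtain S where S: "finite S" "S \<subseteq> torus_points"
    and kernel: "\<forall>x. x \<in> root_ideal \<longleftrightarrow> (\<forall>p\<in>S. \<forall>u<m. \<forall>v<m. ev p u v x = 0)"
    using root_ideal_eq_ev_kernel by (elim exE conjE)
  have "dual_point p \<noteq> p" if "p \<in> S" for p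
    using that S(2) unfolding dual_point_def by (auto simp: torus_points_def prod_eq_iff \<theta>2)
  then obtain S' where S': "S' \<subseteq> S" "S' \<inter> dual_point ` S' = {}" "S \<subseteq> S' \<union> dual_point ` S'"
    using involution_transversal[OF S(1) dual_point_dual_point] by metis
  have points: "finite S'" "S' \<subseteq> torus_points"
    using S S'(1) by (auto intro: finite_subset)
  have "lie_isomorphic (lie_quotient (g_lie n \<rho> T) (lie_annihilator (g_lie n \<rho> T) \<phi>))
    (lie_power ((gl (2 * n) complex_algebra)\<lparr>lcarrier := lcarrier (sl (2 * n))\<rparr>) (card S'))"
  proof (rule annihilator_quotient_isomorphic[OF points _ lie_subalgebra_sl])
    show "block_rep T m (ev p) (2 * n) (2 * n) (\<lambda>a. (a, 0)) (\<lambda>a. 1)" if "p \<in> S'" for p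
      using that points(2) by (intro sl_block_rep q) blast
    show "sl_block p X \<in> lcarrier (sl (2 * n))" if "p \<in> S'" "X \<in> \<g>" for p X
      using that points(2) by (intro sl_block_mem_sl q) blast
    show "\<exists>X\<in>\<g>. \<forall>p\<in>S'. sl_block p X = Y p" if "\<And>p. p \<in> S' \<Longrightarrow> Y p \<in> lcarrier (sl (2 * n))" for Y
      using q points S'(2) that by (rule sl_block_interpolation)
    fix X assume X: "X \<in> \<g>"
    have "(\<forall>p\<in>S. sl_block p X = 0) \<longleftrightarrow> (\<forall>p\<in>S'. sl_block p X = 0)"
      using S'(1,3) points(2) sl_block_dual_point_eq_0_iff[OF q _ X] by blast
    then show "(\<forall>i j. X i j \<in> root_ideal) \<longleftrightarrow> (\<forall>p\<in>S'. sl_block p X = 0)"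
      using entries_mem_root_ideal_iff[OF S(2) kernel sl_block_rep[OF q] X] by simp
  qed
  also have "(gl (2 * n) complex_algebra)\<lparr>lcarrier := lcarrier (sl (2 * n))\<rparr> = sl (2 * n)"
    by (simp add: sl_def)
  finally show ?thesis by blast
qed

end

section \<open>Simple quotients of orthogonal and symplectic type\<close>

definition block_pos :: "nat \<Rightarrow> nat \<Rightarrow> nat \<times> nat" where
  "block_pos m a = ((a - 1) div m + 1, (a - 1) mod m)"

lemma bij_betw_block_pos:
  assumes "0 < m"
  shows "bij_betw (block_pos m) {1..m * N} ({1..N} \<times> {..<m})"
proof (rule bij_betw_byWitness[where f' = "\<lambda>(p, u). m * (p - 1) + u + 1"])
  show "block_pos m ` {1..m * N} \<subseteq> {1..N} \<times> {..<m}"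
  proof (clarsimp simp: block_pos_def assms)
    fix a assume "Suc 0 \<le> a" "a \<le> m * N"
    then have "a - Suc 0 < N * m" by (simp add: mult.commute)
    then show "Suc ((a - Suc 0) div m) \<le> N"
      using assms by (simp add: div_less_iff_less_mult Suc_le_eq)
  qed
  show "(\<lambda>(p, u). m * (p - 1) + u + 1) ` ({1..N} \<times> {..<m}) \<subseteq> {1..m * N}"
  proof clarsimp
    fix p u assume p: "Suc 0 \<le> p" "p \<le> N" and "u < m"
    then have "m * (p - Suc 0) + u < m * (p - Suc 0) + m" by simp
    also have "\<dots> = m * p" using p(1) by (cases p) simp_all
    also have "\<dots> \<le> m * N" using p(2) by simp
    finally show "Suc (m * (p - Suc 0) + u) \<le> m * N" by simp
  qed
qed (auto simp: block_pos_def)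

lemma block_pos_le_iff:
  assumes "0 < m" "1 \<le> a"
  shows "fst (block_pos m a) \<le> n \<longleftrightarrow> a \<le> m * n"
proof -
  have "fst (block_pos m a) \<le> n \<longleftrightarrow> (a - 1) div m < n" by (auto simp: block_pos_def)
  also have "\<dots> \<longleftrightarrow> a - 1 < n * m" by (rule div_less_iff_less_mult) (rule assms)
  finally show ?thesis using assms(2) by (auto simp: mult.commute)
qed

lemma block_pos_add:
  assumes "0 < m" "1 \<le> a"
  shows "block_pos m (a + m * n) = (fst (block_pos m a) + n, snd (block_pos m a))"
proof -
  have "a + m * n - 1 = (a - 1) + m * n" using assms(2) by simp
  then show ?thesis using assms(1) by (simp add: block_pos_def)
qed

locale orthosymplectic_torus_rep = torus_rep +
  assumes params: "(q, \<theta>1, \<theta>2) \<in> torus_params"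
    and orthosymplectic: "q = -1 \<or> (q, \<theta>1, \<theta>2) = (1, 1, 1)"
begin

notation unitary_carrier ("\<g>") and gl_carrier ("\<g>\<l>")

sublocale complex: averaging_unitary complex_algebra "{(1, 1)}" "m * n" "\<theta>1 * \<rho>"
proof (intro averaging_unitary.intro averaging_unitary_axioms.intro complex_averaging_algebra
    unitary.intro unitary_axioms.intro inv_algebra_complex)
  show "\<theta>1 * \<rho> = 1 \<or> \<theta>1 * \<rho> = -1" using signs(2) rho by auto
  show "3 \<le> m * n" using q_cases three_le by auto
qed

text \<open>By \<open>ev_star\<close> below, the involution of the torus becomes the transposition of $m \times m$
  matrices up to the permutation \<open>star_flip\<close> of the rows and their rescaling by powers of \<open>\<theta>2\<close>.
  Permuting and rescaling the rows of the lower half in this way makes the block maps intertwine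
  the adjoints.\<close>

definition star_flip :: "nat \<Rightarrow> nat" where
  "star_flip u = (if \<theta>1 = 1 then u else 1 - u)"

definition block_index :: "nat \<Rightarrow> nat \<times> nat" where
  "block_index a = (case block_pos m a of (p, u) \<Rightarrow> (p, if p \<le> n then u else star_flip u))"

definition block_sign :: "nat \<Rightarrow> complex" where
  "block_sign a = (case block_pos m a of (p, u) \<Rightarrow> if p \<le> n then 1 else \<theta>2 ^ u)"

abbreviation block where "block p \<equiv> block_map (2 * (m * n)) block_index block_sign (ev p)"

lemma sign_cases:
  "q = -1 \<and> m = 2 \<and> \<theta>1 = -1 \<and> \<theta>2 = -1 \<or> q = -1 \<and> m = 2 \<and> \<theta>1 = 1 \<or>
   q = 1 \<and> m = 1 \<and> \<theta>1 = 1 \<and> \<theta>2 = 1"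
  using params orthosymplectic q_cases by (auto simp: torus_params_def)

lemma star_flip_star_flip: "u < m \<Longrightarrow> star_flip (star_flip u) = u"
  and star_flip_less: "u < m \<Longrightarrow> star_flip u < m"
  and theta2_power_star_flip: "u < m \<Longrightarrow> \<theta>2 ^ star_flip u = \<theta>1 * \<theta>2 ^ u"
  using sign_cases by (auto simp: star_flip_def less_2_cases_iff)

lemma theta2_power_square: "\<theta>2 ^ u * \<theta>2 ^ u = 1"
  using signs(3) by (auto simp: power_mult_distrib[symmetric])

lemma bij_betw_block_index: "bij_betw block_index {1..2 * (m * n)} ({1..2 * n} \<times> {..<m})"
proof -
  define flip where "flip = (\<lambda>(p, u). (p, if p \<le> n then u else star_flip u))"
  have "bij_betw flip ({1..2 * n} \<times> {..<m}) ({1..2 * n} \<times> {..<m})"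
    by (rule bij_betw_byWitness[where f' = flip])
      (auto simp: flip_def star_flip_star_flip star_flip_less)
  then have "bij_betw (flip \<circ> block_pos m) {1..m * (2 * n)} ({1..2 * n} \<times> {..<m})"
    by (rule bij_betw_trans[OF bij_betw_block_pos[OF m_pos(1)]])
  then show ?thesis by (simp add: comp_def flip_def block_index_def[abs_def] mult.left_commute)
qed

lemma block_sign_square: "block_sign a * block_sign a = 1"
  by (simp add: block_sign_def case_prod_unfold theta2_power_square)

lemma block_rep_block:
  "p \<in> torus_points \<Longrightarrow> block_rep T m (ev p) (2 * n) (2 * (m * n)) block_index block_sign"
  by (intro block_rep.intro block_rep_axioms.intro matrix_rep_ev bij_betw_block_index
    block_sign_square)

lemma block_index_opp:
  assumes "a \<in> complex.idx" "block_index a = (p, u)"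
  shows "block_index (complex.opp a) = (opp p, star_flip u)"
    and "block_sign a * (sign p * \<theta>2 ^ u) = complex.sign a * block_sign (complex.opp a)"
proof -
  obtain p' w where pos: "block_pos m a = (p', w)" by (cases "block_pos m a")
  have range: "p' \<in> {1..2 * n}" "w < m"
    using bij_betwE[OF bij_betw_block_pos[OF m_pos(1)], of "2 * n"] assms(1) pos
    by (auto simp: complex.idx_def mult.left_commute dest: bspec[of _ _ a])
  have half: "a \<le> m * n \<longleftrightarrow> p' \<le> n"
    using block_pos_le_iff[OF m_pos(1), of a n] assms(1) pos by (simp add: complex.idx_def)
  have "block_index (complex.opp a) = (opp p, star_flip u) \<and>
    block_sign a * (sign p * \<theta>2 ^ u) = complex.sign a * block_sign (complex.opp a)"
  proof (cases "p' \<le> n")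
    case True
    then have "block_pos m (complex.opp a) = (p' + n, w)"
      using block_pos_add[OF m_pos(1), of a n] assms(1) pos half
      by (simp add: complex.idx_def complex.opp_def)
    then show ?thesis
      using True assms(2) range pos half
      by (auto simp: block_index_def block_sign_def opp_def sign_def complex.sign_def)
  next
    case False
    then have "complex.opp a + m * n = a" "1 \<le> complex.opp a"
      using assms(1) half by (auto simp: complex.idx_def complex.opp_def)
    then have "block_pos m (complex.opp a) = (p' - n, w)"
      using block_pos_add[OF m_pos(1), of "complex.opp a" n] pos
      by (cases "block_pos m (complex.opp a)") simp
    then show ?thesis
      using False assms(2) range pos half theta2_power_square[of w]
      by (auto simp: block_index_def block_sign_def opp_def sign_def complex.sign_def
          star_flip_star_flip theta2_power_star_flip)
  qed
  then show "block_index (complex.opp a) = (opp p, star_flip u)"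
    and "block_sign a * (sign p * \<theta>2 ^ u) = complex.sign a * block_sign (complex.opp a)" by simp_all
qed

lemma ev_star:
  assumes "u < m" "v < m"
  shows "ev p u v (x\<^sup>\<dagger>) = \<theta>2 ^ u * \<theta>2 ^ v * ev p (star_flip v) (star_flip u) x"
proof (induction x rule: torus_induct)
  case (single k c)
  obtain x y where k: "k = (x, y)" by (cases k)
  have parity: "int m dvd int (star_flip v) + y - int (star_flip u) \<longleftrightarrow> int m dvd int u + y - int v"
    using sign_cases assms by (auto simp: star_flip_def)
  have "\<theta>1 powi x * (\<theta>2 powi y * (q powi (x * y) * q powi (int u * x))) =
      \<theta>2 ^ u * (\<theta>2 ^ v * q powi (int (star_flip v) * x))" if dvd: "int m dvd int u + y - int v"
  proof -
    have "\<theta>2 powi y = \<theta>2 ^ u * \<theta>2 ^ v"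
      using sign_cases signs(3) dvd assms
      by (elim disjE conjE; auto simp: power_int_minus_left less_2_cases_iff split: if_splits)
    moreover have "q powi (x * y) * q powi (int u * x) = q powi (int v * x)"
      using q_power_int_mult_cong[OF dvd, of x]
      by (simp add: power_int_add ring_distribs mult.commute)
    moreover have "\<theta>1 powi x * q powi (int v * x) = q powi (int (star_flip v) * x)"
      using sign_cases assms(2) by (auto simp: star_flip_def power_int_minus_left less_2_cases_iff)
    ultimately show ?thesis by (simp add: mult_ac)
  qed
  then show ?case
    unfolding k T_simps torus_star_single ev_single parity by auto
qed (simp_all add: star_add ev_add distrib_left)

lemma block_adj:
  assumes "p \<in> torus_points"
  shows "block p (adj X) = complex.adj (block p X)"
proof (intro ext)
  fix a b
  show "block p (adj X) a b = complex.adj (block p X) a b"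
  proof (cases "a \<in> complex.idx \<and> b \<in> complex.idx")
    case True
    interpret ev: matrix_rep T m "ev p" using assms by (rule matrix_rep_ev)
    obtain i u j v where index: "block_index a = (i, u)" "block_index b = (j, v)"
      by (cases "block_index a", cases "block_index b")
    have range: "u < m" "v < m"
      using bij_betwE[OF bij_betw_block_index] True index
      by (auto simp: complex.idx_def mem_Times_iff dest: bspec[of _ _ a] bspec[of _ _ b])
    have signs: "block_sign a * (sign i * \<theta>2 ^ u) = complex.sign a * block_sign (complex.opp a)"
      "block_sign b * (sign j * \<theta>2 ^ v) = complex.sign b * block_sign (complex.opp b)"
      using True index by (simp_all only: block_index_opp(2))
    have "block p (adj X) a b = block_sign a * block_sign b * ev p u v (adj X i j)"
      using True by (simp add: block_map_def complex.idx_def index)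
    also have "\<dots> = (block_sign a * (sign i * \<theta>2 ^ u)) * (block_sign b * (sign j * \<theta>2 ^ v)) *
        ev p (star_flip v) (star_flip u) (X (opp j) (opp i))"
      by (simp add: adj_def ev.rep_scale ev_star[OF range] mult_ac)
    also have "\<dots> = complex.sign a * complex.sign b *
        (block_sign (complex.opp b) * block_sign (complex.opp a) *
         ev p (star_flip v) (star_flip u) (X (opp j) (opp i)))"
      unfolding signs by (simp only: mult_ac)
    also have "\<dots> = complex.sign a * complex.sign b * block p X (complex.opp b) (complex.opp a)"
    proof -
      have "complex.opp a \<in> complex.idx" "complex.opp b \<in> complex.idx" using True by simp_all
      then show ?thesis
        using True index by (simp add: block_map_def complex.idx_def block_index_opp(1))
    qed
    also have "\<dots> = complex.adj (block p X) a b" by (simp add: complex.adj_def complex_algebra_simps)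
    finally show ?thesis .
  next
    case False
    then show ?thesis
      using complex.opp_mem_idx[of a] complex.opp_mem_idx[of b]
      by (auto simp: block_map_def complex.adj_def complex_algebra_simps complex.idx_def)
  qed
qed

lemma complex_avg [simp]: "complex.avg c = c"
  by (simp add: complex.avg_def complex_algebra_simps)

lemma mem_complex_unitary_iff:
  "Y \<in> complex.unitary_carrier \<longleftrightarrow> Y \<in> complex.gl_carrier \<and> complex.adj Y = - Y"
proof -
  have "complex.tr Y = 0" if "complex.adj Y = - Y"
    using complex.trace_adj[of Y] that by (simp add: complex_algebra_simps mat_trace_def sum_negf)
  then show ?thesis unfolding complex.mem_unitary_iff complex_avg by blast
qed

lemma block_mem_unitary:
  assumes "p \<in> torus_points" "X \<in> \<g>"
  shows "block p X \<in> complex.unitary_carrier"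
  by (simp add: mem_complex_unitary_iff block_map_gl adj_unitary[OF assms(2)]
    block_rep.block_minus[OF block_rep_block[OF assms(1)]] flip: block_adj[OF assms(1)])

lemma block_unitary_interpolation:
  assumes S: "finite S" "S \<subseteq> torus_points" "inj_on (\<lambda>p. (fst p ^ m, snd p ^ m)) S"
    and Y: "\<And>p. p \<in> S \<Longrightarrow> Y p \<in> complex.unitary_carrier"
  shows "\<exists>X\<in>\<g>. \<forall>p\<in>S. block p X = Y p"
proof -
  obtain Z where Z: "Z \<in> \<g>\<l>" "avg (tr Z) = 0"
    "\<And>p. p \<in> S \<Longrightarrow> block p Z = (\<lambda>a b. (1 / 2) * Y p a b)"
  proof (rule block_interpolation_traceless[OF S bij_betw_block_index, where \<chi> = block_sign])
    fix p assume "p \<in> S"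
    then have "Y p \<in> complex.gl_carrier" "complex.tr (Y p) = 0"
      using Y[of p] by (auto simp: complex.mem_unitary_iff)
    then show "(\<lambda>a b. (1 / 2) * Y p a b) \<in> complex.gl_carrier"
      "complex.tr (\<lambda>a b. (1 / 2) * Y p a b) = 0"
      by (simp_all add: gl_def mat_trace_def flip: sum_divide_distrib)
  qed (use three_le block_sign_square in simp_all)
  show ?thesis
  proof (intro bexI ballI)
    show "skew_part Z \<in> \<g>" using Z(1,2) by (rule skew_part_mem_unitary)
    fix p assume p: "p \<in> S"
    then have p_point: "p \<in> torus_points" using S(2) by blast
    have "complex.adj (Y p) = - Y p" using Y[OF p] by (rule complex.adj_unitary)
    then show "block p (skew_part Z) = Y p"
      unfolding skew_part_def block_rep.block_diff[OF block_rep_block[OF p_point]]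
        block_adj[OF p_point] Z(3)[OF p]
      by (simp add: complex.adj_def complex_algebra_simps fun_eq_iff)
  qed
qed

theorem quotient_isomorphic_g_lie_power:
  "\<exists>k. lie_isomorphic (lie_quotient (g_lie n \<rho> T) (lie_annihilator (g_lie n \<rho> T) \<phi>))
    (lie_power (g_lie (m * n) (\<theta>1 * \<rho>) complex_algebra) k)"
proof -
  obtain S where S: "finite S" "S \<subseteq> torus_points" "inj_on (\<lambda>p. (fst p ^ m, snd p ^ m)) S"
    and kernel: "\<forall>x. x \<in> root_ideal \<longleftrightarrow> (\<forall>p\<in>S. \<forall>u<m. \<forall>v<m. ev p u v x = 0)"
    using root_ideal_eq_ev_kernel by (elim exE conjE)
  have "lie_isomorphic (lie_quotient (g_lie n \<rho> T) (lie_annihilator (g_lie n \<rho> T) \<phi>))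
    (lie_power ((gl (2 * (m * n)) complex_algebra)\<lparr>lcarrier := complex.unitary_carrier\<rparr>) (card S))"
  proof (rule annihilator_quotient_isomorphic[OF S(1,2) _ complex.lie_subalgebra_unitary])
    show "block_rep T m (ev p) (2 * n) (2 * (m * n)) block_index block_sign" if "p \<in> S" for p
      using that S(2) by (intro block_rep_block) blast
    show "block p X \<in> complex.unitary_carrier" if "p \<in> S" "X \<in> \<g>" for p X
      using that S(2) by (intro block_mem_unitary) blast
    show "\<exists>X\<in>\<g>. \<forall>p\<in>S. block p X = Y p" if "\<And>p. p \<in> S \<Longrightarrow> Y p \<in> complex.unitary_carrier" for Y
      using S that by (rule block_unitary_interpolation)
    show "(\<forall>i j. X i j \<in> root_ideal) \<longleftrightarrow> (\<forall>p\<in>S. block p X = 0)" if "X \<in> \<g>" for X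
      using S(2) kernel block_rep_block that by (rule entries_mem_root_ideal_iff)
  qed
  also have "(gl (2 * (m * n)) complex_algebra)\<lparr>lcarrier := complex.unitary_carrier\<rparr> =
      g_lie (m * n) (\<theta>1 * \<rho>) complex_algebra"
    by (simp add: g_lie_def lie_generate_def)
  finally show ?thesis by blast
qed

end


theorem theorem5p3:
  fixes n :: nat and \<rho> q \<theta>1 \<theta>2 :: complex
    and s :: "complex \<Rightarrow> 'v::ab_group_add \<Rightarrow> 'v" and Basis :: "'v set"
    and \<phi> :: "(nat \<Rightarrow> nat \<Rightarrow> torus) \<Rightarrow> 'v \<Rightarrow> 'v"
  assumes "3 \<le> n" and "\<rho> \<in> {1, -1}" and "(q, \<theta>1, \<theta>2) \<in> torus_params"
    and "finite_dimensional_vector_space s Basis"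
    and "lie_irreducible (g_lie n \<rho> (quantum_torus q \<theta>1 \<theta>2)) s \<phi>"
    and "2 \<le> vector_space.dim s (UNIV :: 'v set)"
  shows
    "(q = -1 \<or> (q, \<theta>1, \<theta>2) = (1, 1, 1) \<longrightarrow>
       (\<exists>k::nat. lie_isomorphic
          (lie_quotient (g_lie n \<rho> (quantum_torus q \<theta>1 \<theta>2))
             (lie_annihilator (g_lie n \<rho> (quantum_torus q \<theta>1 \<theta>2)) \<phi>))
          (lie_power (g_lie (mult_order q * n) (\<theta>1 * \<rho>) complex_algebra) k))) \<and>
     ((q, \<theta>1, \<theta>2) = (1, 1, -1) \<or> (q, \<theta>1, \<theta>2) = (1, -1, -1) \<longrightarrow>
       (\<exists>k::nat. lie_isomorphic
          (lie_quotient (g_lie n \<rho> (quantum_torus q \<theta>1 \<theta>2))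
             (lie_annihilator (g_lie n \<rho> (quantum_torus q \<theta>1 \<theta>2)) \<phi>))
          (lie_power (sl (2 * n)) k)))"
proof -
  interpret torus q \<theta>1 \<theta>2
    using assms(3) by unfold_locales (auto simp: torus_params_def)
  interpret torus_rep q \<theta>1 \<theta>2 n \<rho> s Basis \<phi>
    by (intro torus_rep.intro unitary_rep.intro averaging_unitary.intro unitary.intro
        averaging_unitary_axioms.intro unitary_axioms.intro unitary_rep_axioms.intro
        torus_axioms averaging_algebra_axioms inv_algebra_axioms)
      (use assms in auto)
  show ?thesis
  proof (intro conjI impI)
    assume "q = -1 \<or> (q, \<theta>1, \<theta>2) = (1, 1, 1)"
    with assms(3) interpret orthosymplectic_torus_rep q \<theta>1 \<theta>2 n \<rho> s Basis \<phi>
      by unfold_locales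
    from quotient_isomorphic_g_lie_power
    show "\<exists>k. lie_isomorphic (lie_quotient (g_lie n \<rho> T) (lie_annihilator (g_lie n \<rho> T) \<phi>))
        (lie_power (g_lie (mult_order q * n) (\<theta>1 * \<rho>) complex_algebra) k)" unfolding m_def .
  next
    assume "(q, \<theta>1, \<theta>2) = (1, 1, -1) \<or> (q, \<theta>1, \<theta>2) = (1, -1, -1)"
    then show "\<exists>k. lie_isomorphic (lie_quotient (g_lie n \<rho> T) (lie_annihilator (g_lie n \<rho> T) \<phi>))
        (lie_power (sl (2 * n)) k)"
      by (intro quotient_isomorphic_sl_power) auto
  qed
qed

end
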